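(* If $D$ is a (fixed) disjoint union of spiders and one directed 2-cycle $C_2$, then the problem $\Pi_D$ (given a digraph $G$, does $G$ contain an induced subdivision of $D$?) is polynomial-time solvable.
   Context: All digraphs are finite and simple (no loops, no parallel arcs), but may contain directed 2-cycles. $C_2$ is the digraph on two vertices $a,b$ with the two arcs $ab$ and $ba$. A subdivision of a digraph $D$ is a digraph obtained from $D$ by replacing each arc $ab$ by a directed $(a,b)$-path of length at least 1, these paths being internally disjoint with new internal vertices. An induced subdivision of $D$ in $G$ is an induced subdigraph of $G$ that is (isomorphic to) a subdivision of $D$. For a fixed digraph $D$, $\Pi_D$ is the decision problem: Input: a digraph $G$ (2-cycles allowed). Question: does $G$ contain an induced subdivision of $D$? A vertex of a digraph is a node if its out-degree or its in-degree is at least 2. A spider is an oriented tree (a digraph whose underlying undirected graph is a tree) having at most one node. *)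

theory Defs
  imports
    "Graph_Theory.Graph_Theory"
    "HOL-Computational_Algebra.Polynomial"
begin

text \<open>
  A finite simple digraph (no loops, no parallel arcs, directed 2-cycles allowed) is a
  pair-digraph: the locale predicate \<open>pair_digraph\<close> of the Graph_Theory library.
  The library's notion of subdivision is for bidirected graphs (undirected subdivision), and its
  \<open>tree\<close> only excludes directed cycles; both are therefore defined anew here.
\<close>

section \<open>Subdivisions\<close>

definition inner_vertices :: "'v list \<Rightarrow> 'v set" where
  "inner_vertices p = set (butlast (tl p))"

text \<open>
  \<open>H\<close> is, up to isomorphism, a subdivision of \<open>D\<close>: \<open>f\<close> places the vertices of \<open>D\<close>, and \<open>P e\<close> is
  the vertex sequence of the directed path that replaces the arc \<open>e\<close>.
\<close>

definition is_subdivision_of :: "'v pair_pre_digraph \<Rightarrow> 'a pair_pre_digraph \<Rightarrow> bool" where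
  "is_subdivision_of H D \<longleftrightarrow> (\<exists>f P.
      inj_on f (pverts D) \<and>
      (\<forall>(a, b) \<in> parcs D. vpath (P (a, b)) (with_proj H) \<and> vwalk_length (P (a, b)) \<ge> 1 \<and>
         hd (P (a, b)) = f a \<and> last (P (a, b)) = f b) \<and>
      (\<forall>e \<in> parcs D. inner_vertices (P e) \<inter> f ` pverts D = {}) \<and>
      (\<forall>e \<in> parcs D. \<forall>e' \<in> parcs D. e \<noteq> e' \<longrightarrow>
         inner_vertices (P e) \<inter> inner_vertices (P e') = {}) \<and>
      pverts H = f ` pverts D \<union> (\<Union>e \<in> parcs D. set (P e)) \<and>
      parcs H = (\<Union>e \<in> parcs D. set (vwalk_arcs (P e))))"

definition contains_induced_subdivision ::
    "'v pair_pre_digraph \<Rightarrow> 'a pair_pre_digraph \<Rightarrow> bool" where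
  "contains_induced_subdivision G D \<longleftrightarrow>
     (\<exists>H :: 'v pair_pre_digraph.
        induced_subgraph (with_proj H) (with_proj G) \<and> is_subdivision_of H D)"

section \<open>Spiders, the directed 2-cycle, disjoint unions\<close>

definition is_C2 :: "'a pair_pre_digraph \<Rightarrow> bool" where
  "is_C2 C \<longleftrightarrow> (\<exists>a b. a \<noteq> b \<and> pverts C = {a, b} \<and> parcs C = {(a, b), (b, a)})"

text \<open>
  The first condition after \<open>pair_digraph\<close> says that \<open>T\<close> is an oriented graph; a directed 2-cycle is
  a pair of parallel edges in the underlying graph. \<open>connected\<close> is connectedness of the underlying
  undirected graph and excludes the empty digraph. An undirected cycle is a path with at least
  three vertices whose last and first vertex are adjacent.
\<close>

definition oriented_tree :: "'a pair_pre_digraph \<Rightarrow> bool" where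
  "oriented_tree T \<longleftrightarrow>
     pair_digraph T \<and>
     (\<forall>u v. (u, v) \<in> parcs T \<longrightarrow> (v, u) \<notin> parcs T) \<and>
     connected (with_proj T) \<and>
     \<not> (\<exists>c. length c \<ge> 3 \<and> vpath c (with_proj (mk_symmetric (with_proj T))) \<and>
            (last c, hd c) \<in> parcs (mk_symmetric (with_proj T)))"

definition is_node :: "'a pair_pre_digraph \<Rightarrow> 'a \<Rightarrow> bool" where
  "is_node G v \<longleftrightarrow> v \<in> pverts G \<and>
     (out_degree (with_proj G) v \<ge> 2 \<or> in_degree (with_proj G) v \<ge> 2)"

definition spider :: "'a pair_pre_digraph \<Rightarrow> bool" where
  "spider T \<longleftrightarrow> oriented_tree T \<and> (\<forall>u v. is_node T u \<and> is_node T v \<longrightarrow> u = v)"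

definition is_disjoint_union :: "'a pair_pre_digraph \<Rightarrow> 'a pair_pre_digraph set \<Rightarrow> bool" where
  "is_disjoint_union D Hs \<longleftrightarrow>
     (\<forall>H \<in> Hs. \<forall>K \<in> Hs. H \<noteq> K \<longrightarrow> pverts H \<inter> pverts K = {}) \<and>
     pverts D = (\<Union>H \<in> Hs. pverts H) \<and>
     parcs D = (\<Union>H \<in> Hs. parcs H)"

section \<open>Polynomial-time decidability\<close>

text \<open>
  Deterministic multi-tape Turing machines with two-way infinite tapes. States and tape symbols are
  initial segments of the naturals; the start state is 0. Symbol 0 is the blank, and the input
  bits are written as the symbols 1 (\<open>False\<close>) and 2 (\<open>True\<close>).
\<close>

datatype direction = Move_Left | Stay | Move_Right

record turing_machine =
  num_tapes :: nat
  num_states :: nat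
  num_symbols :: nat
  accept_state :: nat
  reject_state :: nat
  transition :: "nat \<Rightarrow> nat list \<Rightarrow> nat \<times> (nat \<times> direction) list"

definition wf_turing_machine :: "turing_machine \<Rightarrow> bool" where
  "wf_turing_machine M \<longleftrightarrow>
     num_tapes M \<ge> 1 \<and> num_states M \<ge> 1 \<and> num_symbols M \<ge> 3 \<and>
     accept_state M < num_states M \<and> reject_state M < num_states M \<and>
     accept_state M \<noteq> reject_state M \<and>
     (\<forall>q xs. q < num_states M \<and> length xs = num_tapes M \<and> set xs \<subseteq> {..<num_symbols M} \<longrightarrow>
        (case transition M q xs of (q', acts) \<Rightarrow>
           q' < num_states M \<and> length acts = num_tapes M \<and>
           fst ` set acts \<subseteq> {..<num_symbols M}))"

type_synonym tape = "(int \<Rightarrow> nat) \<times> int"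

type_synonym config = "nat \<times> tape list"

fun move_head :: "direction \<Rightarrow> int \<Rightarrow> int" where
  "move_head Move_Left h = h - 1"
| "move_head Stay h = h"
| "move_head Move_Right h = h + 1"

fun read_tape :: "tape \<Rightarrow> nat" where
  "read_tape (t, h) = t h"

fun act_on_tape :: "nat \<times> direction \<Rightarrow> tape \<Rightarrow> tape" where
  "act_on_tape (s, d) (t, h) = (t(h := s), move_head d h)"

fun tm_step :: "turing_machine \<Rightarrow> config \<Rightarrow> config" where
  "tm_step M (q, ts) =
     (if q = accept_state M \<or> q = reject_state M then (q, ts)
      else (case transition M q (map read_tape ts) of
              (q', acts) \<Rightarrow> (q', map2 act_on_tape acts ts)))"

definition input_tape :: "bool list \<Rightarrow> tape" where
  "input_tape w =
     ((\<lambda>i. if 0 \<le> i \<and> i < int (length w) then (if w ! nat i then 2 else 1) else 0), 0)"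

definition initial_config :: "turing_machine \<Rightarrow> bool list \<Rightarrow> config" where
  "initial_config M w = (0, input_tape w # replicate (num_tapes M - 1) ((\<lambda>_. 0), 0))"

definition decides_in_time :: "turing_machine \<Rightarrow> bool list set \<Rightarrow> (nat \<Rightarrow> nat) \<Rightarrow> bool" where
  "decides_in_time M L T \<longleftrightarrow>
     (\<forall>w. \<exists>t \<le> T (length w).
        fst ((tm_step M ^^ t) (initial_config M w)) =
          (if w \<in> L then accept_state M else reject_state M))"

definition polynomial_time_decidable :: "bool list set \<Rightarrow> bool" where
  "polynomial_time_decidable L \<longleftrightarrow>
     (\<exists>M (p :: nat poly). wf_turing_machine M \<and> decides_in_time M L (poly p))"

section \<open>The induced subdivision problem as a language\<close>

text \<open>
  An input digraph has vertex set \<open>{..<n}\<close>, which is no restriction up to isomorphism. It is given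
  as \<open>n\<close> in unary, a separator, and its adjacency matrix in row-major order. A word that encodes
  no digraph is not in the language.
\<close>

definition input_digraph :: "nat pair_pre_digraph \<Rightarrow> bool" where
  "input_digraph G \<longleftrightarrow> pair_digraph G \<and> (\<exists>n. pverts G = {..<n})"

definition encode_digraph :: "nat pair_pre_digraph \<Rightarrow> bool list" where
  "encode_digraph G =
     (let n = card (pverts G) in
        replicate n True @ False # [(u, v) \<in> parcs G. u \<leftarrow> [0..<n], v \<leftarrow> [0..<n]])"

definition induced_subdivision_problem :: "'a pair_pre_digraph \<Rightarrow> bool list set" where
  "induced_subdivision_problem D =
     {encode_digraph G | G. input_digraph G \<and> contains_induced_subdivision G D}"

lemma concat_map_upt_eq_iff:
  "concat (map (\<lambda>u. map (f u) [0..<n]) [0..<m]) = concat (map (\<lambda>u. map (g u) [0..<n]) [0..<m])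
     \<longleftrightarrow> (\<forall>u<m. \<forall>v<n. f u v = g u v)"
proof (induction m)
  case (Suc m)
  have "length (concat (map (\<lambda>u. map (f u) [0..<n]) [0..<m])) =
        length (concat (map (\<lambda>u. map (g u) [0..<n]) [0..<m]))"
    by (simp add: length_concat comp_def)
  then show ?case
    using Suc by (auto simp: less_Suc_eq)
qed simp

lemma encode_digraph_inj: "inj_on encode_digraph {G. input_digraph G}"
proof (rule inj_onI)
  fix G H
  assume "G \<in> {G. input_digraph G}" "H \<in> {G. input_digraph G}"
    and eq: "encode_digraph G = encode_digraph H"
  then obtain n m where G: "pair_digraph G" "pverts G = {..<n}"
    and H: "pair_digraph H" "pverts H = {..<m}"
    by (auto simp: input_digraph_def)
  have "takeWhile (\<lambda>b. b) (encode_digraph G) = takeWhile (\<lambda>b. b) (encode_digraph H)"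
    using eq by simp
  then have nm: "n = m"
    using G(2) H(2)
    by (simp add: encode_digraph_def Let_def takeWhile_append takeWhile_replicate replicate_eq_replicate)
  have "concat (map (\<lambda>u. map (\<lambda>v. (u, v) \<in> parcs G) [0..<n]) [0..<n]) =
        concat (map (\<lambda>u. map (\<lambda>v. (u, v) \<in> parcs H) [0..<n]) [0..<n])"
    using eq G(2) H(2) nm by (simp add: encode_digraph_def Let_def)
  then have *: "\<forall>u<n. \<forall>v<n. ((u, v) \<in> parcs G) = ((u, v) \<in> parcs H)"
    by (simp only: concat_map_upt_eq_iff)
  interpret G: pair_digraph G by (rule G(1))
  interpret H: pair_digraph H by (rule H(1))
  have "parcs G \<subseteq> {..<n} \<times> {..<n}" "parcs H \<subseteq> {..<n} \<times> {..<n}"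
    using G.in_arcsD1 G.in_arcsD2 H.in_arcsD1 H.in_arcsD2 G(2) H(2) nm by auto
  with * have "parcs G = parcs H"
    by auto
  then show "G = H"
    using G(2) H(2) nm by simp
qed

end

theory Submission
  imports Defs
begin

text \<open>
  Truncating the legs of a subdivided spider gives back the spider, and a directed cycle of minimum
  length is induced. Hence \<open>G\<close> contains an induced subdivision of \<open>D\<close> iff the spiders can be placed
  in \<open>G\<close> as an induced subdigraph \<open>X\<close> such that some directed cycle avoids \<open>X\<close> and all its in- and
  out-neighbours, that is, such that some nonempty set of the remaining vertices has an out-neighbour
  of each of its members in itself. The machine tries all placements, of which there are polynomially
  many because \<open>D\<close> is fixed, and for each one repeatedly deletes the remaining vertices without
  remaining out-neighbours.
\<close>

section \<open>Structured programs and their compilation to Turing machines\<close>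

text \<open>The obstacle is the directed 2-cycle: its subdivisions are directed cycles of unbounded
  length, so they cannot be enumerated like the spiders. Sets in which every vertex has an
  out-neighbour take their place. Such sets are closed under union, so there is a greatest one,
  which iterated deletion finds; and a minimal nonempty one is an induced directed cycle. Once the
  neighbours of \<open>X\<close> are gone, no arc can join the cycle to the spiders, so the cycle
  need not be chosen together with the placement. Spiders can be truncated because the spare
  vertices of a subdivided leg can be pushed away from the node to the free end, where removing them
  keeps the subdigraph induced. On the machine side the difficulty is access to the adjacency
  matrix, which a tape offers only sequentially. Everything is therefore a sweep with finitely many
  states: as \<open>D\<close> is fixed, the set of pattern vertices placed on a vertex fits into one
  tape symbol, and placements are enumerated by moving marks along an array instead of by
  counters.\<close>

datatype prog =
    Act "nat list \<Rightarrow> (nat \<times> direction) list"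
  | Seq prog prog
  | Cond "nat list \<Rightarrow> bool" prog prog
  | Loop "nat list \<Rightarrow> bool" prog

text \<open>Step counts are exact because they must agree with the steps of the machine. A test
  costs one step; sequencing costs none, as the exit of the first part is the entry of the
  second.\<close>

inductive exec :: "prog \<Rightarrow> tape list \<Rightarrow> nat \<Rightarrow> tape list \<Rightarrow> bool" where
  exec_Act: "exec (Act a) ts 1 (map2 act_on_tape (a (map read_tape ts)) ts)"
| exec_Seq: "exec c ts t ts' \<Longrightarrow> exec d ts' t' ts'' \<Longrightarrow> exec (Seq c d) ts (t + t') ts''"
| exec_Cond_True: "b (map read_tape ts) \<Longrightarrow> exec c ts t ts' \<Longrightarrow> exec (Cond b c d) ts (Suc t) ts'"
| exec_Cond_False:
    "\<not> b (map read_tape ts) \<Longrightarrow> exec d ts t ts' \<Longrightarrow> exec (Cond b c d) ts (Suc t) ts'"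
| exec_Loop_False: "\<not> b (map read_tape ts) \<Longrightarrow> exec (Loop b c) ts 1 ts"
| exec_Loop_True:
    "b (map read_tape ts) \<Longrightarrow> exec c ts t ts' \<Longrightarrow> exec (Loop b c) ts' t' ts'' \<Longrightarrow>
      exec (Loop b c) ts (Suc (t + t')) ts''"

fun code_length :: "prog \<Rightarrow> nat" where
  "code_length (Act a) = 1"
| "code_length (Seq c d) = code_length c + code_length d"
| "code_length (Cond b c d) = Suc (code_length c + code_length d)"
| "code_length (Loop b c) = Suc (code_length c)"

text \<open>A machine step always writes, so a mere test has to write back the symbols it has
  read.\<close>

definition stay_put :: "nat list \<Rightarrow> (nat \<times> direction) list" where
  "stay_put xs = map (\<lambda>x. (x, Stay)) xs"

text \<open>The code of a program occupies the states from \<open>s\<close> on, \<open>s\<close> is its entry and \<open>e\<close> its exit.\<close>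

fun compile :: "prog \<Rightarrow> nat \<Rightarrow> nat \<Rightarrow> nat \<Rightarrow> nat list \<Rightarrow> nat \<times> (nat \<times> direction) list" where
  "compile (Act a) s e q xs = (e, a xs)"
| "compile (Seq c d) s e q xs =
     (let m = s + code_length c in if q < m then compile c s m q xs else compile d m e q xs)"
| "compile (Cond b c d) s e q xs =
     (let m = Suc s + code_length c in
      if q = s then (if b xs then Suc s else m, stay_put xs)
      else if q < m then compile c (Suc s) e q xs else compile d m e q xs)"
| "compile (Loop b c) s e q xs =
     (if q = s then (if b xs then Suc s else e, stay_put xs) else compile c (Suc s) s q xs)"

lemma code_length_pos: "0 < code_length c"
  by (induction c) auto

lemma act_on_stay_put [simp]: "map2 act_on_tape (stay_put (map read_tape ts)) ts = ts"
  by (induction ts) (auto simp: stay_put_def)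

lemma funpow_trans:
  assumes "(f ^^ a) x = y" and "(f ^^ b) y = z"
  shows "(f ^^ (a + b)) x = z"
  using assms by (metis add.commute comp_apply funpow_add)

lemma funpow_Suc_trans:
  assumes "f x = y" and "(f ^^ n) y = z"
  shows "(f ^^ Suc n) x = z"
  using assms by (simp add: funpow_swap1)

text \<open>Agreement on an interval of states passes to subintervals, so subprograms inherit it.
  Halting states are excluded because \<open>tm_step\<close> is idle there.\<close>

definition implements ::
    "turing_machine \<Rightarrow> nat \<Rightarrow> nat \<Rightarrow> (nat \<Rightarrow> nat list \<Rightarrow> nat \<times> (nat \<times> direction) list) \<Rightarrow> bool" where
  "implements M s l \<delta> \<longleftrightarrow>
     (\<forall>q. s \<le> q \<and> q < s + l \<longrightarrow>
        q \<noteq> accept_state M \<and> q \<noteq> reject_state M \<and> transition M q = \<delta> q)"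

lemma tm_step_implements:
  assumes "implements M s l \<delta>" "s \<le> q" "q < s + l"
  shows "tm_step M (q, ts) =
    (fst (\<delta> q (map read_tape ts)), map2 act_on_tape (snd (\<delta> q (map read_tape ts))) ts)"
  using assms by (auto simp: implements_def tm_step.simps split: prod.split)

declare tm_step.simps [simp del]

text \<open>Induction over the execution, not over the program: after an iteration a loop runs its
  own code again, with the same entry and exit.\<close>

lemma tm_step_compile:
  assumes "exec c ts t ts'"
    and "implements M s (code_length c) (compile c s e)"
  shows "(tm_step M ^^ t) (s, ts) = (e, ts')"
  using assms
proof (induction arbitrary: s e rule: exec.induct)
  case (exec_Act a ts)
  then show ?case by (simp add: tm_step_implements)
next
  case (exec_Seq c ts t ts' d t' ts'')
  let ?m = "s + code_length c"
  have c: "implements M s (code_length c) (compile c s ?m)"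
    and d: "implements M ?m (code_length d) (compile d ?m e)"
    using exec_Seq.prems by (auto simp: implements_def fun_eq_iff Let_def)
  show ?case
    by (rule funpow_trans [OF exec_Seq.IH(1) [OF c] exec_Seq.IH(2) [OF d]])
next
  case (exec_Cond_True b ts c t ts' d)
  have 1: "tm_step M (s, ts) = (Suc s, ts)"
    using exec_Cond_True.prems exec_Cond_True.hyps by (subst tm_step_implements) auto
  have "implements M (Suc s) (code_length c) (compile c (Suc s) e)"
    using exec_Cond_True.prems by (auto simp: implements_def fun_eq_iff Let_def)
  then have "(tm_step M ^^ t) (Suc s, ts) = (e, ts')"
    by (rule exec_Cond_True.IH)
  then show ?case
    by (rule funpow_Suc_trans [where f = "tm_step M", OF 1])
next
  case (exec_Cond_False b ts d t ts' c)
  let ?m = "Suc s + code_length c"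
  have 1: "tm_step M (s, ts) = (?m, ts)"
    using exec_Cond_False.prems exec_Cond_False.hyps by (subst tm_step_implements) auto
  have "implements M ?m (code_length d) (compile d ?m e)"
    using exec_Cond_False.prems by (auto simp: implements_def fun_eq_iff Let_def)
  then have "(tm_step M ^^ t) (?m, ts) = (e, ts')"
    by (rule exec_Cond_False.IH)
  then show ?case
    by (rule funpow_Suc_trans [where f = "tm_step M", OF 1])
next
  case (exec_Loop_False b ts c)
  then show ?case by (simp add: tm_step_implements)
next
  case (exec_Loop_True b ts c t ts' t' ts'')
  have 1: "tm_step M (s, ts) = (Suc s, ts)"
    using exec_Loop_True.prems exec_Loop_True.hyps by (subst tm_step_implements) auto
  have "implements M (Suc s) (code_length c) (compile c (Suc s) s)"
    using exec_Loop_True.prems by (auto simp: implements_def fun_eq_iff)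
  then have "(tm_step M ^^ t) (Suc s, ts) = (s, ts')"
    by (rule exec_Loop_True.IH)
  moreover have "(tm_step M ^^ t') (s, ts') = (e, ts'')"
    by (rule exec_Loop_True.IH) (rule exec_Loop_True.prems)
  ultimately have "(tm_step M ^^ (t + t')) (Suc s, ts) = (e, ts'')"
    by (rule funpow_trans)
  then show ?case
    by (rule funpow_Suc_trans [where f = "tm_step M", OF 1])
qed

fun wf_prog :: "nat \<Rightarrow> nat \<Rightarrow> prog \<Rightarrow> bool" where
  "wf_prog k m (Act a) \<longleftrightarrow>
     (\<forall>xs. length xs = k \<and> set xs \<subseteq> {..<m} \<longrightarrow> length (a xs) = k \<and> fst ` set (a xs) \<subseteq> {..<m})"
| "wf_prog k m (Seq c d) \<longleftrightarrow> wf_prog k m c \<and> wf_prog k m d"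
| "wf_prog k m (Cond b c d) \<longleftrightarrow> wf_prog k m c \<and> wf_prog k m d"
| "wf_prog k m (Loop b c) \<longleftrightarrow> wf_prog k m c"

text \<open>A bound from above is enough for successor states: it keeps them below
  \<open>num_states\<close> in the final machine.\<close>

lemma wf_compile:
  assumes "wf_prog k m c" "length xs = k" "set xs \<subseteq> {..<m}"
    and "compile c s e q xs = (q', acts)" "s \<le> q" "q < s + code_length c"
  shows "(q' = e \<or> q' < s + code_length c) \<and> length acts = k \<and> fst ` set acts \<subseteq> {..<m}"
  using assms
proof (induction c arbitrary: s e q q' acts)
  case (Act a)
  then show ?case by auto
next
  case (Seq c d)
  let ?m = "s + code_length c"
  show ?case
  proof (cases "q < ?m")
    case True
    then show ?thesis
      using Seq.prems Seq.IH(1)[of s ?m q q' acts] code_length_pos [of d] by auto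
  next
    case False
    then show ?thesis
      using Seq.prems Seq.IH(2)[of ?m e q q' acts] by auto
  qed
next
  case (Cond b c d)
  have *: "length (stay_put xs) = k \<and> fst ` set (stay_put xs) \<subseteq> {..<m}"
    using Cond.prems by (auto simp: stay_put_def)
  consider "q = s" | "q \<noteq> s" "q < Suc s + code_length c" | "q \<noteq> s" "\<not> q < Suc s + code_length c"
    by blast
  then show ?case
  proof cases
    case 1
    then show ?thesis using Cond.prems * code_length_pos [of c] code_length_pos [of d] by auto
  next
    case 2
    then show ?thesis
      using Cond.prems Cond.IH(1)[of "Suc s" e q q' acts] by auto
  next
    case 3
    then show ?thesis
      using Cond.prems Cond.IH(2)[of "Suc s + code_length c" e q q' acts] by auto
  qed
next
  case (Loop b c)
  have *: "length (stay_put xs) = k \<and> fst ` set (stay_put xs) \<subseteq> {..<m}"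
    using Loop.prems by (auto simp: stay_put_def)
  show ?case
  proof (cases "q = s")
    case True
    then show ?thesis using Loop.prems * code_length_pos [of c] by (auto split: if_splits)
  next
    case False
    then show ?thesis
      using Loop.prems Loop.IH[of "Suc s" s q q' acts] by auto
  qed
qed

section \<open>Polynomial time bounds and the final machine\<close>

definition poly_bounded :: "(nat \<Rightarrow> nat) \<Rightarrow> bool" where
  "poly_bounded T \<longleftrightarrow> (\<exists>p :: nat poly. \<forall>n. T n \<le> poly p n)"

lemma poly_bounded_const [intro!]: "poly_bounded (\<lambda>n. c)"
  unfolding poly_bounded_def by (rule exI [of _ "[:c:]"]) simp

lemma poly_bounded_ident [intro!]: "poly_bounded (\<lambda>n. n)"
  unfolding poly_bounded_def by (rule exI [of _ "[:0, 1:]"]) simp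

lemma poly_bounded_add [intro!]:
  assumes "poly_bounded S" "poly_bounded T"
  shows "poly_bounded (\<lambda>n. S n + T n)"
proof -
  obtain p q where "\<forall>n. S n \<le> poly p n" "\<forall>n. T n \<le> poly q n"
    using assms by (auto simp: poly_bounded_def)
  then show ?thesis
    unfolding poly_bounded_def by (intro exI [of _ "p + q"]) (auto intro: add_mono)
qed

lemma poly_bounded_mult [intro!]:
  assumes "poly_bounded S" "poly_bounded T"
  shows "poly_bounded (\<lambda>n. S n * T n)"
proof -
  obtain p q where "\<forall>n. S n \<le> poly p n" "\<forall>n. T n \<le> poly q n"
    using assms by (auto simp: poly_bounded_def)
  then show ?thesis
    unfolding poly_bounded_def by (intro exI [of _ "p * q"]) (auto intro: mult_mono)
qed

lemma poly_bounded_Suc [intro!]: "poly_bounded T \<Longrightarrow> poly_bounded (\<lambda>n. Suc (T n))"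
  using poly_bounded_add [OF _ poly_bounded_const [of 1]] by simp

text \<open>State \<open>l\<close>, the exit of the code, reads the answer off the symbols under the
  heads and moves to \<open>l + 1\<close> or \<open>l + 2\<close>. Hence the \<open>l + 3\<close>
  states and the additional step in the time bound.\<close>

theorem polynomial_time_decidable_if_exec:
  assumes wf: "wf_prog k m c" and k: "k \<ge> 1" and m: "m \<ge> 3"
    and T: "poly_bounded T"
    and exec: "\<And>w. \<exists>t ts. t \<le> T (length w) \<and>
      exec c (input_tape w # replicate (k - 1) ((\<lambda>_. 0), 0)) t ts \<and>
      (b (map read_tape ts) \<longleftrightarrow> w \<in> L)"
  shows "polynomial_time_decidable L"
proof -
  define l where "l = code_length c"
  define M where "M = \<lparr>num_tapes = k, num_states = l + 3, num_symbols = m, accept_state = l + 1,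
    reject_state = l + 2, transition = (\<lambda>q xs. if q < l then compile c 0 l q xs
      else (if b xs then l + 1 else l + 2, stay_put xs))\<rparr>"
  have wfM: "wf_turing_machine M"
    unfolding wf_turing_machine_def
  proof (intro conjI allI impI)
    fix q xs
    assume q: "q < num_states M \<and> length xs = num_tapes M \<and> set xs \<subseteq> {..<num_symbols M}"
    obtain q' acts where tr: "transition M q xs = (q', acts)"
      by (cases "transition M q xs")
    have "q' < num_states M \<and> length acts = num_tapes M \<and> fst ` set acts \<subseteq> {..<num_symbols M}"
    proof (cases "q < l")
      case True
      then show ?thesis
        using wf_compile [OF wf, of xs 0 l q q' acts] tr q by (auto simp: M_def l_def)
    next
      case False
      then show ?thesis
        using tr q by (auto simp: M_def stay_put_def split: if_splits)
    qed
    then show "case transition M q xs of (q', acts) \<Rightarrow>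
        q' < num_states M \<and> length acts = num_tapes M \<and> fst ` set acts \<subseteq> {..<num_symbols M}"
      by (simp add: tr)
  qed (use k m in \<open>auto simp: M_def\<close>)
  obtain p where p: "\<forall>n. Suc (T n) \<le> poly p n"
    using poly_bounded_Suc [OF T] by (auto simp: poly_bounded_def)
  have "decides_in_time M L (poly p)"
    unfolding decides_in_time_def
  proof
    fix w
    obtain t ts where t: "t \<le> T (length w)"
      and ex: "exec c (input_tape w # replicate (k - 1) ((\<lambda>_. 0), 0)) t ts"
      and b: "b (map read_tape ts) \<longleftrightarrow> w \<in> L"
      using exec by blast
    have "implements M 0 (code_length c) (compile c 0 l)"
      by (auto simp: implements_def M_def l_def fun_eq_iff)
    from tm_step_compile [OF ex this]
    have "(tm_step M ^^ t) (initial_config M w) = (l, ts)"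
      by (simp add: initial_config_def M_def)
    moreover have "(tm_step M ^^ 1) (l, ts) = (if w \<in> L then l + 1 else l + 2, ts)"
      using b by (simp add: M_def tm_step.simps)
    ultimately have "(tm_step M ^^ (t + 1)) (initial_config M w) =
        (if w \<in> L then l + 1 else l + 2, ts)"
      by (rule funpow_trans)
    moreover have "t + 1 \<le> poly p (length w)"
      using t p [rule_format, of "length w"] by simp
    ultimately show "\<exists>t \<le> poly p (length w). fst ((tm_step M ^^ t) (initial_config M w)) =
        (if w \<in> L then accept_state M else reject_state M)"
      by (intro exI [of _ "t + 1"]) (simp add: M_def)
  qed
  with wfM show ?thesis
    unfolding polynomial_time_decidable_def by blast
qed

section \<open>Sweeps over a labelled vertex set\<close>

text \<open>Upper bounds, unlike the exact counts of \<open>exec\<close>, can be shared by branches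
  of different cost and by loops whose length depends on the data.\<close>

definition runs :: "prog \<Rightarrow> tape list \<Rightarrow> nat \<Rightarrow> tape list \<Rightarrow> bool" where
  "runs c ts T ts' \<longleftrightarrow> (\<exists>t \<le> T. exec c ts t ts')"

lemma runs_mono: "runs c ts T ts' \<Longrightarrow> T \<le> T' \<Longrightarrow> runs c ts T' ts'"
  unfolding runs_def using le_trans by blast

lemma runs_Act: "ts' = map2 act_on_tape (a (map read_tape ts)) ts \<Longrightarrow> runs (Act a) ts 1 ts'"
  unfolding runs_def using exec_Act by blast

lemma runs_Seq: "runs c ts T ts' \<Longrightarrow> runs d ts' T' ts'' \<Longrightarrow> runs (Seq c d) ts (T + T') ts''"
  unfolding runs_def by (meson add_mono exec_Seq)

lemma runs_Cond_True: "b (map read_tape ts) \<Longrightarrow> runs c ts T ts' \<Longrightarrow> runs (Cond b c d) ts (Suc T) ts'"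
  unfolding runs_def by (meson Suc_le_mono exec_Cond_True)

lemma runs_Cond_False:
  "\<not> b (map read_tape ts) \<Longrightarrow> runs d ts T ts' \<Longrightarrow> runs (Cond b c d) ts (Suc T) ts'"
  unfolding runs_def by (meson Suc_le_mono exec_Cond_False)

lemma runs_Loop_False: "\<not> b (map read_tape ts) \<Longrightarrow> runs (Loop b c) ts 1 ts"
  unfolding runs_def using exec_Loop_False by blast

lemma runs_Loop_True:
  "b (map read_tape ts) \<Longrightarrow> runs c ts T ts' \<Longrightarrow> runs (Loop b c) ts' T' ts'' \<Longrightarrow>
    runs (Loop b c) ts (Suc (T + T')) ts''"
  unfolding runs_def by (meson Suc_le_mono add_mono exec_Loop_True)

section \<open>Moving, scanning and rewinding a head\<close>

definition move_tape :: "nat \<Rightarrow> direction \<Rightarrow> prog" where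
  "move_tape k d = Act (\<lambda>xs. (stay_put xs)[k := (xs ! k, d)])"

lemma runs_move_tape:
  assumes "k < length ts" "ts ! k = (t, h)"
  shows "runs (move_tape k d) ts 1 (ts[k := (t, move_head d h)])"
proof -
  have "map2 act_on_tape ((stay_put (map read_tape ts))[k := (map read_tape ts ! k, d)]) ts =
      ts[k := (t, move_head d h)]" (is "?l = ?r")
  proof (rule nth_equalityI)
    show "length ?l = length ?r"
      by (simp add: stay_put_def)
  next
    fix i
    assume "i < length ?l"
    then have "i < length ts" by (simp add: stay_put_def)
    then show "?l ! i = ?r ! i"
      using assms by (cases "ts ! i") (auto simp: stay_put_def nth_list_update)
  qed
  then show ?thesis
    unfolding move_tape_def by (intro runs_Act) simp
qed

definition scan :: "nat \<Rightarrow> direction \<Rightarrow> (nat \<Rightarrow> bool) \<Rightarrow> prog" where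
  "scan k d b = Loop (\<lambda>xs. b (xs ! k)) (move_tape k d)"

text \<open>Each of the \<open>n\<close> cells passed costs a test and a move; the final
  \<open>1\<close> is the failing test.\<close>

lemma runs_scan_right:
  assumes "k < length ts" "ts ! k = (t, h)"
    and "\<forall>i < n. b (t (h + int i))" "\<not> b (t (h + int n))"
  shows "runs (scan k Move_Right b) ts (2 * n + 1) (ts[k := (t, h + int n)])"
  using assms
proof (induction n arbitrary: ts h)
  case 0
  have "ts[k := (t, h)] = ts"
    using 0 by (metis list_update_id)
  then show ?case
    using 0 by (simp add: scan_def runs_Loop_False del: One_nat_def)
next
  case (Suc n)
  let ?ts = "ts[k := (t, h + 1)]"
  have rest: "runs (scan k Move_Right b) ?ts (2 * n + 1) (?ts[k := (t, (h + 1) + int n)])"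
  proof (rule Suc.IH)
    show "\<forall>i < n. b (t (h + 1 + int i))"
      using Suc.prems(3) by (metis Suc_mono add.assoc of_nat_Suc)
    show "\<not> b (t (h + 1 + int n))"
      using Suc.prems(4) by (simp add: ac_simps)
  qed (use Suc.prems in auto)
  have move: "runs (move_tape k Move_Right) ts 1 ?ts"
    using runs_move_tape [of k ts t h Move_Right] Suc.prems by simp
  have b: "b (map read_tape ts ! k)"
    using Suc.prems(1,2) Suc.prems(3) [rule_format, of 0] by simp
  show ?case
    using runs_Loop_True [where b = "\<lambda>xs. b (xs ! k)", OF b move rest [unfolded scan_def]]
    by (simp add: scan_def algebra_simps)
qed

lemma runs_scan_left:
  assumes "k < length ts" "ts ! k = (t, h)"
    and "\<forall>i < n. b (t (h - int i))" "\<not> b (t (h - int n))"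
  shows "runs (scan k Move_Left b) ts (2 * n + 1) (ts[k := (t, h - int n)])"
  using assms
proof (induction n arbitrary: ts h)
  case 0
  have "ts[k := (t, h)] = ts"
    using 0 by (metis list_update_id)
  then show ?case
    using 0 by (simp add: scan_def runs_Loop_False del: One_nat_def)
next
  case (Suc n)
  let ?ts = "ts[k := (t, h - 1)]"
  have rest: "runs (scan k Move_Left b) ?ts (2 * n + 1) (?ts[k := (t, (h - 1) - int n)])"
  proof (rule Suc.IH)
    show "\<forall>i < n. b (t (h - 1 - int i))"
      using Suc.prems(3) by (metis Suc_mono diff_diff_eq of_nat_Suc)
    show "\<not> b (t (h - 1 - int n))"
      using Suc.prems(4) by (simp add: algebra_simps)
  qed (use Suc.prems in auto)
  have move: "runs (move_tape k Move_Left) ts 1 ?ts"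
    using runs_move_tape [of k ts t h Move_Left] Suc.prems by simp
  have b: "b (map read_tape ts ! k)"
    using Suc.prems(1,2) Suc.prems(3) [rule_format, of 0] by simp
  show ?case
    using runs_Loop_True [where b = "\<lambda>xs. b (xs ! k)", OF b move rest [unfolded scan_def]]
    by (simp add: scan_def algebra_simps)
qed

text \<open>The head may sit on the blank behind the data, where a scan over nonblanks would stop at
  once; hence the first move. The last one steps from the blank at \<open>- 1\<close> back to cell
  \<open>0\<close>.\<close>

definition rewind :: "nat \<Rightarrow> prog" where
  "rewind k = Seq (move_tape k Move_Left) (Seq (scan k Move_Left (\<lambda>x. x \<noteq> 0)) (move_tape k Move_Right))"

lemma runs_rewind:
  assumes "k < length ts" "ts ! k = (t, int n)"
    and "\<forall>i < n. t (int i) \<noteq> 0" "t (- 1) = 0"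
  shows "runs (rewind k) ts (2 * n + 3) (ts[k := (t, 0)])"
proof -
  let ?ts1 = "ts[k := (t, int n - 1)]" and ?ts2 = "ts[k := (t, - 1)]"
  have "runs (move_tape k Move_Left) ts 1 ?ts1"
    using runs_move_tape [of k ts t "int n" Move_Left] assms by simp
  moreover have "runs (scan k Move_Left (\<lambda>x. x \<noteq> 0)) ?ts1 (2 * n + 1)
      (?ts1[k := (t, int n - 1 - int n)])"
  proof (rule runs_scan_left)
    show "\<forall>i < n. t (int n - 1 - int i) \<noteq> 0"
    proof (intro allI impI)
      fix i
      assume "i < n"
      then have eq: "int n - 1 - int i = int (n - 1 - i)" by auto
      show "t (int n - 1 - int i) \<noteq> 0"
        unfolding eq using \<open>i < n\<close> by (intro assms(3) [rule_format]) auto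
    qed
  qed (use assms in auto)
  then have "runs (scan k Move_Left (\<lambda>x. x \<noteq> 0)) ?ts1 (2 * n + 1) ?ts2"
    by simp
  moreover have "runs (move_tape k Move_Right) ?ts2 1 (?ts2[k := (t, move_head Move_Right (- 1))])"
    by (rule runs_move_tape) (use assms in auto)
  then have "runs (move_tape k Move_Right) ?ts2 1 (ts[k := (t, 0)])"
    by simp
  ultimately show ?thesis
    unfolding rewind_def
    by (intro runs_mono [OF runs_Seq [OF _ runs_Seq]]) auto
qed

lemma wf_move_tape [simp]: "k < l \<Longrightarrow> wf_prog l m (move_tape k d)"
proof -
  assume k: "k < l"
  have "fst ` set ((stay_put xs)[k := (xs ! k, d)]) \<subseteq> {..<m}"
    if "length xs = l" "set xs \<subseteq> {..<m}" for xs
  proof -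
    have "fst ` set ((stay_put xs)[k := (xs ! k, d)]) = set (map fst ((stay_put xs)[k := (xs ! k, d)]))"
      by simp
    also have "map fst ((stay_put xs)[k := (xs ! k, d)]) = xs"
      by (simp add: map_update stay_put_def comp_def)
    finally show ?thesis
      using that by simp
  qed
  then show ?thesis
    by (simp add: move_tape_def stay_put_def)
qed

lemma wf_scan [simp]: "k < l \<Longrightarrow> wf_prog l m (scan k d b)"
  by (simp add: scan_def)

lemma wf_rewind [simp]: "k < l \<Longrightarrow> wf_prog l m (rewind k)"
  by (simp add: rewind_def)

lemma nth_less: "set xs \<subseteq> {..<m} \<Longrightarrow> k < length xs \<Longrightarrow> xs ! k < (m :: nat)"
  by (meson lessThan_iff nth_mem subsetD)

text \<open>
  The machine has four tapes: the input, two copies of an array of vertex labels, and a single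
  cell holding the register. Having two copies gives access to the labels of both ends of an arc
  while the adjacency matrix is read sequentially.
\<close>

locale label_code =
  fixes lab :: "'l \<Rightarrow> nat" and unlab :: "nat \<Rightarrow> 'l" and L :: "'l set"
    and reg :: "'r \<Rightarrow> nat" and unreg :: "nat \<Rightarrow> 'r" and m :: nat
  assumes lab_pos: "lab x > 0" and lab_less: "lab x < m"
    and unlab_lab: "x \<in> L \<Longrightarrow> unlab (lab x) = x"
    and reg_less: "reg r < m" and unreg_reg: "unreg (reg r) = r"
begin

text \<open>Labels are never \<open>0\<close>, so the blanks on both sides delimit the array, and
  its ends are recognised without storing \<open>n\<close>.\<close>

definition arr :: "nat \<Rightarrow> (nat \<Rightarrow> 'l) \<Rightarrow> int \<Rightarrow> nat" where
  "arr n R i = (if 0 \<le> i \<and> i < int n then lab (R (nat i)) else 0)"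

definition cfg :: "(int \<Rightarrow> nat) \<Rightarrow> nat \<Rightarrow> int \<Rightarrow> int \<Rightarrow> int \<Rightarrow> 'r \<Rightarrow> (nat \<Rightarrow> 'l) \<Rightarrow> (nat \<Rightarrow> 'l) \<Rightarrow> tape list"
  where "cfg inp n p a b r R C =
    [(inp, p), (arr n R, a), (arr n C, b), ((\<lambda>i. if i = 0 then reg r else 0), 0)]"

lemma length_cfg [simp]: "length (cfg inp n p a b r R C) = 4"
  by (simp add: cfg_def)

lemma cfg_nth [simp]:
  "cfg inp n p a b r R C ! 0 = (inp, p)"
  "cfg inp n p a b r R C ! Suc 0 = (arr n R, a)"
  "cfg inp n p a b r R C ! 2 = (arr n C, b)"
  "cfg inp n p a b r R C ! 3 = ((\<lambda>i. if i = 0 then reg r else 0), 0)"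
  by (simp_all add: cfg_def)

lemma cfg_update [simp]:
  "(cfg inp n p a b r R C)[0 := (inp, p')] = cfg inp n p' a b r R C"
  "(cfg inp n p a b r R C)[Suc 0 := (arr n R, a')] = cfg inp n p a' b r R C"
  "(cfg inp n p a b r R C)[2 := (arr n C, b')] = cfg inp n p a b' r R C"
  by (simp_all add: cfg_def numeral_2_eq_2)

lemma read_cfg [simp]:
  "map read_tape (cfg inp n p a b r R C) = [inp p, arr n R a, arr n C b, reg r]"
  by (simp add: cfg_def)

lemma arr_eq_0_iff: "arr n R i = 0 \<longleftrightarrow> i < 0 \<or> int n \<le> i"
  using lab_pos by (auto simp: arr_def)

lemma arr_of_nat [simp]: "i < n \<Longrightarrow> arr n R (int i) = lab (R i)"
  by (simp add: arr_def)

lemma arr_upd: "i < n \<Longrightarrow> (arr n R)(int i := lab x) = arr n (R(i := x))"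
  by (auto simp: arr_def fun_eq_iff)

text \<open>All passes and sweeps are built from this action; they differ only in \<open>g\<close>
  and in the directions of the heads.\<close>

definition cell_act ::
    "(nat \<Rightarrow> 'r \<Rightarrow> 'l \<Rightarrow> 'l \<Rightarrow> 'r \<times> 'l \<times> 'l) \<Rightarrow> direction \<Rightarrow> direction \<Rightarrow> direction \<Rightarrow> prog"
  where "cell_act g d0 d1 d2 = Act (\<lambda>xs.
    case g (xs ! 0) (unreg (xs ! 3)) (unlab (xs ! 1)) (unlab (xs ! 2)) of
      (r, x, y) \<Rightarrow> [(xs ! 0, d0), (lab x, d1), (lab y, d2), (reg r, Stay)])"

lemma wf_cell_act [simp]: "wf_prog 4 m (cell_act g d0 d1 d2)"
proof -
  have "xs ! 0 < m" if "length xs = 4" "set xs \<subseteq> {..<m}" for xs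
    using that nth_less by simp
  then show ?thesis
    by (auto simp: cell_act_def lab_less reg_less split: prod.split)
qed

lemma runs_cell_act:
  assumes "i < n" "j < n" "R i \<in> L" "C j \<in> L" "g (inp p) r (R i) (C j) = (r', x, y)"
  shows "runs (cell_act g d0 d1 d2) (cfg inp n p (int i) (int j) r R C) 1
    (cfg inp n (move_head d0 p) (move_head d1 (int i)) (move_head d2 (int j)) r'
      (R(i := x)) (C(j := y)))"
  unfolding cell_act_def
  by (rule runs_Act)
    (use assms in \<open>simp add: unlab_lab unreg_reg, auto simp: cfg_def arr_upd\<close>)

definition set_reg :: "('r \<Rightarrow> 'r) \<Rightarrow> prog" where
  "set_reg h = Act (\<lambda>xs. [(xs ! 0, Stay), (xs ! 1, Stay), (xs ! 2, Stay), (reg (h (unreg (xs ! 3))), Stay)])"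

lemma wf_set_reg [simp]: "wf_prog 4 m (set_reg h)"
proof -
  have "xs ! 0 < m" "xs ! Suc 0 < m" "xs ! 2 < m" if "length xs = 4" "set xs \<subseteq> {..<m}" for xs
    using that nth_less by simp_all
  then show ?thesis
    by (auto simp: set_reg_def reg_less)
qed

lemma runs_set_reg:
  "runs (set_reg h) (cfg inp n p a b r R C) 1 (cfg inp n p a b (h r) R C)"
  unfolding set_reg_def
  by (rule runs_Act) (simp add: unreg_reg, auto simp: cfg_def)

lemma runs_rewind_rows:
  "runs (rewind 1) (cfg inp n p (int n) b r R C) (2 * n + 3) (cfg inp n p 0 b r R C)"
  using runs_rewind [of 1 "cfg inp n p (int n) b r R C" "arr n R" n] lab_pos
  by (simp add: arr_eq_0_iff)

lemma runs_rewind_cols: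
  "runs (rewind 2) (cfg inp n p a (int n) r R C) (2 * n + 3) (cfg inp n p a 0 r R C)"
  using runs_rewind [of 2 "cfg inp n p a (int n) r R C" "arr n C" n] lab_pos
  by (simp add: arr_eq_0_iff)

section \<open>Passes over the labels and sweeps over the matrix\<close>

definition pass :: "('r \<Rightarrow> 'l \<Rightarrow> 'l \<Rightarrow> 'r \<times> 'l \<times> 'l) \<Rightarrow> prog" where
  "pass g = Seq (Loop (\<lambda>xs. xs ! 1 \<noteq> 0) (cell_act (\<lambda>_. g) Stay Move_Right Move_Right))
    (Seq (rewind 1) (rewind 2))"

lemma wf_pass [simp]: "wf_prog 4 m (pass g)"
  by (simp add: pass_def)

text \<open>A loop rule whose invariant \<open>I\<close> is indexed by the number of processed
  cells. The final arrays are existentially quantified, so that only \<open>I\<close> has to be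
  found when the rule is used.\<close>

lemma runs_pass_loop:
  assumes step: "\<And>i r R C. i < n \<Longrightarrow> I i r R C \<Longrightarrow> R i \<in> L \<and> C i \<in> L \<and>
      (case g r (R i) (C i) of (r', x, y) \<Rightarrow> I (Suc i) r' (R(i := x)) (C(i := y)))"
    and "I i r R C" "i + k = n"
  shows "\<exists>r' R' C'. I n r' R' C' \<and>
    runs (Loop (\<lambda>xs. xs ! 1 \<noteq> 0) (cell_act (\<lambda>_. g) Stay Move_Right Move_Right))
      (cfg inp n p (int i) (int i) r R C) (2 * k + 1) (cfg inp n p (int n) (int n) r' R' C')"
  using assms(2,3)
proof (induction k arbitrary: i r R C)
  case 0
  then show ?case
    by (intro exI conjI, simp, simp del: One_nat_def)
      (rule runs_Loop_False, simp add: arr_eq_0_iff)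
next
  case (Suc k)
  then have i: "i < n" by simp
  obtain r' x y where g: "g r (R i) (C i) = (r', x, y)"
    by (cases "g r (R i) (C i)")
  with step [OF i Suc.prems(1)] have L: "R i \<in> L" "C i \<in> L"
    and I: "I (Suc i) r' (R(i := x)) (C(i := y))"
    by auto
  have k: "Suc i + k = n" using Suc.prems(2) by simp
  from Suc.IH [OF I k] obtain r'' R'' C'' where I': "I n r'' R'' C''"
    and rest: "runs (Loop (\<lambda>xs. xs ! 1 \<noteq> 0) (cell_act (\<lambda>_. g) Stay Move_Right Move_Right))
      (cfg inp n p (int (Suc i)) (int (Suc i)) r' (R(i := x)) (C(i := y))) (2 * k + 1)
      (cfg inp n p (int n) (int n) r'' R'' C'')"
    by blast
  have cell: "runs (cell_act (\<lambda>_. g) Stay Move_Right Move_Right)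
      (cfg inp n p (int i) (int i) r R C) 1
      (cfg inp n p (int (Suc i)) (int (Suc i)) r' (R(i := x)) (C(i := y)))"
    using runs_cell_act [of i n i R C "\<lambda>_. g" inp p r r' x y Stay Move_Right Move_Right] i L g
    by (simp add: ac_simps)
  have "runs (Loop (\<lambda>xs. xs ! 1 \<noteq> 0) (cell_act (\<lambda>_. g) Stay Move_Right Move_Right))
      (cfg inp n p (int i) (int i) r R C) (2 * Suc k + 1) (cfg inp n p (int n) (int n) r'' R'' C'')"
    by (rule runs_mono [OF runs_Loop_True [OF _ cell rest]]) (use i lab_pos in auto)
  with I' show ?case by blast
qed

lemma runs_pass:
  assumes "\<And>i r R C. i < n \<Longrightarrow> I i r R C \<Longrightarrow> R i \<in> L \<and> C i \<in> L \<and>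
      (case g r (R i) (C i) of (r', x, y) \<Rightarrow> I (Suc i) r' (R(i := x)) (C(i := y)))"
    and "I 0 r R C"
  shows "\<exists>r' R' C'. I n r' R' C' \<and>
    runs (pass g) (cfg inp n p 0 0 r R C) (6 * n + 7) (cfg inp n p 0 0 r' R' C')"
proof -
  obtain r' R' C' where I: "I n r' R' C'" and
    *: "runs (Loop (\<lambda>xs. xs ! 1 \<noteq> 0) (cell_act (\<lambda>_. g) Stay Move_Right Move_Right))
      (cfg inp n p 0 0 r R C) (2 * n + 1) (cfg inp n p (int n) (int n) r' R' C')"
    using runs_pass_loop [of n I g 0 r R C n inp p] assms by auto
  have "runs (pass g) (cfg inp n p 0 0 r R C) (6 * n + 7) (cfg inp n p 0 0 r' R' C')"
    unfolding pass_def
    by (rule runs_mono [OF runs_Seq [OF * runs_Seq [OF runs_rewind_rows runs_rewind_cols]]]) simp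
  with I show ?thesis by blast
qed

definition sweep_row :: "(nat \<Rightarrow> 'r \<Rightarrow> 'l \<Rightarrow> 'l \<Rightarrow> 'r \<times> 'l \<times> 'l) \<Rightarrow> prog" where
  "sweep_row f = Loop (\<lambda>xs. xs ! 2 \<noteq> 0) (cell_act f Move_Right Stay Move_Right)"

text \<open>Rewinding the column array after each row, while the input head only moves right, keeps
  the input head on entry \<open>i * n + j\<close> of the row-major matrix.\<close>

definition sweep_matrix :: "(nat \<Rightarrow> 'r \<Rightarrow> 'l \<Rightarrow> 'l \<Rightarrow> 'r \<times> 'l \<times> 'l) \<Rightarrow> prog" where
  "sweep_matrix f = Seq (Loop (\<lambda>xs. xs ! 1 \<noteq> 0)
    (Seq (sweep_row f) (Seq (rewind 2) (move_tape 1 Move_Right)))) (rewind 1)"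

lemma wf_sweep_matrix [simp]: "wf_prog 4 m (sweep_matrix f)"
  by (simp add: sweep_matrix_def sweep_row_def)

lemma runs_sweep_row:
  assumes step: "\<And>j r R C. j < n \<Longrightarrow> I j r R C \<Longrightarrow> R i \<in> L \<and> C j \<in> L \<and>
      (case f (inp (p + int j)) r (R i) (C j) of (r', x, y) \<Rightarrow> I (Suc j) r' (R(i := x)) (C(j := y)))"
    and i: "i < n" and "I j r R C" "j + k = n"
  shows "\<exists>r' R' C'. I n r' R' C' \<and>
    runs (sweep_row f) (cfg inp n (p + int j) (int i) (int j) r R C) (2 * k + 1)
      (cfg inp n (p + int n) (int i) (int n) r' R' C')"
  using assms(3,4)
proof (induction k arbitrary: j r R C)
  case 0
  then show ?case
    unfolding sweep_row_def
    by (intro exI conjI, simp, simp del: One_nat_def)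
      (rule runs_Loop_False, simp add: arr_eq_0_iff)
next
  case (Suc k)
  then have j: "j < n" by simp
  obtain r' x y where f: "f (inp (p + int j)) r (R i) (C j) = (r', x, y)"
    by (cases "f (inp (p + int j)) r (R i) (C j)")
  with step [OF j Suc.prems(1)] have L: "R i \<in> L" "C j \<in> L"
    and I: "I (Suc j) r' (R(i := x)) (C(j := y))"
    by auto
  have k: "Suc j + k = n" using Suc.prems(2) by simp
  from Suc.IH [OF I k] obtain r'' R'' C'' where I': "I n r'' R'' C''"
    and rest: "runs (sweep_row f)
      (cfg inp n (p + int (Suc j)) (int i) (int (Suc j)) r' (R(i := x)) (C(j := y))) (2 * k + 1)
      (cfg inp n (p + int n) (int i) (int n) r'' R'' C'')"
    by blast
  have cell: "runs (cell_act f Move_Right Stay Move_Right)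
      (cfg inp n (p + int j) (int i) (int j) r R C) 1
      (cfg inp n (p + int (Suc j)) (int i) (int (Suc j)) r' (R(i := x)) (C(j := y)))"
    using runs_cell_act [of i n j R C f inp "p + int j" r r' x y Move_Right Stay Move_Right] i j L f
    by (simp add: ac_simps)
  have "runs (sweep_row f) (cfg inp n (p + int j) (int i) (int j) r R C) (2 * Suc k + 1)
      (cfg inp n (p + int n) (int i) (int n) r'' R'' C'')"
    unfolding sweep_row_def
    by (rule runs_mono [OF runs_Loop_True [OF _ cell rest [unfolded sweep_row_def]]])
      (use j lab_pos in auto)
  with I' show ?case by blast
qed

text \<open>The assumption \<open>row\<close> is the change of coordinates at the end of a row, from
  \<open>(i, n)\<close> to \<open>(i + 1, 0)\<close>. A row costs \<open>4 * n + 6\<close>: the loop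
  test, the row itself with \<open>2 * n + 1\<close>, the rewind with \<open>2 * n + 3\<close>, and
  one move.\<close>

lemma runs_sweep_loop:
  assumes step: "\<And>i j r R C. i < n \<Longrightarrow> j < n \<Longrightarrow> I i j r R C \<Longrightarrow> R i \<in> L \<and> C j \<in> L \<and>
      (case f (inp (p + int (i * n + j))) r (R i) (C j) of
        (r', x, y) \<Rightarrow> I i (Suc j) r' (R(i := x)) (C(j := y)))"
    and row: "\<And>i r R C. i < n \<Longrightarrow> I i n r R C \<Longrightarrow> I (Suc i) 0 r R C"
    and "I i 0 r R C" "i + k = n"
  shows "\<exists>r' R' C'. I n 0 r' R' C' \<and>
    runs (Loop (\<lambda>xs. xs ! 1 \<noteq> 0) (Seq (sweep_row f) (Seq (rewind 2) (move_tape 1 Move_Right))))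
      (cfg inp n (p + int (i * n)) (int i) 0 r R C) (k * (4 * n + 6) + 1)
      (cfg inp n (p + int (n * n)) (int n) 0 r' R' C')"
  using assms(3,4)
proof (induction k arbitrary: i r R C)
  case 0
  then show ?case
    by (intro exI conjI, simp, simp del: One_nat_def)
      (rule runs_Loop_False, simp add: arr_eq_0_iff)
next
  case (Suc k)
  then have i: "i < n" by simp
  obtain r1 R1 C1 where I1: "I i n r1 R1 C1" and
    *: "runs (sweep_row f) (cfg inp n (p + int (i * n)) (int i) 0 r R C) (2 * n + 1)
      (cfg inp n (p + int (Suc i * n)) (int i) (int n) r1 R1 C1)"
    using runs_sweep_row [of n "I i" i f inp "p + int (i * n)" 0 r R C n] step [OF i] i Suc.prems(1)
    by (auto simp: algebra_simps)
  have "runs (move_tape 1 Move_Right) (cfg inp n (p + int (Suc i * n)) (int i) 0 r1 R1 C1) 1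
      (cfg inp n (p + int (Suc i * n)) (int (Suc i)) 0 r1 R1 C1)"
    using runs_move_tape [of 1 "cfg inp n (p + int (Suc i * n)) (int i) 0 r1 R1 C1" "arr n R1" "int i" Move_Right]
    by (simp add: ac_simps)
  note body = runs_Seq [OF * runs_Seq [OF runs_rewind_cols this]]
  obtain r2 R2 C2 where I2: "I n 0 r2 R2 C2" and
    **: "runs (Loop (\<lambda>xs. xs ! 1 \<noteq> 0) (Seq (sweep_row f) (Seq (rewind 2) (move_tape 1 Move_Right))))
      (cfg inp n (p + int (Suc i * n)) (int (Suc i)) 0 r1 R1 C1) (k * (4 * n + 6) + 1)
      (cfg inp n (p + int (n * n)) (int n) 0 r2 R2 C2)"
    using Suc.IH [OF row [OF i I1]] Suc.prems(2) by auto
  have "runs (Loop (\<lambda>xs. xs ! 1 \<noteq> 0) (Seq (sweep_row f) (Seq (rewind 2) (move_tape 1 Move_Right))))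
      (cfg inp n (p + int (i * n)) (int i) 0 r R C) (Suc k * (4 * n + 6) + 1)
      (cfg inp n (p + int (n * n)) (int n) 0 r2 R2 C2)"
    by (rule runs_mono [OF runs_Loop_True [OF _ body **]]) (use i lab_pos in auto)
  with I2 show ?case by blast
qed

lemma runs_sweep_matrix:
  assumes "\<And>i j r R C. i < n \<Longrightarrow> j < n \<Longrightarrow> I i j r R C \<Longrightarrow> R i \<in> L \<and> C j \<in> L \<and>
      (case f (inp (p + int (i * n + j))) r (R i) (C j) of
        (r', x, y) \<Rightarrow> I i (Suc j) r' (R(i := x)) (C(j := y)))"
    and "\<And>i r R C. i < n \<Longrightarrow> I i n r R C \<Longrightarrow> I (Suc i) 0 r R C"
    and "I 0 0 r R C"
  shows "\<exists>r' R' C'. I n 0 r' R' C' \<and>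
    runs (sweep_matrix f) (cfg inp n p 0 0 r R C) (n * (4 * n + 6) + 2 * n + 4)
      (cfg inp n (p + int (n * n)) 0 0 r' R' C')"
proof -
  obtain r' R' C' where I: "I n 0 r' R' C'" and
    *: "runs (Loop (\<lambda>xs. xs ! 1 \<noteq> 0) (Seq (sweep_row f) (Seq (rewind 2) (move_tape 1 Move_Right))))
      (cfg inp n p 0 0 r R C) (n * (4 * n + 6) + 1) (cfg inp n (p + int (n * n)) (int n) 0 r' R' C')"
    using runs_sweep_loop [of n I f inp p 0 r R C n] assms by auto
  have "runs (sweep_matrix f) (cfg inp n p 0 0 r R C) (n * (4 * n + 6) + 2 * n + 4)
      (cfg inp n (p + int (n * n)) 0 0 r' R' C')"
    unfolding sweep_matrix_def by (rule runs_mono [OF runs_Seq [OF * runs_rewind_rows]]) simp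
  with I show ?thesis by blast
qed

text \<open>The first matrix entry has no mark of its own; it is found from the left end of the
  input by skipping the unary prefix and the separator.\<close>

definition home :: prog where
  "home = Seq (rewind 0) (Seq (scan 0 Move_Right (\<lambda>x. x = 2)) (move_tape 0 Move_Right))"

lemma wf_home [simp]: "wf_prog 4 m home"
  by (simp add: home_def)

lemma runs_home:
  assumes "\<forall>i < n. inp (int i) = 2" "inp (int n) \<noteq> 2" "inp (- 1) = 0"
    and "\<forall>i < q. inp (int i) \<noteq> 0"
  shows "runs home (cfg inp n (int q) 0 0 r R C) (2 * q + 2 * n + 5)
    (cfg inp n (int n + 1) 0 0 r R C)"
proof -
  have "runs (rewind 0) (cfg inp n (int q) 0 0 r R C) (2 * q + 3) (cfg inp n 0 0 0 r R C)"
    using runs_rewind [of 0 "cfg inp n (int q) 0 0 r R C" inp q] assms by simp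
  moreover have "runs (scan 0 Move_Right (\<lambda>x. x = 2)) (cfg inp n 0 0 0 r R C) (2 * n + 1)
      (cfg inp n (int n) 0 0 r R C)"
    using runs_scan_right [of 0 "cfg inp n 0 0 0 r R C" inp 0 n "\<lambda>x. x = 2"] assms by simp
  moreover have "runs (move_tape 0 Move_Right) (cfg inp n (int n) 0 0 r R C) 1
      (cfg inp n (int n + 1) 0 0 r R C)"
    using runs_move_tape [of 0 "cfg inp n (int n) 0 0 r R C" inp "int n" Move_Right] by simp
  ultimately show ?thesis
    unfolding home_def by (intro runs_mono [OF runs_Seq [OF _ runs_Seq]]) auto
qed

definition sweep :: "(nat \<Rightarrow> 'r \<Rightarrow> 'l \<Rightarrow> 'l \<Rightarrow> 'r \<times> 'l \<times> 'l) \<Rightarrow> prog" where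
  "sweep f = Seq (sweep_matrix f) home"

lemma wf_sweep [simp]: "wf_prog 4 m (sweep f)"
  by (simp add: sweep_def)

end

section \<open>The search algorithm\<close>

text \<open>
  A vertex label consists of the set of pattern vertices placed on the vertex and a working bit.
  The register consists of a loop flag, the result of the embedding test, and the overall result.
\<close>

type_synonym 'v label = "'v set \<times> bool"

type_synonym registers = "bool \<times> bool \<times> bool"

fun shift_step :: "'v \<Rightarrow> registers \<Rightarrow> 'v label \<Rightarrow> 'v label \<Rightarrow> registers \<times> 'v label \<times> 'v label" where
  "shift_step a (fl, ok, res) (M, d) (M', d') =
     (let upd = \<lambda>M. if fl then insert a M else M - {a}
      in ((a \<in> M, ok, res), (upd M, d), (upd M', d')))"

text \<open>The row copy learns of marked out-neighbours and the column copy of marked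
  in-neighbours, since an arc is read only once, in the row of its tail. The last conjunct for
  \<open>ok\<close> makes the placement injective: no vertex carries two marks.\<close>

fun check_step :: "'v rel \<Rightarrow> nat \<Rightarrow> registers \<Rightarrow> 'v label \<Rightarrow> 'v label \<Rightarrow> registers \<times> 'v label \<times> 'v label"
  where "check_step A s (fl, ok, res) (M, d) (M', d') =
     ((fl, ok \<and> (\<forall>a \<in> M. \<forall>b \<in> M'. s = 2 \<longleftrightarrow> (a, b) \<in> A) \<and> (\<forall>a \<in> M. \<forall>b \<in> M. a = b), res),
      (M, d \<or> (s = 2 \<and> M' \<noteq> {})), (M', d' \<or> (s = 2 \<and> M \<noteq> {})))"

text \<open>Prepares the peeling: placed vertices and their neighbours start as deleted, and no
  vertex has yet found a remaining out-neighbour.\<close>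

fun merge_step :: "registers \<Rightarrow> 'v label \<Rightarrow> 'v label \<Rightarrow> registers \<times> 'v label \<times> 'v label" where
  "merge_step r (M, d) (M', d') = (r, (M, True), (M', d \<or> d' \<or> M \<noteq> {}))"

fun peel_step :: "nat \<Rightarrow> registers \<Rightarrow> 'v label \<Rightarrow> 'v label \<Rightarrow> registers \<times> 'v label \<times> 'v label" where
  "peel_step s r (M, d) (M', d') = (r, (M, d \<and> \<not> (s = 2 \<and> \<not> d')), (M', d'))"

text \<open>The flag reports a new deletion, so that peeling stops after the first round without
  one.\<close>

fun collect_step :: "registers \<Rightarrow> 'v label \<Rightarrow> 'v label \<Rightarrow> registers \<times> 'v label \<times> 'v label" where
  "collect_step (fl, ok, res) (M, d) (M', d') =
     ((fl \<or> (d \<and> \<not> d'), ok, res), (M, True), (M', d \<or> d'))"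

fun finish_step :: "registers \<Rightarrow> 'v label \<Rightarrow> 'v label \<Rightarrow> registers \<times> 'v label \<times> 'v label" where
  "finish_step (fl, ok, res) (M, d) (M', d') =
     ((fl, ok, res \<or> (ok \<and> \<not> d')), (M, False), (M', False))"

text \<open>With one mark on one vertex, \<open>M \<inter> M'\<close> is nonempty only where row and
  column are that vertex. Diagonal entries are thus recognised without comparing indices.\<close>

fun loop_step :: "nat \<Rightarrow> registers \<Rightarrow> 'v label \<Rightarrow> 'v label \<Rightarrow> registers \<times> 'v label \<times> 'v label" where
  "loop_step s (fl, ok, res) (M, d) (M', d') =
     ((fl, ok, res \<or> (s = 2 \<and> M \<inter> M' \<noteq> {})), (M, d), (M', d'))"

text \<open>A blank inside the \<open>n\<close> by \<open>n\<close> block means that the word is too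
  short.\<close>

fun short_step :: "nat \<Rightarrow> registers \<Rightarrow> 'v label \<Rightarrow> 'v label \<Rightarrow> registers \<times> 'v label \<times> 'v label" where
  "short_step s (fl, ok, res) x y = ((fl, ok, res \<or> s = 0), x, y)"

definition put :: "'v \<Rightarrow> nat \<Rightarrow> (nat \<Rightarrow> 'v set) \<Rightarrow> nat \<Rightarrow> 'v set" where
  "put a i M k = (if k = i then insert a (M k) else M k)"

locale search = label_code lab unlab "Pow Vs \<times> UNIV" reg unreg m
  for lab :: "'v label \<Rightarrow> nat" and unlab and Vs :: "'v set" and reg :: "registers \<Rightarrow> nat" and unreg m +
  fixes A :: "'v rel"
begin

text \<open>
  A pass of \<open>shift_step a\<close> moves the mark \<open>a\<close> to the next vertex, with the flag as carry: a set flag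
  inserts the mark at the first vertex, and the flag is set again once the mark has left the array.
\<close>

definition for_each :: "'v \<Rightarrow> prog \<Rightarrow> prog" where
  "for_each a c =
    Seq (set_reg (\<lambda>(fl, ok, res). (True, ok, res)))
      (Seq (pass (shift_step a))
        (Loop (\<lambda>xs. \<not> fst (unreg (xs ! 3)))
          (Seq c (Seq (set_reg (\<lambda>(fl, ok, res). (False, ok, res))) (pass (shift_step a))))))"

fun nest :: "'v list \<Rightarrow> prog \<Rightarrow> prog" where
  "nest [] c = c"
| "nest (a # as) c = for_each a (nest as c)"

text \<open>
  While peeling, the working bit of the second copy marks the deleted vertices, and the one of the
  first copy the vertices for which no remaining out-neighbour has been found in the current sweep.
\<close>

definition peel :: prog where
  "peel = Loop (\<lambda>xs. fst (unreg (xs ! 3)))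
     (Seq (set_reg (\<lambda>(fl, ok, res). (False, ok, res))) (Seq (sweep peel_step) (pass collect_step)))"

definition test_placement :: prog where
  "test_placement =
    Seq (set_reg (\<lambda>(fl, ok, res). (True, True, res)))
      (Seq (sweep (check_step A)) (Seq (pass merge_step) (Seq peel (pass finish_step))))"

lemma wf_for_each [simp]: "wf_prog 4 m c \<Longrightarrow> wf_prog 4 m (for_each a c)"
  by (simp add: for_each_def)

lemma wf_nest [simp]: "wf_prog 4 m c \<Longrightarrow> wf_prog 4 m (nest as c)"
  by (induction as) auto

lemma wf_test_placement [simp]: "wf_prog 4 m test_placement"
  by (simp add: test_placement_def peel_def)

end

text \<open>The entries before \<open>(i, j)\<close> in row-major order. The invariant of a sweep is
  its final result with the quantifiers restricted to these entries.\<close>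

definition seen :: "nat \<Rightarrow> nat \<Rightarrow> nat \<Rightarrow> nat \<Rightarrow> bool" where
  "seen i j i' j' \<longleftrightarrow> i' < i \<or> (i' = i \<and> j' < j)"

lemma seen_0 [simp]: "\<not> seen 0 0 i' j'"
  by (simp add: seen_def)

lemma seen_Suc: "seen i (Suc j) i' j' \<longleftrightarrow> seen i j i' j' \<or> (i' = i \<and> j' = j)"
  by (auto simp: seen_def less_Suc_eq)

lemma seen_next_row: "j' < n \<Longrightarrow> seen (Suc i) 0 i' j' \<longleftrightarrow> seen i n i' j'"
  by (auto simp: seen_def less_Suc_eq)

lemma all_seen_all:
  "(\<forall>i' < n. \<forall>j' < n. seen n 0 i' j' \<longrightarrow> P i' j') \<longleftrightarrow> (\<forall>i' < n. \<forall>j' < n. P i' j')"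
  by (auto simp: seen_def)

lemma ex_seen_all_col: "k < n \<Longrightarrow> (\<exists>j' < n. seen n 0 k j' \<and> Q j') \<longleftrightarrow> (\<exists>j' < n. Q j')"
  by (auto simp: seen_def)

lemma ex_seen_all_row: "(\<exists>i' < n. seen n 0 i' k \<and> Q i') \<longleftrightarrow> (\<exists>i' < n. Q i')"
  by (auto simp: seen_def)

lemma all_seen_Suc:
  assumes "i < n" "j < n"
  shows "(\<forall>i' < n. \<forall>j' < n. seen i (Suc j) i' j' \<longrightarrow> P i' j') \<longleftrightarrow>
    (\<forall>i' < n. \<forall>j' < n. seen i j i' j' \<longrightarrow> P i' j') \<and> P i j"
  using assms by (auto simp: seen_Suc)

lemma all_seen_next_row:
  "(\<forall>i' < n. \<forall>j' < n. seen (Suc i) 0 i' j' \<longrightarrow> P i' j') \<longleftrightarrow>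
    (\<forall>i' < n. \<forall>j' < n. seen i n i' j' \<longrightarrow> P i' j')"
  by (auto simp: seen_next_row)

lemma ex_seen_Suc_col:
  assumes "j < n"
  shows "(\<exists>j' < n. seen i (Suc j) k j' \<and> Q j') \<longleftrightarrow> (\<exists>j' < n. seen i j k j' \<and> Q j') \<or> (k = i \<and> Q j)"
  using assms by (auto simp: seen_Suc)

lemma ex_seen_Suc_row:
  assumes "i < n"
  shows "(\<exists>i' < n. seen i (Suc j) i' k \<and> Q i') \<longleftrightarrow> (\<exists>i' < n. seen i j i' k \<and> Q i') \<or> (k = j \<and> Q i)"
  using assms by (auto simp: seen_Suc)

lemma ex_seen_next_row_col:
  "(\<exists>j' < n. seen (Suc i) 0 k j' \<and> Q j') \<longleftrightarrow> (\<exists>j' < n. seen i n k j' \<and> Q j')"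
  by (auto simp: seen_next_row)

lemma ex_seen_next_row_row:
  "k < n \<Longrightarrow> (\<exists>i' < n. seen (Suc i) 0 i' k \<and> Q i') \<longleftrightarrow> (\<exists>i' < n. seen i n i' k \<and> Q i')"
  by (auto simp: seen_next_row)

lemmas seen_simps = all_seen_Suc all_seen_next_row ex_seen_Suc_col ex_seen_Suc_row
  ex_seen_next_row_col ex_seen_next_row_row all_seen_all ex_seen_all_col ex_seen_all_row

section \<open>Correctness and running time of the test of one placement\<close>

locale search_run = search +
  fixes inp :: "int \<Rightarrow> nat" and n N :: nat
  assumes inp_ones: "\<forall>i < n. inp (int i) = 2" and inp_sep: "inp (int n) \<noteq> 2"
    and inp_left: "inp (- 1) = 0" and inp_nonblank: "\<forall>i < n + 1 + n * n. inp (int i) \<noteq> 0"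
    and size_le: "n + 1 + n * n \<le> N"
begin

definition adj :: "nat \<Rightarrow> nat \<Rightarrow> bool" where
  "adj i j \<longleftrightarrow> inp (int n + 1 + int (i * n + j)) = 2"

lemma inp_adj: "inp (int n + 1 + (int i * int n + int j)) = 2 \<longleftrightarrow> adj i j"
  by (simp add: adj_def)

abbreviation state :: "registers \<Rightarrow> (nat \<Rightarrow> 'a set) \<Rightarrow> (nat \<Rightarrow> bool) \<Rightarrow> (nat \<Rightarrow> bool) \<Rightarrow> tape list" where
  "state r M d d' \<equiv> cfg inp n (int n + 1) 0 0 r (\<lambda>i. (M i, d i)) (\<lambda>i. (M i, d' i))"

abbreviation rest_state :: "registers \<Rightarrow> (nat \<Rightarrow> 'a set) \<Rightarrow> tape list" where
  "rest_state r M \<equiv> state r M (\<lambda>_. False) (\<lambda>_. False)"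

lemma arr_cong: "(\<And>i. i < n \<Longrightarrow> R i = R' i) \<Longrightarrow> arr n R = arr n R'"
  by (auto simp: arr_def fun_eq_iff)

text \<open>Only the values below \<open>n\<close> are on the tape, so an invariant may leave the
  label functions arbitrary elsewhere.\<close>

lemma state_cong:
  assumes "\<And>i. i < n \<Longrightarrow> R i = (M i, d i) \<and> C i = (M i, d' i)"
  shows "cfg inp n p 0 0 r R C = cfg inp n p 0 0 r (\<lambda>i. (M i, d i)) (\<lambda>i. (M i, d' i))"
  using arr_cong [of R "\<lambda>i. (M i, d i)"] arr_cong [of C "\<lambda>i. (M i, d' i)"] assms
  by (simp add: cfg_def)

lemma n_le: "n \<le> N" "n * n \<le> N"
  using size_le by auto

text \<open>From here on times are stated in \<open>N\<close>, later the length of the input, which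
  bounds both \<open>n\<close> and \<open>n * n\<close>.\<close>

lemma runs_pass_state:
  assumes "\<And>i r R C. i < n \<Longrightarrow> I i r R C \<Longrightarrow> R i \<in> Pow Vs \<times> UNIV \<and> C i \<in> Pow Vs \<times> UNIV \<and>
      (case g r (R i) (C i) of (r', x, y) \<Rightarrow> I (Suc i) r' (R(i := x)) (C(i := y)))"
    and "I 0 r (\<lambda>i. (M i, d i)) (\<lambda>i. (M i, d' i))"
    and "\<And>r R C. I n r R C \<Longrightarrow> r = r' \<and> (\<forall>i < n. R i = (M' i, e i) \<and> C i = (M' i, e' i))"
  shows "runs (pass g) (state r M d d') (6 * N + 7) (state r' M' e e')"
proof -
  obtain r1 R C where I: "I n r1 R C" and
    *: "runs (pass g) (state r M d d') (6 * n + 7) (cfg inp n (int n + 1) 0 0 r1 R C)"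
    using runs_pass [of n I g, OF assms(1,2)] by blast
  have "cfg inp n (int n + 1) 0 0 r1 R C = state r' M' e e'"
    using assms(3) [OF I] state_cong [of R M' e C e'] by simp
  with * show ?thesis
    using n_le by (auto intro: runs_mono)
qed

lemma runs_sweep_state:
  assumes "\<And>i j r R C. i < n \<Longrightarrow> j < n \<Longrightarrow> I i j r R C \<Longrightarrow>
      R i \<in> Pow Vs \<times> UNIV \<and> C j \<in> Pow Vs \<times> UNIV \<and>
      (case f (inp (int n + 1 + int (i * n + j))) r (R i) (C j) of
        (r', x, y) \<Rightarrow> I i (Suc j) r' (R(i := x)) (C(j := y)))"
    and "\<And>i r R C. i < n \<Longrightarrow> I i n r R C \<Longrightarrow> I (Suc i) 0 r R C"
    and "I 0 0 r (\<lambda>i. (M i, d i)) (\<lambda>i. (M i, d' i))"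
    and "\<And>r R C. I n 0 r R C \<Longrightarrow> r = r' \<and> (\<forall>i < n. R i = (M' i, e i) \<and> C i = (M' i, e' i))"
  shows "runs (sweep f) (state r M d d') (16 * N + 11) (state r' M' e e')"
proof -
  obtain r1 R C where I: "I n 0 r1 R C" and
    *: "runs (sweep_matrix f) (state r M d d') (n * (4 * n + 6) + 2 * n + 4)
      (cfg inp n (int n + 1 + int (n * n)) 0 0 r1 R C)"
    using runs_sweep_matrix [of n I f inp "int n + 1", OF assms(1-3)] by blast
  have eq: "int n + 1 + int (n * n) = int (n + 1 + n * n)"
    by simp
  have **: "runs home (cfg inp n (int n + 1 + int (n * n)) 0 0 r1 R C)
      (2 * (n + 1 + n * n) + 2 * n + 5) (cfg inp n (int n + 1) 0 0 r1 R C)"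
    unfolding eq by (rule runs_home) (use inp_ones inp_sep inp_left inp_nonblank in auto)
  have "cfg inp n (int n + 1) 0 0 r1 R C = state r' M' e e'"
    using assms(4) [OF I] state_cong [of R M' e C e'] by simp
  with runs_Seq [OF * **] have "runs (sweep f) (state r M d d')
      (n * (4 * n + 6) + 2 * n + 4 + (2 * (n + 1 + n * n) + 2 * n + 5)) (state r' M' e e')"
    by (simp add: sweep_def)
  \<comment> \<open>The sum is \<open>6 * n * n + 12 * n + 11\<close>, which \<open>size_le\<close>
    keeps below the bound.\<close>
  then show ?thesis
    by (rule runs_mono) (use size_le in \<open>simp add: algebra_simps\<close>)
qed

lemma runs_shift:
  assumes "\<And>i. i < n \<Longrightarrow> M i \<subseteq> Vs" "a \<in> Vs"
  shows "runs (pass (shift_step a)) (rest_state (fl, ok, res) M) (6 * N + 7)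
    (rest_state (if n = 0 then fl else a \<in> M (n - 1), ok, res)
      (\<lambda>i. if (if i = 0 then fl else a \<in> M (i - 1)) then insert a (M i) else M i - {a}))"
  by (rule runs_pass_state [where I = "\<lambda>k r R C. r = (if k = 0 then fl else a \<in> M (k - 1), ok, res) \<and>
      (\<forall>i < n. R i = (if i < k then
          (if (if i = 0 then fl else a \<in> M (i - 1)) then insert a (M i) else M i - {a}) else M i, False) \<and>
        C i = R i)"])
    (use assms in \<open>auto simp: less_Suc_eq\<close>)

definition embedded :: "(nat \<Rightarrow> 'a set) \<Rightarrow> bool" where
  "embedded M \<longleftrightarrow> (\<forall>i < n. \<forall>j < n. (\<forall>a \<in> M i. \<forall>b \<in> M j. adj i j \<longleftrightarrow> (a, b) \<in> A) \<and>
     (\<forall>a \<in> M i. \<forall>b \<in> M i. a = b))"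

lemma runs_check:
  assumes "\<And>i. i < n \<Longrightarrow> M i \<subseteq> Vs"
  shows "runs (sweep (check_step A)) (rest_state (fl, True, res) M) (16 * N + 11)
    (state (fl, embedded M, res) M (\<lambda>i. \<exists>j < n. adj i j \<and> M j \<noteq> {}) (\<lambda>j. \<exists>i < n. adj i j \<and> M i \<noteq> {}))"
proof -
  \<comment> \<open>Both conditions form one predicate, so that \<open>all_seen_Suc\<close> splits
    off the current entry as a whole.\<close>
  define P where "P i j \<longleftrightarrow> (\<forall>a \<in> M i. \<forall>b \<in> M j. adj i j \<longleftrightarrow> (a, b) \<in> A) \<and> (\<forall>a \<in> M i. \<forall>b \<in> M i. a = b)"
    for i j
  show ?thesis
    by (rule runs_sweep_state [where I = "\<lambda>i j r R C.
      r = (fl, \<forall>i' < n. \<forall>j' < n. seen i j i' j' \<longrightarrow> P i' j', res) \<and>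
      (\<forall>k < n. R k = (M k, \<exists>j' < n. seen i j k j' \<and> adj k j' \<and> M j' \<noteq> {}) \<and>
        C k = (M k, \<exists>i' < n. seen i j i' k \<and> adj i' k \<and> M i' \<noteq> {}))"])
      (use assms in \<open>simp_all add: seen_simps embedded_def inp_adj P_def\<close>)
qed

definition blocked :: "(nat \<Rightarrow> 'a set) \<Rightarrow> nat \<Rightarrow> bool" where
  "blocked M i \<longleftrightarrow> M i \<noteq> {} \<or> (\<exists>j < n. M j \<noteq> {} \<and> (adj i j \<or> adj j i))"

lemma runs_merge:
  assumes "\<And>i. i < n \<Longrightarrow> M i \<subseteq> Vs"
  shows "runs (pass merge_step)
    (state r M (\<lambda>i. \<exists>j < n. adj i j \<and> M j \<noteq> {}) (\<lambda>j. \<exists>i < n. adj i j \<and> M i \<noteq> {})) (6 * N + 7)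
    (state r M (\<lambda>_. True) (blocked M))"
  by (rule runs_pass_state [where I = "\<lambda>k r' R C. r' = r \<and>
      (\<forall>i < n. R i = (M i, i < k \<or> (\<exists>j < n. adj i j \<and> M j \<noteq> {})) \<and>
        C i = (M i, (i < k \<and> blocked M i) \<or> (\<exists>j < n. adj j i \<and> M j \<noteq> {})))"])
    (use assms in \<open>auto simp: less_Suc_eq blocked_def\<close>)

text \<open>The deletion marks \<open>D\<close> are fixed during the sweep, so all vertices of a
  round are judged against the same survivors.\<close>

lemma runs_peel_sweep:
  assumes "\<And>i. i < n \<Longrightarrow> M i \<subseteq> Vs"
  shows "runs (sweep peel_step) (state r M (\<lambda>_. True) D) (16 * N + 11)
    (state r M (\<lambda>i. \<not> (\<exists>j < n. adj i j \<and> \<not> D j)) D)"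
  by (rule runs_sweep_state [where I = "\<lambda>i j r' R C. r' = r \<and>
      (\<forall>k < n. R k = (M k, \<not> (\<exists>j' < n. seen i j k j' \<and> adj k j' \<and> \<not> D j')) \<and> C k = (M k, D k))"])
    (use assms in \<open>auto simp: seen_simps inp_adj\<close>)

lemma runs_collect:
  assumes "\<And>i. i < n \<Longrightarrow> M i \<subseteq> Vs"
  shows "runs (pass collect_step) (state (False, ok, res) M e D) (6 * N + 7)
    (state (\<exists>i < n. e i \<and> \<not> D i, ok, res) M (\<lambda>_. True) (\<lambda>i. e i \<or> D i))"
  by (rule runs_pass_state [where I = "\<lambda>k r R C. r = (\<exists>i < k. e i \<and> \<not> D i, ok, res) \<and>
      (\<forall>i < n. R i = (M i, i < k \<or> e i) \<and> C i = (M i, (i < k \<and> e i) \<or> D i))"])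
    (use assms in \<open>auto simp: less_Suc_eq\<close>)

lemma runs_finish:
  assumes "\<And>i. i < n \<Longrightarrow> M i \<subseteq> Vs"
  shows "runs (pass finish_step) (state (fl, ok, res) M (\<lambda>_. True) D) (6 * N + 7)
    (rest_state (fl, ok, res \<or> (ok \<and> (\<exists>i < n. \<not> D i))) M)"
  by (rule runs_pass_state [where I = "\<lambda>k r R C. r = (fl, ok, res \<or> (ok \<and> (\<exists>i < k. \<not> D i))) \<and>
      (\<forall>i < n. R i = (M i, \<not> i < k) \<and> C i = (M i, \<not> i < k \<and> D i))"])
    (use assms in \<open>auto simp: less_Suc_eq\<close>)

lemma runs_loop_sweep:
  assumes "\<And>i. i < n \<Longrightarrow> M i \<subseteq> Vs"
  shows "runs (sweep loop_step) (rest_state (fl, ok, res) M) (16 * N + 11)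
    (rest_state (fl, ok, res \<or> (\<exists>i < n. \<exists>j < n. adj i j \<and> M i \<inter> M j \<noteq> {})) M)"
proof -
  \<comment> \<open>The existential result is carried as a negated universal one, the form that
    \<open>all_seen_Suc\<close> extends.\<close>
  define P where "P i j \<longleftrightarrow> \<not> (adj i j \<and> M i \<inter> M j \<noteq> {})" for i j
  have "runs (sweep loop_step) (rest_state (fl, ok, res) M) (16 * N + 11)
    (rest_state (fl, ok, res \<or> \<not> (\<forall>i < n. \<forall>j < n. P i j)) M)"
    by (rule runs_sweep_state [where I = "\<lambda>i j r R C.
      r = (fl, ok, res \<or> \<not> (\<forall>i' < n. \<forall>j' < n. seen i j i' j' \<longrightarrow> P i' j')) \<and>
      (\<forall>k < n. R k = (M k, False) \<and> C k = (M k, False))"])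
      (use assms in \<open>simp_all add: seen_simps inp_adj\<close>, auto simp: P_def)
  then show ?thesis
    by (simp add: P_def)
qed

text \<open>Sets that induce a subdigraph without sinks. Unlike vertex sets of directed cycles, they
  are closed under union.\<close>

definition closed :: "nat set \<Rightarrow> bool" where
  "closed W \<longleftrightarrow> (\<forall>i \<in> W. \<exists>j \<in> W. adj i j)"

definition alive :: "(nat \<Rightarrow> bool) \<Rightarrow> nat set" where
  "alive D = {i. i < n \<and> \<not> D i}"

lemma finite_alive [simp]: "finite (alive D)"
  by (simp add: alive_def)

lemma runs_set_reg_state:
  "h r = r' \<Longrightarrow> runs (set_reg h) (state r M d d') 1 (state r' M d d')"
  using runs_set_reg by blast

text \<open>A round that leaves the flag set has deleted a vertex, so fewer than \<open>k\<close>
  survivors allow at most \<open>k\<close> rounds; a clear flag means that the survivors are closed.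
  A closed set of survivors never loses a vertex, since each of its members keeps an out-neighbour,
  so the greatest closed set is what is left.\<close>

lemma runs_peel:
  assumes M: "\<And>i. i < n \<Longrightarrow> M i \<subseteq> Vs"
    and "if fl then card (alive D) < k else closed (alive D)"
  shows "\<exists>D'. runs peel (state (fl, ok, res) M (\<lambda>_. True) D) (k * (22 * N + 20) + 1)
      (state (False, ok, res) M (\<lambda>_. True) D') \<and>
    alive D' \<subseteq> alive D \<and> closed (alive D') \<and> (\<forall>W. closed W \<and> W \<subseteq> alive D \<longrightarrow> W \<subseteq> alive D')"
  using assms(2)
proof (induction k arbitrary: fl D)
  case 0
  then have "\<not> fl" "closed (alive D)" by (auto split: if_splits)
  then show ?case
    unfolding peel_def
    by (intro exI [of _ D]) (auto intro!: runs_Loop_False simp: unreg_reg simp del: One_nat_def)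
next
  case (Suc k)
  show ?case
  proof (cases fl)
    case False
    then show ?thesis
      using Suc.prems unfolding peel_def
      by (intro exI [of _ D] conjI)
        (auto intro!: runs_mono [OF runs_Loop_False] simp: unreg_reg simp del: One_nat_def)
  next
    case True
    define e where "e i \<longleftrightarrow> \<not> (\<exists>j < n. adj i j \<and> \<not> D j)" for i
    define D1 where "D1 i \<longleftrightarrow> e i \<or> D i" for i
    define fl1 where "fl1 \<longleftrightarrow> (\<exists>i < n. e i \<and> \<not> D i)"
    have alive1: "alive D1 = {i \<in> alive D. \<exists>j \<in> alive D. adj i j}"
      by (auto simp: alive_def D1_def e_def)
    have fl1: "fl1 \<longleftrightarrow> alive D1 \<noteq> alive D"
      unfolding fl1_def alive1 by (auto simp: alive_def e_def)
    have "if fl1 then card (alive D1) < k else closed (alive D1)"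
    proof (cases fl1)
      case True
      then have "alive D1 \<subset> alive D" using fl1 alive1 by blast
      then have "card (alive D1) < card (alive D)" by (simp add: psubset_card_mono)
      then show ?thesis using True \<open>fl\<close> Suc.prems by simp
    next
      case False
      then have "alive D1 = alive D" using fl1 by simp
      then show ?thesis using False alive1 by (auto simp: closed_def)
    qed
    from Suc.IH [OF this] obtain D' where
      *: "runs peel (state (fl1, ok, res) M (\<lambda>_. True) D1) (k * (22 * N + 20) + 1)
        (state (False, ok, res) M (\<lambda>_. True) D') \<and> alive D' \<subseteq> alive D1 \<and> closed (alive D') \<and>
        (\<forall>W. closed W \<and> W \<subseteq> alive D1 \<longrightarrow> W \<subseteq> alive D')"
      by (rule exE)
    note rest = * [THEN conjunct1] and D' = * [THEN conjunct2]
    have max: "W \<subseteq> alive D'" if "closed W" "W \<subseteq> alive D" for W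
    proof -
      have "W \<subseteq> alive D1"
        using that unfolding alive1 closed_def by blast
      then show ?thesis using D' that by simp
    qed
    have 1: "runs (set_reg (\<lambda>(fl, ok, res). (False, ok, res))) (state (fl, ok, res) M (\<lambda>_. True) D) 1
        (state (False, ok, res) M (\<lambda>_. True) D)"
      by (rule runs_set_reg_state) simp
    have 2: "runs (sweep peel_step) (state (False, ok, res) M (\<lambda>_. True) D) (16 * N + 11)
        (state (False, ok, res) M e D)"
      using runs_peel_sweep [of M "(False, ok, res)" D, OF M] by (simp add: e_def [abs_def])
    have 3: "runs (pass collect_step) (state (False, ok, res) M e D) (6 * N + 7)
        (state (fl1, ok, res) M (\<lambda>_. True) D1)"
      using runs_collect [of M ok res e D, OF M] by (simp add: fl1_def D1_def [abs_def])
    \<comment> \<open>One round: \<open>2\<close> for the test and the register,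
      \<open>16 * N + 11\<close> for the sweep, \<open>6 * N + 7\<close> for the pass.\<close>
    have "runs peel (state (fl, ok, res) M (\<lambda>_. True) D) (Suc k * (22 * N + 20) + 1)
        (state (False, ok, res) M (\<lambda>_. True) D')"
      unfolding peel_def
      by (rule runs_mono [OF runs_Loop_True [OF _ runs_Seq [OF 1 runs_Seq [OF 2 3]] rest [unfolded peel_def]]])
        (use True in \<open>simp_all add: unreg_reg\<close>)
    moreover have "alive D' \<subseteq> alive D"
      using D' unfolding alive1 by blast
    ultimately show ?thesis
      using D' max by (intro exI [of _ D'] conjI) simp_all
  qed
qed

definition good :: "(nat \<Rightarrow> 'a set) \<Rightarrow> bool" where
  "good M \<longleftrightarrow> embedded M \<and> (\<exists>W. W \<noteq> {} \<and> W \<subseteq> {i. i < n \<and> \<not> blocked M i} \<and> closed W)"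

text \<open>The contract that lets loops nest: the placement is left as it was found and the result
  only gains a disjunct, while flag and \<open>ok\<close> are scratch.\<close>

definition accumulates :: "prog \<Rightarrow> nat \<Rightarrow> (nat \<Rightarrow> 'a set) \<Rightarrow> bool \<Rightarrow> bool" where
  "accumulates c T M B \<longleftrightarrow> (\<forall>fl ok res. \<exists>fl' ok'.
     runs c (rest_state (fl, ok, res) M) T (rest_state (fl', ok', res \<or> B) M))"

lemma accumulates_test_placement:
  assumes M: "\<And>i. i < n \<Longrightarrow> M i \<subseteq> Vs"
  shows "accumulates test_placement ((N + 1) * (22 * N + 20) + 28 * N + 27) M (good M)"
  unfolding accumulates_def
proof (intro allI)
  fix fl ok res :: bool
  let ?r = "(True, embedded M, res)"
  have "alive (blocked M) \<subseteq> {..<n}"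
    by (auto simp: alive_def)
  then have "card (alive (blocked M)) \<le> n"
    using card_mono [of "{..<n}"] by fastforce
  \<comment> \<open>\<open>N + 1\<close> rounds suffice as at most \<open>n\<close> vertices are
    alive at the start; \<open>if True\<close> matches the premise of \<open>runs_peel\<close> for a
    set flag.\<close>
  then have "if True then card (alive (blocked M)) < N + 1 else closed (alive (blocked M))"
    using n_le by simp
  from runs_peel [of M True "blocked M" "N + 1" "embedded M" res, OF M this] obtain D where
    *: "runs peel (state ?r M (\<lambda>_. True) (blocked M)) ((N + 1) * (22 * N + 20) + 1)
        (state (False, embedded M, res) M (\<lambda>_. True) D) \<and>
      alive D \<subseteq> alive (blocked M) \<and> closed (alive D) \<and>
      (\<forall>W. closed W \<and> W \<subseteq> alive (blocked M) \<longrightarrow> W \<subseteq> alive D)"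
    by (rule exE)
  note peel = * [THEN conjunct1] and D = * [THEN conjunct2]
  have alive: "(\<exists>i < n. \<not> D i) \<longleftrightarrow> alive D \<noteq> {}"
    by (auto simp: alive_def)
  have "good M \<longleftrightarrow> embedded M \<and> (\<exists>W. W \<noteq> {} \<and> W \<subseteq> alive (blocked M) \<and> closed W)"
    by (simp add: good_def alive_def)
  \<comment> \<open>As \<open>alive D\<close> is the greatest closed set of unblocked vertices, it
    is nonempty as soon as any nonempty one exists.\<close>
  also have "\<dots> \<longleftrightarrow> embedded M \<and> (\<exists>i < n. \<not> D i)"
    unfolding alive using D by blast
  finally have good: "(embedded M \<and> (\<exists>i < n. \<not> D i)) = good M" ..
  have 1: "runs (set_reg (\<lambda>(fl, ok, res). (True, True, res))) (rest_state (fl, ok, res) M) 1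
      (rest_state (True, True, res) M)"
    by (rule runs_set_reg_state) simp
  have "runs test_placement (rest_state (fl, ok, res) M) ((N + 1) * (22 * N + 20) + 28 * N + 27)
      (rest_state (False, embedded M, res \<or> good M) M)"
    unfolding test_placement_def
    by (rule runs_mono [OF runs_Seq [OF 1 runs_Seq [OF runs_check [where M = M and fl = True, OF M]
        runs_Seq [OF runs_merge [where M = M, OF M] runs_Seq [OF peel runs_finish [where M = M and fl = False and D = D and ok = "embedded M" and res = res, OF M, unfolded good]]]]]])
      simp_all
  then show "\<exists>fl' ok'. runs test_placement (rest_state (fl, ok, res) M)
      ((N + 1) * (22 * N + 20) + 28 * N + 27) (rest_state (fl', ok', res \<or> good M) M)"
    by blast
qed

lemma accumulates_loop_sweep:
  assumes "\<And>i. i < n \<Longrightarrow> M i \<subseteq> Vs"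
  shows "accumulates (sweep loop_step) (16 * N + 11) M (\<exists>i < n. \<exists>j < n. adj i j \<and> M i \<inter> M j \<noteq> {})"
  unfolding accumulates_def using runs_loop_sweep [of M, OF assms] by blast

section \<open>Enumeration of all placements\<close>

lemma runs_for_each_loop:
  assumes M: "\<And>i. i < n \<Longrightarrow> M i \<subseteq> Vs" "\<And>i. i < n \<Longrightarrow> a \<notin> M i" and a: "a \<in> Vs"
    and c: "\<And>i. i < n \<Longrightarrow> accumulates c T (put a i M) (B i)"
    and "i + k = n"
  shows "\<exists>ok'. runs (Loop (\<lambda>xs. \<not> fst (unreg (xs ! 3)))
      (Seq c (Seq (set_reg (\<lambda>(fl, ok, res). (False, ok, res))) (pass (shift_step a)))))
    (rest_state (i \<ge> n, ok, res) (put a i M)) (k * (T + 6 * N + 9) + 1)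
    (rest_state (True, ok', res \<or> (\<exists>j. i \<le> j \<and> j < n \<and> B j)) M)"
  using assms(5)
proof (induction k arbitrary: i ok res)
  case 0
  then have "i = n" by simp
  \<comment> \<open>Position \<open>n\<close> lies outside the array, so a mark put there is not on
    the tape: leaving the array restores the original placement.\<close>
  have eq: "rest_state (True, ok, res) (put a n M) = rest_state (True, ok, res) M"
    by (rule state_cong) (simp add: put_def)
  have "runs (Loop (\<lambda>xs. \<not> fst (unreg (xs ! 3)))
      (Seq c (Seq (set_reg (\<lambda>(fl, ok, res). (False, ok, res))) (pass (shift_step a)))))
      (rest_state (True, ok, res) M) 1 (rest_state (True, ok, res) M)"
    by (rule runs_Loop_False) (simp add: unreg_reg)
  moreover have "(res \<or> (\<exists>j. n \<le> j \<and> j < n \<and> B j)) = res"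
    by auto
  ultimately show ?case
    unfolding \<open>i = n\<close> by (intro exI [of _ ok]) (simp only: eq order_refl mult_0 add_0)
next
  case (Suc k)
  then have i: "i < n" by simp
  obtain fl' ok' where 1: "runs c (rest_state (i \<ge> n, ok, res) (put a i M)) T
      (rest_state (fl', ok', res \<or> B i) (put a i M))"
    using c [OF i] unfolding accumulates_def by blast
  have 2: "runs (set_reg (\<lambda>(fl, ok, res). (False, ok, res)))
      (rest_state (fl', ok', res \<or> B i) (put a i M)) 1
      (rest_state (False, ok', res \<or> B i) (put a i M))"
    by (rule runs_set_reg_state) simp
  have "\<And>k. k < n \<Longrightarrow> put a i M k \<subseteq> Vs"
    using M a by (auto simp: put_def)
  note shift = runs_shift [where fl = False and ok = ok' and res = "res \<or> B i", OF this a]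
  \<comment> \<open>The carry after the pass is set exactly if the mark was on the last
    vertex.\<close>
  have flag: "(if n = 0 then False else a \<in> put a i M (n - 1)) = (Suc i \<ge> n)"
    using i M(2) [of "n - 1"] by (auto simp: put_def)
  have "rest_state (if n = 0 then False else a \<in> put a i M (n - 1), ok', res \<or> B i)
      (\<lambda>k. if (if k = 0 then False else a \<in> put a i M (k - 1)) then insert a (put a i M k)
        else put a i M k - {a}) =
    rest_state (Suc i \<ge> n, ok', res \<or> B i) (\<lambda>k. if (if k = 0 then False else a \<in> put a i M (k - 1))
      then insert a (put a i M k) else put a i M k - {a})"
    by (simp only: flag)
  also have "\<dots> = rest_state (Suc i \<ge> n, ok', res \<or> B i) (put a (Suc i) M)"
  proof (rule state_cong)
    fix k
    assume "k < n"
    then have "a \<notin> M k" "a \<notin> M (k - 1)"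
      using M(2) by auto
    then show "((if (if k = 0 then False else a \<in> put a i M (k - 1)) then insert a (put a i M k)
        else put a i M k - {a}), False) = (put a (Suc i) M k, False) \<and>
      ((if (if k = 0 then False else a \<in> put a i M (k - 1)) then insert a (put a i M k)
        else put a i M k - {a}), False) = (put a (Suc i) M k, False)"
      by (cases k) (auto simp: put_def)
  qed
  finally have 3: "runs (pass (shift_step a)) (rest_state (False, ok', res \<or> B i) (put a i M)) (6 * N + 7)
      (rest_state (Suc i \<ge> n, ok', res \<or> B i) (put a (Suc i) M))"
    by (rule subst [where P = "runs (pass (shift_step a))
        (rest_state (False, ok', res \<or> B i) (put a i M)) (6 * N + 7)", OF _ shift])
  obtain ok'' where rest: "runs (Loop (\<lambda>xs. \<not> fst (unreg (xs ! 3)))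
      (Seq c (Seq (set_reg (\<lambda>(fl, ok, res). (False, ok, res))) (pass (shift_step a)))))
    (rest_state (Suc i \<ge> n, ok', res \<or> B i) (put a (Suc i) M)) (k * (T + 6 * N + 9) + 1)
    (rest_state (True, ok'', (res \<or> B i) \<or> (\<exists>j. Suc i \<le> j \<and> j < n \<and> B j)) M)"
    using Suc.IH [of "Suc i" ok' "res \<or> B i"] Suc.prems by auto
  have B: "((res \<or> B i) \<or> (\<exists>j. Suc i \<le> j \<and> j < n \<and> B j)) = (res \<or> (\<exists>j. i \<le> j \<and> j < n \<and> B j))"
    using i by (metis Suc_leD Suc_le_eq le_neq_implies_less order_refl)
  have "runs (Loop (\<lambda>xs. \<not> fst (unreg (xs ! 3)))
      (Seq c (Seq (set_reg (\<lambda>(fl, ok, res). (False, ok, res))) (pass (shift_step a)))))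
    (rest_state (i \<ge> n, ok, res) (put a i M)) (Suc k * (T + 6 * N + 9) + 1)
    (rest_state (True, ok'', res \<or> (\<exists>j. i \<le> j \<and> j < n \<and> B j)) M)"
    by (rule runs_mono [OF runs_Loop_True [OF _ runs_Seq [OF 1 runs_Seq [OF 2 3]] rest [unfolded B]]])
      (use i in \<open>simp_all add: unreg_reg\<close>)
  then show ?case by blast
qed

lemma accumulates_for_each:
  assumes M: "\<And>i. i < n \<Longrightarrow> M i \<subseteq> Vs" "\<And>i. i < n \<Longrightarrow> a \<notin> M i" and a: "a \<in> Vs"
    and c: "\<And>i. i < n \<Longrightarrow> accumulates c T (put a i M) (B i)"
  shows "accumulates (for_each a c) (N * (T + 6 * N + 9) + 6 * N + 9) M (\<exists>i < n. B i)"
  unfolding accumulates_def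
proof (intro allI)
  fix fl ok res :: bool
  have 1: "runs (set_reg (\<lambda>(fl, ok, res). (True, ok, res))) (rest_state (fl, ok, res) M) 1
      (rest_state (True, ok, res) M)"
    by (rule runs_set_reg_state) simp
  note shift = runs_shift [where fl = True and ok = ok and res = res, OF M(1) a]
  \<comment> \<open>For \<open>n = 0\<close> the inserted mark falls out at once, and the set flag
    prevents the first iteration.\<close>
  have "rest_state (if n = 0 then True else a \<in> M (n - 1), ok, res)
      (\<lambda>k. if (if k = 0 then True else a \<in> M (k - 1)) then insert a (M k) else M k - {a}) =
    rest_state (0 \<ge> n, ok, res)
      (\<lambda>k. if (if k = 0 then True else a \<in> M (k - 1)) then insert a (M k) else M k - {a})"
    using M(2) [of "n - 1"] by auto
  also have "\<dots> = rest_state (0 \<ge> n, ok, res) (put a 0 M)"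
  proof (rule state_cong)
    fix k
    assume "k < n"
    then have "a \<notin> M k" "a \<notin> M (k - 1)"
      using M(2) by auto
    then show "((if (if k = 0 then True else a \<in> M (k - 1)) then insert a (M k) else M k - {a}), False) =
        (put a 0 M k, False) \<and>
      ((if (if k = 0 then True else a \<in> M (k - 1)) then insert a (M k) else M k - {a}), False) =
        (put a 0 M k, False)"
      by (auto simp: put_def)
  qed
  finally have 2: "runs (pass (shift_step a)) (rest_state (True, ok, res) M) (6 * N + 7)
      (rest_state (0 \<ge> n, ok, res) (put a 0 M))"
    by (rule subst [where P = "runs (pass (shift_step a)) (rest_state (True, ok, res) M) (6 * N + 7)",
        OF _ shift])
  obtain ok' where 3: "runs (Loop (\<lambda>xs. \<not> fst (unreg (xs ! 3)))
      (Seq c (Seq (set_reg (\<lambda>(fl, ok, res). (False, ok, res))) (pass (shift_step a)))))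
    (rest_state (0 \<ge> n, ok, res) (put a 0 M)) (n * (T + 6 * N + 9) + 1)
    (rest_state (True, ok', res \<or> (\<exists>j. 0 \<le> j \<and> j < n \<and> B j)) M)"
    by (rule exE [OF runs_for_each_loop [where i = 0 and ok = ok and res = res, OF M a c]]) simp_all
  have B: "(\<exists>j. 0 \<le> j \<and> j < n \<and> B j) = (\<exists>j < n. B j)"
    by simp
  have "runs (for_each a c) (rest_state (fl, ok, res) M) (N * (T + 6 * N + 9) + 6 * N + 9)
      (rest_state (True, ok', res \<or> (\<exists>j < n. B j)) M)"
    unfolding for_each_def
    by (rule runs_mono [OF runs_Seq [OF 1 runs_Seq [OF 2 3 [unfolded B]]]])
      (use mult_le_mono1 [OF n_le(1), of "T + 6 * N + 9"] in simp)
  then show "\<exists>fl' ok'. runs (for_each a c) (rest_state (fl, ok, res) M)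
      (N * (T + 6 * N + 9) + 6 * N + 9) (rest_state (fl', ok', res \<or> (\<exists>i < n. B i)) M)"
    by blast
qed

end

fun nest_time :: "nat \<Rightarrow> nat \<Rightarrow> nat \<Rightarrow> nat" where
  "nest_time 0 N T = T"
| "nest_time (Suc k) N T = N * (nest_time k N T + 6 * N + 9) + 6 * N + 9"

text \<open>The degree grows with the depth \<open>k\<close>. This is where it matters that the
  pattern, and with it the number of nested loops, is fixed.\<close>

lemma poly_bounded_nest_time: "poly_bounded T \<Longrightarrow> poly_bounded (\<lambda>N. nest_time k N (T N))"
  by (induction k) auto

definition placed :: "('v \<Rightarrow> nat) \<Rightarrow> 'v set \<Rightarrow> nat \<Rightarrow> 'v set" where
  "placed \<phi> V k = {a \<in> V. \<phi> a = k}"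

context search_run
begin

text \<open>\<open>M\<close> holds the marks of the enclosing loops; its disjointness from
  \<open>as\<close> lets every inner loop move its own mark. The positions chosen loop by loop form
  the function \<open>\<phi>\<close>.\<close>

lemma accumulates_nest:
  assumes "\<And>i. i < n \<Longrightarrow> M i \<subseteq> Vs" "set as \<subseteq> Vs" "distinct as"
    and "\<And>i. i < n \<Longrightarrow> M i \<inter> set as = {}"
    and "\<And>M. (\<And>i. i < n \<Longrightarrow> M i \<subseteq> Vs) \<Longrightarrow> accumulates c T M (B M)"
  shows "accumulates (nest as c) (nest_time (length as) N T) M
    (\<exists>\<phi>. (\<forall>a \<in> set as. \<phi> a < n) \<and> B (\<lambda>k. M k \<union> placed \<phi> (set as) k))"
  using assms(1-4)
proof (induction as arbitrary: M)
  case Nil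
  then show ?case
    using assms(5) by (simp add: placed_def)
next
  case (Cons a as)
  let ?B = "\<lambda>i. \<exists>\<phi>. (\<forall>a \<in> set as. \<phi> a < n) \<and> B (\<lambda>k. put a i M k \<union> placed \<phi> (set as) k)"
  have "accumulates (for_each a (nest as c)) (N * (nest_time (length as) N T + 6 * N + 9) + 6 * N + 9) M
      (\<exists>i < n. ?B i)"
  proof (rule accumulates_for_each)
    fix i
    assume "i < n"
    show "accumulates (nest as c) (nest_time (length as) N T) (put a i M) (?B i)"
    proof (rule Cons.IH)
      fix k
      assume "k < n"
      then show "put a i M k \<subseteq> Vs"
        using Cons.prems(1) [of k] Cons.prems(2) by (auto simp: put_def)
      show "put a i M k \<inter> set as = {}"
        using Cons.prems(3) Cons.prems(4) [OF \<open>k < n\<close>] by (auto simp: put_def)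
    qed (use Cons.prems in auto)
  qed (use Cons.prems in auto)
  moreover have "(\<exists>i < n. ?B i) \<longleftrightarrow>
      (\<exists>\<phi>. (\<forall>b \<in> set (a # as). \<phi> b < n) \<and> B (\<lambda>k. M k \<union> placed \<phi> (set (a # as)) k))" (is "?l \<longleftrightarrow> ?r")
  proof
    assume ?l
    then obtain i \<phi> where *: "i < n" "\<forall>a \<in> set as. \<phi> a < n"
        "B (\<lambda>k. put a i M k \<union> placed \<phi> (set as) k)"
      by blast
    have "(\<lambda>k. put a i M k \<union> placed \<phi> (set as) k) =
        (\<lambda>k. M k \<union> placed (\<phi>(a := i)) (set (a # as)) k)"
      using Cons.prems(3) by (auto simp: put_def placed_def fun_eq_iff)
    with * show ?r
      by (intro exI [of _ "\<phi>(a := i)"]) auto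
  next
    assume ?r
    then obtain \<phi> where *: "\<forall>b \<in> set (a # as). \<phi> b < n" "B (\<lambda>k. M k \<union> placed \<phi> (set (a # as)) k)"
      by blast
    have "(\<lambda>k. M k \<union> placed \<phi> (set (a # as)) k) = (\<lambda>k. put a (\<phi> a) M k \<union> placed \<phi> (set as) k)"
      by (auto simp: put_def placed_def fun_eq_iff)
    with * show ?l
      by (intro exI [of _ "\<phi> a"]) auto
  qed
  ultimately show ?case by simp
qed

end

text \<open>The interface between machine and graph theory: being stated for arbitrary
  \<open>E\<close> and \<open>P\<close>, it expresses both what the search tests on a word and what
  an induced subdivision amounts to. The set \<open>W\<close> stands for the directed cycle.\<close>

definition good_placement :: "'v rel \<Rightarrow> 'v set \<Rightarrow> 'w rel \<Rightarrow> 'w set \<Rightarrow> ('v \<Rightarrow> 'w) \<Rightarrow> bool" where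
  "good_placement A V E P \<phi> \<longleftrightarrow>
     \<phi> ` V \<subseteq> P \<and> inj_on \<phi> V \<and> (\<forall>a \<in> V. \<forall>b \<in> V. (\<phi> a, \<phi> b) \<in> E \<longleftrightarrow> (a, b) \<in> A) \<and>
     (\<exists>W. W \<noteq> {} \<and> W \<subseteq> P \<and> (\<forall>i \<in> W. \<exists>j \<in> W. (i, j) \<in> E) \<and>
        (\<forall>i \<in> W. \<forall>a \<in> V. i \<noteq> \<phi> a \<and> (i, \<phi> a) \<notin> E \<and> (\<phi> a, i) \<notin> E))"

context search_run
begin

lemma good_placed:
  assumes "\<forall>a \<in> V. \<phi> a < n"
  shows "good (placed \<phi> V) \<longleftrightarrow> good_placement A V {(i, j). i < n \<and> j < n \<and> adj i j} {..<n} \<phi>"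
proof -
  let ?E = "{(i, j). i < n \<and> j < n \<and> adj i j}"
  have emb: "embedded (placed \<phi> V) \<longleftrightarrow>
      inj_on \<phi> V \<and> (\<forall>a \<in> V. \<forall>b \<in> V. (\<phi> a, \<phi> b) \<in> ?E \<longleftrightarrow> (a, b) \<in> A)"
  proof
    assume "embedded (placed \<phi> V)"
    then have *: "\<And>i j a b. i < n \<Longrightarrow> j < n \<Longrightarrow> a \<in> V \<Longrightarrow> \<phi> a = i \<Longrightarrow> b \<in> V \<Longrightarrow> \<phi> b = j \<Longrightarrow>
          adj i j \<longleftrightarrow> (a, b) \<in> A"
      and **: "\<And>i a b. i < n \<Longrightarrow> a \<in> V \<Longrightarrow> \<phi> a = i \<Longrightarrow> b \<in> V \<Longrightarrow> \<phi> b = i \<Longrightarrow> a = b"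
      unfolding embedded_def placed_def by simp_all
    show "inj_on \<phi> V \<and> (\<forall>a \<in> V. \<forall>b \<in> V. (\<phi> a, \<phi> b) \<in> ?E \<longleftrightarrow> (a, b) \<in> A)"
      using assms by (auto intro!: inj_onI ** simp: *)
  next
    assume "inj_on \<phi> V \<and> (\<forall>a \<in> V. \<forall>b \<in> V. (\<phi> a, \<phi> b) \<in> ?E \<longleftrightarrow> (a, b) \<in> A)"
    then show "embedded (placed \<phi> V)"
      using assms by (auto simp: embedded_def placed_def dest: inj_onD)
  qed
  have "i < n \<and> \<not> blocked (placed \<phi> V) i \<longleftrightarrow>
      i < n \<and> (\<forall>a \<in> V. i \<noteq> \<phi> a \<and> (i, \<phi> a) \<notin> ?E \<and> (\<phi> a, i) \<notin> ?E)" for i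
    using assms by (auto simp: blocked_def placed_def)
  then have sub: "W \<subseteq> {i. i < n \<and> \<not> blocked (placed \<phi> V) i} \<longleftrightarrow>
      W \<subseteq> {..<n} \<and> (\<forall>i \<in> W. \<forall>a \<in> V. i \<noteq> \<phi> a \<and> (i, \<phi> a) \<notin> ?E \<and> (\<phi> a, i) \<notin> ?E)" for W
    by blast
  have cl: "closed W \<longleftrightarrow> (\<forall>i \<in> W. \<exists>j \<in> W. (i, j) \<in> ?E)" if "W \<subseteq> {..<n}" for W
    using that by (auto simp: closed_def subset_eq)
  have cycle: "W \<subseteq> {i. i < n \<and> \<not> blocked (placed \<phi> V) i} \<and> closed W \<longleftrightarrow>
      W \<subseteq> {..<n} \<and> (\<forall>i \<in> W. \<exists>j \<in> W. (i, j) \<in> ?E) \<and>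
      (\<forall>i \<in> W. \<forall>a \<in> V. i \<noteq> \<phi> a \<and> (i, \<phi> a) \<notin> ?E \<and> (\<phi> a, i) \<notin> ?E)" for W
    unfolding sub using cl [of W] by argo
  have "\<phi> ` V \<subseteq> {..<n}"
    using assms by auto
  then show ?thesis
    unfolding good_def good_placement_def emb cycle by simp
qed

end

section \<open>The format of the word, and the whole machine\<close>

context search
begin

text \<open>A word with a nonzero diagonal entry encodes no digraph and is rejected by clearing the
  result. The mark \<open>a0\<close> serves to run along the diagonal.\<close>

definition search_all :: "'v list \<Rightarrow> 'v \<Rightarrow> prog" where
  "search_all vs a0 = Seq (for_each a0 (sweep loop_step))
     (Cond (\<lambda>xs. snd (snd (unreg (xs ! 3))))
       (set_reg (\<lambda>_. (False, False, False)))
       (nest vs test_placement))"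

definition fill :: prog where
  "fill = Loop (\<lambda>xs. xs ! 0 = 2)
     (Act (\<lambda>xs. [(xs ! 0, Move_Right), (lab ({}, False), Move_Right), (lab ({}, False), Move_Right),
        (xs ! 3, Stay)]))"

text \<open>Three rejections precede the search: no separator after the unary prefix, a blank inside
  the matrix, a symbol behind it.\<close>

definition decide :: "'v list \<Rightarrow> 'v \<Rightarrow> prog" where
  "decide vs a0 =
    Seq (set_reg (\<lambda>_. (False, False, False))) (Seq fill (Seq (rewind 1) (Seq (rewind 2)
      (Cond (\<lambda>xs. xs ! 0 = 0)
        (set_reg (\<lambda>_. (False, False, False)))
        (Seq (move_tape 0 Move_Right) (Seq (sweep_matrix short_step)
          (Cond (\<lambda>xs. snd (snd (unreg (xs ! 3))) \<or> xs ! 0 \<noteq> 0)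
            (set_reg (\<lambda>_. (False, False, False)))
            (Seq home (search_all vs a0)))))))))"

lemma wf_fill: "wf_prog 4 m fill"
proof -
  have "xs ! 0 < m" "xs ! 3 < m" if "length xs = 4" "set xs \<subseteq> {..<m}" for xs
    using that nth_less by simp_all
  then show ?thesis
    by (auto simp: fill_def lab_less)
qed

lemma wf_decide: "wf_prog 4 m (decide vs a0)"
  using wf_fill by (simp add: decide_def search_all_def)

text \<open>The arrays have length \<open>i\<close> here: they grow along with the part of the
  prefix that has been read.\<close>

lemma runs_fill:
  assumes "\<forall>i < n. inp (int i) = 2" "inp (int n) \<noteq> 2" "i + k = n"
  shows "runs fill (cfg inp i (int i) (int i) (int i) r (\<lambda>_. ({}, False)) (\<lambda>_. ({}, False))) (2 * k + 1)
    (cfg inp n (int n) (int n) (int n) r (\<lambda>_. ({}, False)) (\<lambda>_. ({}, False)))"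
  using assms(3)
proof (induction k arbitrary: i)
  case 0
  then show ?case
    using assms(2) unfolding fill_def
    by (simp del: One_nat_def) (rule runs_Loop_False, simp)
next
  case (Suc k)
  then have i: "i < n" by simp
  have upd: "(arr i (\<lambda>_. ({}, False)))(int i := lab ({}, False)) = arr (Suc i) (\<lambda>_. ({}, False))"
    by (auto simp: arr_def fun_eq_iff)
  have "runs (Act (\<lambda>xs. [(xs ! 0, Move_Right), (lab ({}, False), Move_Right),
        (lab ({}, False), Move_Right), (xs ! 3, Stay)]))
      (cfg inp i (int i) (int i) (int i) r (\<lambda>_. ({}, False)) (\<lambda>_. ({}, False))) 1
      (cfg inp (Suc i) (int (Suc i)) (int (Suc i)) (int (Suc i)) r (\<lambda>_. ({}, False)) (\<lambda>_. ({}, False)))"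
    by (rule runs_Act) (simp, auto simp: cfg_def upd)
  note step = runs_Loop_True [where b = "\<lambda>xs. xs ! 0 = 2", OF _ this]
  have "Suc i + k = n"
    using Suc.prems by simp
  note rest = Suc.IH [OF this, unfolded fill_def]
  show ?case
    unfolding fill_def
    by (rule runs_mono [OF step [OF _ rest]]) (use i assms(1) in auto)
qed

lemma runs_short:
  "runs (sweep_matrix short_step)
      (cfg inp n p 0 0 (False, False, False) (\<lambda>_. ({}, False)) (\<lambda>_. ({}, False)))
      (n * (4 * n + 6) + 2 * n + 4)
      (cfg inp n (p + int (n * n)) 0 0
        (False, False, \<exists>i < n. \<exists>j < n. inp (p + int (i * n + j)) = 0)
        (\<lambda>_. ({}, False)) (\<lambda>_. ({}, False)))"
proof -
  define P where "P i j \<longleftrightarrow> inp (p + int (i * n + j)) \<noteq> 0" for i j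
  have P: "(\<exists>i < n. \<exists>j < n. inp (p + int (i * n + j)) = 0) = (\<not> (\<forall>i < n. \<forall>j < n. P i j))"
    by (simp add: P_def)
  have "\<exists>r R C. (r = (False, False, \<not> (\<forall>i' < n. \<forall>j' < n. seen n 0 i' j' \<longrightarrow> P i' j')) \<and>
      R = (\<lambda>_. ({}, False)) \<and> C = (\<lambda>_. ({}, False))) \<and>
    runs (sweep_matrix short_step)
      (cfg inp n p 0 0 (False, False, False) (\<lambda>_. ({}, False)) (\<lambda>_. ({}, False)))
      (n * (4 * n + 6) + 2 * n + 4) (cfg inp n (p + int (n * n)) 0 0 r R C)"
  proof (rule runs_sweep_matrix [where I = "\<lambda>i j r R C.
        r = (False, False, \<not> (\<forall>i' < n. \<forall>j' < n. seen i j i' j' \<longrightarrow> P i' j')) \<and>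
        R = (\<lambda>_. ({}, False)) \<and> C = (\<lambda>_. ({}, False))"], goal_cases)
    case (1 i j r R C)
    then have "R i = ({}, False)" "C j = ({}, False)"
      by simp_all
    then show ?case
      using 1 by (simp add: seen_simps P_def fun_upd_idem del: of_nat_add of_nat_mult)
  next
    case (2 i r R C)
    then show ?case by (simp add: seen_simps)
  next
    case 3
    then show ?case by simp
  qed
  then show ?thesis
    unfolding P by (simp add: seen_simps)
qed

end

context search_run
begin

lemma accumulatesD:
  "accumulates c T M B \<Longrightarrow> \<exists>fl' ok'.
    runs c (rest_state (fl, ok, res) M) T (rest_state (fl', ok', res \<or> B) M)"
  unfolding accumulates_def by blast

lemma runs_search_all:
  assumes "set vs \<subseteq> Vs" "distinct vs" "a0 \<in> Vs"
  defines "E \<equiv> {(i, j). i < n \<and> j < n \<and> adj i j}"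
  shows "\<exists>fl ok. runs (search_all vs a0) (rest_state (False, False, False) (\<lambda>_. {}))
    (N * (16 * N + 11 + 6 * N + 9) + 6 * N + 10 +
      (nest_time (length vs) N ((N + 1) * (22 * N + 20) + 28 * N + 27) + 1))
    (rest_state (fl, ok, (\<forall>i < n. (i, i) \<notin> E) \<and>
      (\<exists>\<phi>. good_placement A (set vs) E {..<n} \<phi>)) (\<lambda>_. {}))"
proof -
  let ?B = "\<exists>i < n. adj i i"
  have diag: "accumulates (for_each a0 (sweep loop_step)) (N * (16 * N + 11 + 6 * N + 9) + 6 * N + 9)
      (\<lambda>_. {}) (\<exists>k < n. \<exists>i < n. \<exists>j < n. adj i j \<and> put a0 k (\<lambda>_. {}) i \<inter> put a0 k (\<lambda>_. {}) j \<noteq> {})"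
    by (rule accumulates_for_each, simp, simp, rule assms(3), rule accumulates_loop_sweep)
      (use assms(3) in \<open>simp add: put_def\<close>)
  \<comment> \<open>Row and column share the mark only for \<open>i = j = k\<close>.\<close>
  have "(\<exists>k < n. \<exists>i < n. \<exists>j < n. adj i j \<and> put a0 k (\<lambda>_. {}) i \<inter> put a0 k (\<lambda>_. {}) j \<noteq> {}) \<longleftrightarrow> ?B"
    by (auto simp: put_def)
  with diag have "accumulates (for_each a0 (sweep loop_step)) (N * (16 * N + 11 + 6 * N + 9) + 6 * N + 9)
      (\<lambda>_. {}) ?B"
    by simp
  from accumulatesD [OF this, of False False False] obtain fl ok where
    1: "runs (for_each a0 (sweep loop_step)) (rest_state (False, False, False) (\<lambda>_. {}))
      (N * (16 * N + 11 + 6 * N + 9) + 6 * N + 9) (rest_state (fl, ok, ?B) (\<lambda>_. {}))"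
    by auto
  have nest: "accumulates (nest vs test_placement)
      (nest_time (length vs) N ((N + 1) * (22 * N + 20) + 28 * N + 27)) (\<lambda>_. {})
      (\<exists>\<phi>. (\<forall>a \<in> set vs. \<phi> a < n) \<and> good (\<lambda>k. {} \<union> placed \<phi> (set vs) k))"
    by (rule accumulates_nest) (use assms accumulates_test_placement in auto)
  have "(\<forall>a \<in> set vs. \<phi> a < n) \<and> good (\<lambda>k. {} \<union> placed \<phi> (set vs) k) \<longleftrightarrow>
      good_placement A (set vs) E {..<n} \<phi>" for \<phi>
  proof (cases "\<forall>a \<in> set vs. \<phi> a < n")
    case True
    then show ?thesis
      using good_placed [OF True] by (simp add: E_def)
  next
    case False
    then show ?thesis
      by (auto simp: good_placement_def)
  qed
  with nest have nest: "accumulates (nest vs test_placement)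
      (nest_time (length vs) N ((N + 1) * (22 * N + 20) + 28 * N + 27)) (\<lambda>_. {})
      (\<exists>\<phi>. good_placement A (set vs) E {..<n} \<phi>)"
    by simp
  show ?thesis
  proof (cases ?B)
    case True
    have 2: "runs (set_reg (\<lambda>_. (False, False, False))) (rest_state (fl, ok, ?B) (\<lambda>_. {})) 1
        (rest_state (False, False, False) (\<lambda>_. {}))"
      by (rule runs_set_reg_state) simp
    have res: "((\<forall>i < n. (i, i) \<notin> E) \<and> (\<exists>\<phi>. good_placement A (set vs) E {..<n} \<phi>)) = False"
      using True by (auto simp: E_def)
    show ?thesis
      unfolding search_all_def res
      by (intro exI, rule runs_mono [OF runs_Seq [OF 1 runs_Cond_True [OF _ 2]]])
        (use True in \<open>auto simp: unreg_reg\<close>)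
  next
    case False
    obtain fl' ok' where 2: "runs (nest vs test_placement) (rest_state (fl, ok, ?B) (\<lambda>_. {}))
        (nest_time (length vs) N ((N + 1) * (22 * N + 20) + 28 * N + 27))
        (rest_state (fl', ok', ?B \<or> (\<exists>\<phi>. good_placement A (set vs) E {..<n} \<phi>)) (\<lambda>_. {}))"
      using accumulatesD [OF nest, of fl ok ?B] by blast
    have res: "((\<forall>i < n. (i, i) \<notin> E) \<and> (\<exists>\<phi>. good_placement A (set vs) E {..<n} \<phi>)) =
        (?B \<or> (\<exists>\<phi>. good_placement A (set vs) E {..<n} \<phi>))"
      using False by (auto simp: E_def)
    show ?thesis
      unfolding search_all_def res
      by (intro exI, rule runs_mono [OF runs_Seq [OF 1 runs_Cond_False [OF _ 2]]])
        (use False in \<open>auto simp: unreg_reg\<close>)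
  qed
qed

end

definition matrix_entry :: "bool list \<Rightarrow> nat \<Rightarrow> nat \<Rightarrow> nat \<Rightarrow> bool" where
  "matrix_entry w n i j \<longleftrightarrow> w ! (n + 1 + (i * n + j))"

definition accepted :: "'v rel \<Rightarrow> 'v set \<Rightarrow> bool list \<Rightarrow> bool" where
  "accepted A V w \<longleftrightarrow> (\<exists>n. length w = n + 1 + n * n \<and> (\<forall>i < n. w ! i) \<and> \<not> w ! n \<and>
     (\<forall>i < n. \<not> matrix_entry w n i i) \<and>
     (\<exists>\<phi>. good_placement A V {(i, j). i < n \<and> j < n \<and> matrix_entry w n i j} {..<n} \<phi>))"

lemma square_index_less:
  assumes "i < n" "j < n"
  shows "i * n + j < n * (n :: nat)"
proof -
  have "i * n + j < Suc i * n"
    using assms by simp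
  also have "\<dots> \<le> n * n"
    using assms by (intro mult_le_mono1) simp
  finally show ?thesis .
qed

text \<open>Division with remainder by \<open>n\<close>.\<close>

lemma ex_less_square_iff:
  "(\<exists>i < n. \<exists>j < n. P (i * n + j)) \<longleftrightarrow> (\<exists>q < n * n. P (q :: nat))"
proof
  assume "\<exists>i < n. \<exists>j < n. P (i * n + j)"
  then show "\<exists>q < n * n. P q"
    using square_index_less by blast
next
  assume "\<exists>q < n * n. P q"
  then obtain q where q: "q < n * n" "P q" by blast
  then have "q div n < n" "q mod n < n"
    by (auto simp: less_mult_imp_div_less intro!: mod_less_divisor gr0I)
  then show "\<exists>i < n. \<exists>j < n. P (i * n + j)"
    using q(2) by (metis div_mult_mod_eq)
qed

definition input_symbols :: "bool list \<Rightarrow> int \<Rightarrow> nat" where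
  "input_symbols w i = (if 0 \<le> i \<and> i < int (length w) then (if w ! nat i then 2 else 1) else 0)"

lemma input_symbols_nat:
  "input_symbols w (int i) = (if i < length w then (if w ! i then 2 else 1) else 0)"
  by (simp add: input_symbols_def)

lemma ones_prefix:
  obtains n where "n \<le> length w" "\<forall>i < n. w ! i" "n < length w \<longrightarrow> \<not> w ! n"
proof
  let ?n = "length (takeWhile (\<lambda>b. b) w)"
  show "?n \<le> length w"
    by (rule length_takeWhile_le)
  show "\<forall>i < ?n. w ! i"
    by (metis nth_mem set_takeWhileD takeWhile_nth)
  show "?n < length w \<longrightarrow> \<not> w ! ?n"
    using nth_length_takeWhile by blast
qed

context search
begin

definition decide_time :: "nat \<Rightarrow> nat \<Rightarrow> nat" where
  "decide_time k N = (N * (16 * N + 11 + 6 * N + 9) + 6 * N + 10 +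
      (nest_time k N ((N + 1) * (22 * N + 20) + 28 * N + 27) + 1)) + (N * (4 * N + 6) + 14 * N + 40)"

lemma poly_bounded_decide_time: "poly_bounded (decide_time k)"
proof -
  have *: "poly_bounded (\<lambda>N. nest_time k N ((N + 1) * (22 * N + 20) + 28 * N + 27))"
    by (rule poly_bounded_nest_time)
      (intro poly_bounded_add poly_bounded_mult poly_bounded_const poly_bounded_ident)
  show ?thesis
    unfolding decide_time_def [abs_def]
    by (intro poly_bounded_add poly_bounded_mult poly_bounded_const poly_bounded_ident *)
qed

lemma runs_decide:
  assumes "set vs \<subseteq> Vs" "distinct vs" "a0 \<in> Vs"
  shows "\<exists>ts. runs (decide vs a0) (input_tape w # replicate 3 ((\<lambda>_. 0), 0))
      (decide_time (length vs) (length w)) ts \<and>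
    (snd (snd (unreg (map read_tape ts ! 3))) \<longleftrightarrow> accepted A (set vs) w)"
proof -
  obtain n where n: "n \<le> length w" "\<forall>i < n. w ! i" "n < length w \<longrightarrow> \<not> w ! n"
    by (rule ones_prefix)
  \<comment> \<open>The format determines \<open>n\<close> as the length of the leading block of
    \<open>True\<close>, so a word that fails for this \<open>n\<close> fails for all.\<close>
  have n_unique: "k = n" if "length w = k + 1 + k * k" "\<forall>i < k. w ! i" "\<not> w ! k" for k
  proof (rule ccontr)
    assume "k \<noteq> n"
    then consider "k < n" | "n < k" by linarith
    then show False
      using n that by cases auto
  qed
  let ?inp = "input_symbols w" and ?r0 = "(False, False, False)"
  let ?R0 = "\<lambda>_ :: nat. ({} :: 'v set, False)"
  have inp: "\<forall>i < n. ?inp (int i) = 2" "?inp (int n) \<noteq> 2" "?inp (- 1) = 0"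
    using n by (auto simp: input_symbols_nat input_symbols_def [of w "- 1"])
  have tapes: "input_tape w # replicate 3 ((\<lambda>_. 0), 0) =
      [(?inp, 0), ((\<lambda>_. 0), 0), ((\<lambda>_. 0), 0), ((\<lambda>_. 0), 0)]"
    by (simp add: input_tape_def input_symbols_def [abs_def] numeral_3_eq_3)
  have 1: "runs (set_reg (\<lambda>_. ?r0)) (input_tape w # replicate 3 ((\<lambda>_. 0), 0)) 1
      (cfg ?inp 0 (int 0) (int 0) (int 0) ?r0 ?R0 ?R0)"
    unfolding tapes set_reg_def
    by (rule runs_Act) (auto simp: cfg_def arr_def fun_eq_iff)
  have 2: "runs fill (cfg ?inp 0 (int 0) (int 0) (int 0) ?r0 ?R0 ?R0) (2 * n + 1)
      (cfg ?inp n (int n) (int n) (int n) ?r0 ?R0 ?R0)"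
    by (rule runs_fill) (use inp in auto)
  note init = runs_Seq [OF 1 runs_Seq [OF 2 runs_Seq [OF runs_rewind_rows runs_Seq [OF runs_rewind_cols]]]]
  show ?thesis
  proof (cases "n < length w")
    case False
    then have "\<not> accepted A (set vs) w"
      using n n_unique by (auto simp: accepted_def)
    moreover have "?inp (int n) = 0"
      using False by (simp add: input_symbols_nat)
    then have "runs (Cond (\<lambda>xs. xs ! 0 = 0) (set_reg (\<lambda>_. ?r0)) d) (cfg ?inp n (int n) 0 0 ?r0 ?R0 ?R0)
        (Suc 1) (cfg ?inp n (int n) 0 0 ?r0 ?R0 ?R0)" for d
      by (intro runs_Cond_True runs_set_reg) simp
    from runs_mono [OF init [OF this], of "decide_time (length vs) (length w)"]
    have "runs (decide vs a0) (input_tape w # replicate 3 ((\<lambda>_. 0), 0))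
        (decide_time (length vs) (length w)) (cfg ?inp n (int n) 0 0 ?r0 ?R0 ?R0)"
      unfolding decide_def using n(1) by (simp add: decide_time_def)
    ultimately show ?thesis
      by (intro exI [of _ "cfg ?inp n (int n) 0 0 ?r0 ?R0 ?R0"]) (simp add: unreg_reg)
  next
    case True
    then have nonblank: "?inp (int n) \<noteq> 0"
      by (simp add: input_symbols_nat)
    let ?bad = "\<exists>i < n. \<exists>j < n. ?inp (int n + 1 + int (i * n + j)) = 0"
    have sum: "int n + 1 + int k = int (n + 1 + k)" for k
      by simp
    have "?bad \<longleftrightarrow> (\<exists>q < n * n. ?inp (int n + 1 + int q) = 0)"
      by (rule ex_less_square_iff)
    \<comment> \<open>If the word is too short, the first missing cell \<open>length w\<close> falls
      into the matrix, at index \<open>length w - (n + 1)\<close>.\<close>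
    also have "\<dots> \<longleftrightarrow> length w < n + 1 + n * n"
      unfolding sum input_symbols_nat using True
      by (auto intro!: exI [of _ "length w - (n + 1)"] split: if_splits)
    finally have bad: "?bad \<longleftrightarrow> length w < n + 1 + n * n" .
    have long: "?inp (int n + 1 + int (n * n)) \<noteq> 0 \<longleftrightarrow> n + 1 + n * n < length w"
      unfolding sum input_symbols_nat by simp
    have 3: "runs (move_tape 0 Move_Right) (cfg ?inp n (int n) 0 0 ?r0 ?R0 ?R0) 1
        (cfg ?inp n (int n + 1) 0 0 ?r0 ?R0 ?R0)"
      using runs_move_tape [of 0 "cfg ?inp n (int n) 0 0 ?r0 ?R0 ?R0" ?inp "int n" Move_Right] by simp
    have "n * (4 * n + 6) \<le> length w * (4 * length w + 6)"
      using n(1) by (intro mult_mono) auto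
    then have time: "n * (4 * n + 6) + 10 * n \<le> length w * (4 * length w + 6) + 10 * length w"
      using n(1) by linarith
    note check = runs_Seq [OF 3 runs_Seq [OF runs_short]]
    show ?thesis
    proof (cases "length w = n + 1 + n * n")
      case False
      then have "\<not> accepted A (set vs) w"
        using n_unique by (auto simp: accepted_def)
      let ?ts = "\<lambda>r. cfg ?inp n (int n + 1 + int (n * n)) 0 0 r ?R0 ?R0"
      have "snd (snd (False, False, ?bad)) \<or> ?inp (int n + 1 + int (n * n)) \<noteq> 0"
        using False unfolding bad long by auto
      then have 4: "runs (Cond (\<lambda>xs. snd (snd (unreg (xs ! 3))) \<or> xs ! 0 \<noteq> 0) (set_reg (\<lambda>_. ?r0)) d)
          (?ts (False, False, ?bad)) (Suc 1) (?ts ?r0)" for d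
        by (intro runs_Cond_True runs_set_reg) (simp add: unreg_reg)
      have "runs (decide vs a0) (input_tape w # replicate 3 ((\<lambda>_. 0), 0))
          (decide_time (length vs) (length w)) (?ts ?r0)"
        unfolding decide_def
        by (rule runs_mono [OF init [OF runs_Cond_False [OF _ check [OF 4]]]])
          (use nonblank time n(1) in \<open>simp_all add: decide_time_def\<close>)
      then show ?thesis
        using \<open>\<not> accepted A (set vs) w\<close> by (intro exI [of _ "?ts ?r0"]) (simp add: unreg_reg)
    next
      case eq: True
      interpret run: search_run lab unlab Vs reg unreg m A ?inp n "length w"
        by unfold_locales (use inp eq in \<open>auto simp: input_symbols_nat\<close>)
      let ?E = "{(i, j). i < n \<and> j < n \<and> run.adj i j}"
      let ?t = "length w * (16 * length w + 11 + 6 * length w + 9) + 6 * length w + 10 +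
        (nest_time (length vs) (length w) ((length w + 1) * (22 * length w + 20) + 28 * length w + 27) + 1)"
      have adj: "run.adj i j \<longleftrightarrow> matrix_entry w n i j" if "i < n" "j < n" for i j
        unfolding run.adj_def sum input_symbols_nat matrix_entry_def
        using square_index_less [OF that] eq by simp
      then have E: "?E = {(i, j). i < n \<and> j < n \<and> matrix_entry w n i j}"
        by auto
      obtain fl ok where 4: "runs (search_all vs a0) (run.rest_state ?r0 (\<lambda>_. {})) ?t
          (run.rest_state (fl, ok, (\<forall>i < n. (i, i) \<notin> ?E) \<and>
            (\<exists>\<phi>. good_placement A (set vs) ?E {..<n} \<phi>)) (\<lambda>_. {}))"
        using run.runs_search_all [OF assms] by blast
      have 5: "runs home (cfg ?inp n (int n + 1 + int (n * n)) 0 0 (False, False, ?bad) ?R0 ?R0)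
          (2 * (n + 1 + n * n) + 2 * n + 5) (cfg ?inp n (int n + 1) 0 0 (False, False, ?bad) ?R0 ?R0)"
        unfolding sum by (rule runs_home) (use inp eq in \<open>auto simp: input_symbols_nat\<close>)
      have "\<not> ?bad"
        using bad eq by simp
      then have bad_False: "?bad = False"
        by (simp only: simp_thms)
      note 6 = runs_Seq [OF 5 [unfolded bad_False] 4]
      have 7: "\<not> (snd (snd (False, False, False)) \<or> ?inp (int n + 1 + int (n * n)) \<noteq> 0)"
        using long eq by simp
      let ?ts = "run.rest_state (fl, ok, (\<forall>i < n. (i, i) \<notin> ?E) \<and>
            (\<exists>\<phi>. good_placement A (set vs) ?E {..<n} \<phi>)) (\<lambda>_. {})"
      have 8: "runs (Cond (\<lambda>xs. snd (snd (unreg (xs ! 3))) \<or> xs ! 0 \<noteq> 0) d (Seq home (search_all vs a0)))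
          (cfg ?inp n (int n + 1 + int (n * n)) 0 0 (False, False, False) ?R0 ?R0)
          (Suc (2 * (n + 1 + n * n) + 2 * n + 5 + ?t)) ?ts" for d
        by (rule runs_Cond_False [OF _ 6]) (use 7 in \<open>simp add: unreg_reg\<close>)
      have "runs (decide vs a0) (input_tape w # replicate 3 ((\<lambda>_. 0), 0))
          (decide_time (length vs) (length w)) ?ts"
        unfolding decide_def
        by (rule runs_mono [OF init [OF runs_Cond_False [OF _ check [unfolded bad_False, OF 8]]]])
          (use nonblank time eq in \<open>simp_all add: decide_time_def\<close>)
      moreover have "accepted A (set vs) w \<longleftrightarrow> (\<forall>i < n. (i, i) \<notin> ?E) \<and>
          (\<exists>\<phi>. good_placement A (set vs) ?E {..<n} \<phi>)"
      proof
        assume "accepted A (set vs) w"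
        then obtain k where "length w = k + 1 + k * k" "\<forall>i < k. w ! i" "\<not> w ! k"
          and *: "\<forall>i < k. \<not> matrix_entry w k i i"
            "\<exists>\<phi>. good_placement A (set vs) {(i, j). i < k \<and> j < k \<and> matrix_entry w k i j} {..<k} \<phi>"
          unfolding accepted_def by blast
        then have "k = n" by (intro n_unique)
        with * show "(\<forall>i < n. (i, i) \<notin> ?E) \<and> (\<exists>\<phi>. good_placement A (set vs) ?E {..<n} \<phi>)"
          unfolding E by simp
      next
        assume "(\<forall>i < n. (i, i) \<notin> ?E) \<and> (\<exists>\<phi>. good_placement A (set vs) ?E {..<n} \<phi>)"
        then show "accepted A (set vs) w"
          unfolding E accepted_def using eq n True by (intro exI [of _ n]) simp
      qed
      ultimately show ?thesis
        by (intro exI [of _ ?ts]) (simp add: unreg_reg)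
    qed
  qed
qed

end

text \<open>The type of marks may be infinite, so only labels with marks in \<open>V\<close> are
  encoded faithfully; all others get the code \<open>1\<close>. The shift by one reserves
  \<open>0\<close> for the blank.\<close>

lemma ex_label_code:
  assumes "finite V"
  obtains lab unlab reg unreg m
  where "label_code lab unlab (Pow V \<times> UNIV :: 'v label set) (reg :: registers \<Rightarrow> nat) unreg m"
    and "m \<ge> 3"
proof -
  let ?X = "Pow V \<times> UNIV :: 'v label set"
  have X: "finite ?X"
    using assms by simp
  obtain h where h: "bij_betw h ?X {0..<card ?X}"
    using ex_bij_betw_finite_nat [OF X] by blast
  obtain g where g: "bij_betw g (UNIV :: registers set) {0..<card (UNIV :: registers set)}"
    using ex_bij_betw_finite_nat [of "UNIV :: registers set"] by auto
  have h_less: "h x < card ?X" if "x \<in> ?X" for x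
    using h that by (auto simp: bij_betw_def)
  have g_less: "g r < card (UNIV :: registers set)" for r
    using g by (metis atLeastLessThan_iff bij_betwE iso_tuple_UNIV_I)
  have "label_code (\<lambda>x. if x \<in> ?X then h x + 1 else 1) (\<lambda>k. inv_into ?X h (k - 1)) ?X g (inv g)
      (card ?X + card (UNIV :: registers set) + 3)"
  proof
    fix x
    assume "x \<in> ?X"
    then show "inv_into ?X h ((if x \<in> ?X then h x + 1 else 1) - 1) = x"
      using h by (simp only: if_True) (simp add: bij_betw_def inv_into_f_f)
  next
    fix x
    show "(if x \<in> ?X then h x + 1 else 1) < card ?X + card (UNIV :: registers set) + 3"
      using h_less [of x] by auto
  next
    fix r
    show "g r < card ?X + card (UNIV :: registers set) + 3"
      using g_less [of r] by simp
    show "inv g (g r) = r"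
      using g by (simp add: bij_betw_def)
  qed simp
  then show thesis
    by (rule that) simp
qed

theorem polynomial_time_decidable_accepted:
  assumes "finite V"
  shows "polynomial_time_decidable {w. accepted A V w}"
proof -
  \<comment> \<open>\<open>V\<close> may be empty, but the diagonal test needs a mark; every type
    provides one.\<close>
  obtain a0 :: 'a where True by blast
  let ?V = "insert a0 V"
  obtain lab unlab reg unreg m
    where code: "label_code lab unlab (Pow ?V \<times> UNIV :: 'a label set) (reg :: registers \<Rightarrow> nat) unreg m"
      and m: "m \<ge> 3"
    by (rule ex_label_code [OF finite.insertI [OF assms, of a0]])
  interpret search lab unlab ?V reg unreg m A
    by (rule search.intro [OF code])
  obtain vs where vs: "set vs = V" "distinct vs"
    using finite_distinct_list [OF assms] by blast
  show ?thesis
  proof (rule polynomial_time_decidable_if_exec)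
    show "wf_prog 4 m (decide vs a0)"
      by (rule wf_decide)
    show "poly_bounded (decide_time (length vs))"
      by (rule poly_bounded_decide_time)
    fix w
    show "\<exists>t ts. t \<le> decide_time (length vs) (length w) \<and>
        exec (decide vs a0) (input_tape w # replicate (4 - 1) ((\<lambda>_. 0), 0)) t ts \<and>
        snd (snd (unreg (map read_tape ts ! 3))) = (w \<in> {w. accepted A V w})"
      using runs_decide [of vs a0 w] vs unfolding runs_def by auto
  qed (use m in auto)
qed

section \<open>Subdivisions of spiders\<close>

text \<open>A subdivision is determined by the branch vertices \<open>f\<close> and the paths \<open>P\<close>.\<close>

definition subdivision_arcs :: "('v \<times> 'v \<Rightarrow> 'w list) \<Rightarrow> 'v rel \<Rightarrow> 'w rel" where
  "subdivision_arcs P A = (\<Union>e \<in> A. set (vwalk_arcs (P e)))"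

definition subdivision_verts :: "('v \<Rightarrow> 'w) \<Rightarrow> ('v \<times> 'v \<Rightarrow> 'w list) \<Rightarrow> 'v set \<Rightarrow> 'v rel \<Rightarrow> 'w set" where
  "subdivision_verts f P V A = f ` V \<union> (\<Union>e \<in> A. set (P e))"

definition subdivides :: "('v \<Rightarrow> 'w) \<Rightarrow> ('v \<times> 'v \<Rightarrow> 'w list) \<Rightarrow> 'v set \<Rightarrow> 'v rel \<Rightarrow> bool" where
  "subdivides f P V A \<longleftrightarrow>
     inj_on f V \<and>
     (\<forall>a b. (a, b) \<in> A \<longrightarrow> distinct (P (a, b)) \<and> 2 \<le> length (P (a, b)) \<and>
        hd (P (a, b)) = f a \<and> last (P (a, b)) = f b) \<and>
     (\<forall>e \<in> A. inner_vertices (P e) \<inter> f ` V = {}) \<and>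
     (\<forall>e \<in> A. \<forall>e' \<in> A. e \<noteq> e' \<longrightarrow> inner_vertices (P e) \<inter> inner_vertices (P e') = {})"

text \<open>\<open>H\<close> consists of the branch vertices and the paths, so each path is
  automatically a walk in \<open>H\<close>; of \<open>vpath\<close> only distinctness
  remains.\<close>

lemma is_subdivision_of_iff:
  "is_subdivision_of H D \<longleftrightarrow> (\<exists>f P. subdivides f P (pverts D) (parcs D) \<and>
     pverts H = subdivision_verts f P (pverts D) (parcs D) \<and> parcs H = subdivision_arcs P (parcs D))"
proof -
  have key: "(\<forall>(a, b) \<in> parcs D. vpath (P (a, b)) (with_proj H) \<and> vwalk_length (P (a, b)) \<ge> 1 \<and>
         hd (P (a, b)) = f a \<and> last (P (a, b)) = f b) \<longleftrightarrow>
      (\<forall>a b. (a, b) \<in> parcs D \<longrightarrow> distinct (P (a, b)) \<and> 2 \<le> length (P (a, b)) \<and>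
         hd (P (a, b)) = f a \<and> last (P (a, b)) = f b)"
    if "pverts H = subdivision_verts f P (pverts D) (parcs D)"
      and "parcs H = subdivision_arcs P (parcs D)" for f P
  proof -
    have "vpath (P e) (with_proj H) \<and> vwalk_length (P e) \<ge> 1 \<longleftrightarrow> distinct (P e) \<and> 2 \<le> length (P e)"
      if "e \<in> parcs D" for e
      using that \<open>pverts H = _\<close> \<open>parcs H = _\<close>
      by (auto simp: vpath_def vwalk_def subdivision_verts_def subdivision_arcs_def)
    then show ?thesis
      by (auto split: prod.splits)
  qed
  show ?thesis
    unfolding is_subdivision_of_def subdivides_def subdivision_verts_def [symmetric]
      subdivision_arcs_def [symmetric]
  proof (intro ex_cong1, goal_cases)
    case (1 f P)
    show ?case
      using key [of f P] by argo
  qed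
qed

lemma induced_subgraph_iff:
  assumes "pair_digraph G"
  shows "induced_subgraph (with_proj H) (with_proj G) \<longleftrightarrow>
    pverts H \<subseteq> pverts G \<and> parcs H = parcs G \<inter> pverts H \<times> pverts H"
proof -
  interpret G: pair_digraph G by (rule assms)
  have "wf_digraph (with_proj H)" if "parcs H = parcs G \<inter> pverts H \<times> pverts H"
    using that by (auto simp: wf_digraph_def)
  moreover have "wf_digraph (with_proj G)"
    by (rule G.wf_digraph_axioms)
  ultimately show ?thesis
    by (auto simp: induced_subgraph_def subgraph_def compatible_def)
qed

definition induced_in :: "'w set \<Rightarrow> 'w rel \<Rightarrow> 'w set \<Rightarrow> 'w rel \<Rightarrow> bool" where
  "induced_in X F Y E \<longleftrightarrow> X \<subseteq> Y \<and> F = E \<inter> X \<times> X"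

lemma contains_induced_subdivision_iff:
  assumes "pair_digraph G"
  shows "contains_induced_subdivision G D \<longleftrightarrow> (\<exists>f P. subdivides f P (pverts D) (parcs D) \<and>
    induced_in (subdivision_verts f P (pverts D) (parcs D)) (subdivision_arcs P (parcs D))
      (pverts G) (parcs G))"
  (is "?l \<longleftrightarrow> ?r")
proof
  assume ?l
  then show ?r
    unfolding contains_induced_subdivision_def is_subdivision_of_iff induced_subgraph_iff [OF assms]
      induced_in_def
    by metis
next
  assume ?r
  then obtain f P where *: "subdivides f P (pverts D) (parcs D)"
      "induced_in (subdivision_verts f P (pverts D) (parcs D)) (subdivision_arcs P (parcs D))
        (pverts G) (parcs G)"
    by blast
  let ?H = "\<lparr>pverts = subdivision_verts f P (pverts D) (parcs D),
    parcs = subdivision_arcs P (parcs D)\<rparr>"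
  have "is_subdivision_of ?H D"
    unfolding is_subdivision_of_iff using *(1) by auto
  moreover have "induced_subgraph (with_proj ?H) (with_proj G)"
    unfolding induced_subgraph_iff [OF assms] using *(2) by (simp add: induced_in_def)
  ultimately show ?l
    unfolding contains_induced_subdivision_def by blast
qed

section \<open>Paths, their inner vertices, and reversal of arcs\<close>

lemma vwalk_arcs_append:
  "p \<noteq> [] \<Longrightarrow> q \<noteq> [] \<Longrightarrow> vwalk_arcs (p @ q) = vwalk_arcs p @ (last p, hd q) # vwalk_arcs q"
proof (induction p rule: vwalk_arcs.induct)
  case (2 x)
  then show ?case by (cases q) auto
qed auto

lemma set_vwalk_arcs_rev: "set (vwalk_arcs (rev p)) = (set (vwalk_arcs p))\<inverse>"
proof (induction p rule: vwalk_arcs.induct)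
  case (3 x y p)
  have "vwalk_arcs (rev (x # y # p)) = vwalk_arcs (rev (y # p)) @ [(y, x)]"
    using vwalk_arcs_append [of "rev (y # p)" "[x]"] by simp
  then show ?case
    using 3 by auto
qed auto

lemma inner_vertices_rev: "inner_vertices (rev p) = inner_vertices p"
  unfolding inner_vertices_def
  by (cases p; cases "tl p" rule: rev_cases) (auto simp: butlast_append)

lemma set_eq_inner_vertices:
  assumes "2 \<le> length p"
  shows "set p = {hd p, last p} \<union> inner_vertices p"
proof -
  obtain x q where "p = x # q"
    using assms by (cases p) auto
  moreover from this have "q \<noteq> []"
    using assms by auto
  ultimately show ?thesis
    by (cases q rule: rev_cases) (auto simp: inner_vertices_def)
qed

lemma vwalk_arcs_subset: "set (vwalk_arcs p) \<subseteq> set p \<times> set p"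
  by (induction p rule: vwalk_arcs.induct) auto

lemma subdividesD:
  assumes "subdivides f P V A"
  shows "inj_on f V"
    and "(a, b) \<in> A \<Longrightarrow> distinct (P (a, b))" "(a, b) \<in> A \<Longrightarrow> 2 \<le> length (P (a, b))"
    and "(a, b) \<in> A \<Longrightarrow> hd (P (a, b)) = f a" "(a, b) \<in> A \<Longrightarrow> last (P (a, b)) = f b"
    and "e \<in> A \<Longrightarrow> inner_vertices (P e) \<inter> f ` V = {}"
    and "e \<in> A \<Longrightarrow> e' \<in> A \<Longrightarrow> e \<noteq> e' \<Longrightarrow> inner_vertices (P e) \<inter> inner_vertices (P e') = {}"
  using assms unfolding subdivides_def by simp_all

text \<open>Reversal turns sources into sinks, so that legs have to be shortened in one direction
  only.\<close>

lemma subdivides_reverse: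
  assumes "subdivides f P V A"
  shows "subdivides f (\<lambda>(a, b). rev (P (b, a))) V (A\<inverse>)"
    and "subdivision_verts f (\<lambda>(a, b). rev (P (b, a))) V (A\<inverse>) = subdivision_verts f P V A"
    and "subdivision_arcs (\<lambda>(a, b). rev (P (b, a))) (A\<inverse>) = (subdivision_arcs P A)\<inverse>"
proof -
  show "subdivides f (\<lambda>(a, b). rev (P (b, a))) V (A\<inverse>)"
    unfolding subdivides_def
  proof (intro conjI)
    show "inj_on f V"
      using assms by (simp add: subdivides_def)
    show "\<forall>a b. (a, b) \<in> A\<inverse> \<longrightarrow> distinct ((\<lambda>(a, b). rev (P (b, a))) (a, b)) \<and>
        2 \<le> length ((\<lambda>(a, b). rev (P (b, a))) (a, b)) \<and>
        hd ((\<lambda>(a, b). rev (P (b, a))) (a, b)) = f a \<and> last ((\<lambda>(a, b). rev (P (b, a))) (a, b)) = f b"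
      using assms by (simp add: subdivides_def hd_rev last_rev)
    show "\<forall>e \<in> A\<inverse>. inner_vertices ((\<lambda>(a, b). rev (P (b, a))) e) \<inter> f ` V = {}"
    proof
      fix e
      assume e: "e \<in> A\<inverse>"
      obtain a b where ab: "e = (a, b)"
        by fastforce
      then have "(b, a) \<in> A"
        using e by simp
      then have "inner_vertices (P (b, a)) \<inter> f ` V = {}"
        by (rule subdividesD(6) [OF assms])
      then show "inner_vertices ((\<lambda>(a, b). rev (P (b, a))) e) \<inter> f ` V = {}"
        by (simp add: ab inner_vertices_rev)
    qed
    show "\<forall>e \<in> A\<inverse>. \<forall>e' \<in> A\<inverse>. e \<noteq> e' \<longrightarrow> inner_vertices ((\<lambda>(a, b). rev (P (b, a))) e) \<inter>
        inner_vertices ((\<lambda>(a, b). rev (P (b, a))) e') = {}"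
    proof (intro ballI impI)
      fix e e'
      assume e: "e \<in> A\<inverse>" "e' \<in> A\<inverse>" "e \<noteq> e'"
      obtain a b a' b' where ab: "e = (a, b)" "e' = (a', b')"
        by fastforce
      then have "(b, a) \<in> A" "(b', a') \<in> A" "(b, a) \<noteq> (b', a')"
        using e by auto
      then have "inner_vertices (P (b, a)) \<inter> inner_vertices (P (b', a')) = {}"
        by (rule subdividesD(7) [OF assms])
      then show "inner_vertices ((\<lambda>(a, b). rev (P (b, a))) e) \<inter>
          inner_vertices ((\<lambda>(a, b). rev (P (b, a))) e') = {}"
        by (simp add: ab inner_vertices_rev)
    qed
  qed
  show "subdivision_verts f (\<lambda>(a, b). rev (P (b, a))) V (A\<inverse>) = subdivision_verts f P V A"
    by (auto simp: subdivision_verts_def)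
  show "subdivision_arcs (\<lambda>(a, b). rev (P (b, a))) (A\<inverse>) = (subdivision_arcs P A)\<inverse>"
    by (auto simp: subdivision_arcs_def set_vwalk_arcs_rev)
qed

lemma subdivides_set_path:
  assumes "subdivides f P V A" "(a, b) \<in> A"
  shows "set (P (a, b)) = {f a, f b} \<union> inner_vertices (P (a, b))"
  using set_eq_inner_vertices [of "P (a, b)"] subdividesD [OF assms(1)] assms(2) by metis

lemma disjoint_mono: "X \<inter> Y = {} \<Longrightarrow> X' \<subseteq> X \<Longrightarrow> Y' \<subseteq> Y \<Longrightarrow> X' \<inter> Y' = {}"
  by blast

lemma long_path_split:
  assumes "3 \<le> length p"
  obtains q y z where "p = q @ [y, z]" "q \<noteq> []"
proof -
  obtain p' z where p': "p = p' @ [z]"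
    using assms by (cases p rule: rev_cases) auto
  moreover obtain q y where "p' = q @ [y]"
    using assms p' by (cases p' rule: rev_cases) auto
  ultimately show thesis
    using assms by (intro that [of q y z]) auto
qed

lemma inner_vertices_snoc2:
  "q \<noteq> [] \<Longrightarrow> inner_vertices (q @ [y, z]) = insert y (set (tl q))"
  "q \<noteq> [] \<Longrightarrow> inner_vertices (q @ [y]) = set (tl q)"
  by (cases q; simp add: inner_vertices_def butlast_append)+

text \<open>
  If the path replacing the only arc into \<open>b\<close> is long, then the branch vertex of \<open>b\<close> can be moved
  backwards along it: if \<open>b\<close> has a unique out-arc then that arc gets the spare vertex, and if \<open>b\<close>
  is a sink then the old branch vertex is dropped.
\<close>

lemma subdivides_shift:
  assumes sub: "subdivides f P V A" and A: "A \<subseteq> V \<times> V" "(a, b) \<in> A" "(b, c) \<in> A" "a \<noteq> b" "b \<noteq> c"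
    and unique_in: "\<And>x. (x, b) \<in> A \<Longrightarrow> x = a" and unique_out: "\<And>x. (b, x) \<in> A \<Longrightarrow> x = c"
    and long: "3 \<le> length (P (a, b))"
  obtains f' P' where "subdivides f' P' V A" "subdivision_verts f' P' V A = subdivision_verts f P V A"
    "subdivision_arcs P' A = subdivision_arcs P A" "3 \<le> length (P' (b, c))"
proof -
  note subD = subdividesD [OF sub]
  obtain q y z where q: "P (a, b) = q @ [y, z]" "q \<noteq> []"
    using long long_path_split by metis
  have z: "z = f b"
    using subD(5) [OF A(2)] q by simp
  obtain r where r1: "P (b, c) = f b # r"
    using subD(3,4) [OF A(3)] by (cases "P (b, c)") auto
  then have r: "P (b, c) = f b # r" "r \<noteq> []"
    using subD(3) [OF A(3)] by auto
  have inner_ab: "inner_vertices (P (a, b)) = insert y (set (tl q))"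
    using q inner_vertices_snoc2 by simp
  have y: "y \<notin> f ` V"
    using subD(6) [OF A(2)] inner_ab by auto
  have y_other: "y \<notin> inner_vertices (P e)" if "e \<in> A" "e \<noteq> (a, b)" for e
    using subD(7) [OF A(2) that(1)] that(2) inner_ab by auto
  have inV: "a \<in> V" "b \<in> V" "c \<in> V"
    using A by auto
  have distinct_ab: "distinct (q @ [y, f b])"
    using subD(2) [OF A(2)] q z by simp
  have set_bc: "set (P (b, c)) = {f b, f c} \<union> inner_vertices (P (b, c))"
    by (rule subdivides_set_path [OF sub A(3)])
  have y_bc: "y \<notin> set (P (b, c))"
    unfolding set_bc using y inV y_other [OF A(3)] A(4) by auto
  \<comment> \<open>\<open>y\<close>, the last inner vertex before \<open>f b\<close>, becomes the
    image of \<open>b\<close>, and \<open>f b\<close> becomes the first inner vertex of the path to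
    \<open>c\<close>.\<close>
  let ?f = "f(b := y)" and ?P = "P((a, b) := q @ [y], (b, c) := y # f b # r)"
  have P_ab: "?P (a, b) = q @ [y]" and P_bc: "?P (b, c) = y # f b # r"
    using A by auto
  have P_other: "?P e = P e" if "e \<noteq> (a, b)" "e \<noteq> (b, c)" for e
    using that by simp
  have inner'_ab: "inner_vertices (?P (a, b)) = set (tl q)"
    unfolding P_ab by (rule inner_vertices_snoc2(2) [OF q(2)])
  have inner'_bc: "inner_vertices (?P (b, c)) = insert (f b) (inner_vertices (P (b, c)))"
    unfolding P_bc r(1) using r(2) by (simp add: inner_vertices_def)
  have y_tl: "y \<notin> set (tl q)"
    using distinct_ab q(2) by (cases q) auto
  have f'V: "?f ` V \<subseteq> insert y (f ` V - {f b})"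
    using inV subD(1) by (auto dest: inj_onD)
  have fb: "f b \<noteq> y"
    using y inV by blast
  have "subdivides ?f ?P V A"
    unfolding subdivides_def
  proof (intro conjI allI impI ballI)
    show "inj_on ?f V"
      using subD(1) y by (auto simp: inj_on_def)
  next
    fix u v
    assume uv: "(u, v) \<in> A"
    consider "(u, v) = (a, b)" | "(u, v) = (b, c)" | "u \<noteq> b" "v \<noteq> b" "(u, v) \<noteq> (a, b)" "(u, v) \<noteq> (b, c)"
      using unique_in unique_out uv by blast
    note cases = this
    show "distinct (?P (u, v))"
      using cases
    proof cases
      case 1
      then show ?thesis using P_ab distinct_ab by simp
    next
      case 2
      then show ?thesis using P_bc y_bc subD(2) [OF A(3)] r by simp
    next
      case 3
      then show ?thesis using P_other subD(2) [OF uv] by simp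
    qed
    show "2 \<le> length (?P (u, v))"
      using cases
    proof cases
      case 1
      then show ?thesis using P_ab q(2) by (cases q) auto
    next
      case 2
      then show ?thesis using P_bc by simp
    next
      case 3
      then show ?thesis using P_other subD(3) [OF uv] by simp
    qed
    show "hd (?P (u, v)) = ?f u"
      using cases
    proof cases
      case 1
      then show ?thesis using P_ab q A(4) subD(4) [OF A(2)] by simp
    next
      case 2
      then show ?thesis using P_bc by simp
    next
      case 3
      then show ?thesis using P_other subD(4) [OF uv] by simp
    qed
    show "last (?P (u, v)) = ?f v"
      using cases
    proof cases
      case 1
      then show ?thesis using P_ab by simp
    next
      case 2
      then show ?thesis using P_bc r A(5) subD(5) [OF A(3)] by simp
    next
      case 3
      then show ?thesis using P_other subD(5) [OF uv] by simp
    qed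
  next
    fix e
    assume e: "e \<in> A"
    have "inner_vertices (?P e) \<inter> insert y (f ` V - {f b}) = {}"
    proof (cases "e = (a, b) \<or> e = (b, c)")
      case True
      then show ?thesis
        using inner'_ab inner'_bc y_tl subD(6) [OF A(2)] subD(6) [OF A(3)] inner_ab fb
          y_other [OF A(3)] A(4) by auto
    next
      case False
      then show ?thesis
        using P_other subD(6) [OF e] y_other [OF e] by auto
    qed
    then show "inner_vertices (?P e) \<inter> ?f ` V = {}"
      using f'V by blast
  next
    fix e e'
    assume e: "e \<in> A" "e' \<in> A" "e \<noteq> e'"
    \<comment> \<open>Only the path of \<open>(b, c)\<close> gains an inner vertex, namely
      \<open>f b\<close>, which as a branch vertex was inner to no path before.\<close>
    have sub': "inner_vertices (?P e) \<subseteq> inner_vertices (P e) \<union> (if e = (b, c) then {f b} else {})" for e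
      using inner'_ab inner_ab inner'_bc P_other [of e] by (cases "e = (a, b)"; cases "e = (b, c)") auto
    have "f b \<notin> inner_vertices (P e)" if "e \<in> A" for e
      using subD(6) [OF that] inV by blast
    then have "(inner_vertices (P e) \<union> (if e = (b, c) then {f b} else {})) \<inter>
        (inner_vertices (P e') \<union> (if e' = (b, c) then {f b} else {})) = {}"
      using subD(7) [OF e] e by (cases "e = (b, c)"; cases "e' = (b, c)") auto
    then show "inner_vertices (?P e) \<inter> inner_vertices (?P e') = {}"
      by (rule disjoint_mono [OF _ sub' sub'])
  qed
  moreover have "subdivision_verts ?f ?P V A = subdivision_verts f P V A"
  proof -
    define B where "B = A - {(a, b), (b, c)}"
    have A_eq: "A = insert (a, b) (insert (b, c) B)"
      using A by (auto simp: B_def)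
    have "(\<Union>e \<in> B. set (?P e)) = (\<Union>e \<in> B. set (P e))"
      by (intro SUP_cong refl arg_cong [of _ _ set] P_other) (auto simp: B_def)
    then have "(\<Union>e \<in> A. set (?P e)) = (\<Union>e \<in> A. set (P e))"
      unfolding A_eq using P_ab P_bc q(1) r(1) z by auto
    moreover have "?f ` V \<union> (\<Union>e \<in> A. set (P e)) = f ` V \<union> (\<Union>e \<in> A. set (P e))"
    proof -
      have "insert y (insert (f b) (f ` (V - {b}))) = insert y (?f ` V \<union> {f b})"
        using inV by auto
      moreover have "f ` V = insert (f b) (f ` (V - {b}))"
        using inV by blast
      moreover have "{y, f b} \<subseteq> (\<Union>e \<in> A. set (P e))"
        using A(2) q(1) z by (auto intro!: bexI [of _ "(a, b)"])
      ultimately show ?thesis by blast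
    qed
    ultimately show ?thesis
      by (simp add: subdivision_verts_def)
  qed
  moreover have "subdivision_arcs ?P A = subdivision_arcs P A"
  proof -
    define B where "B = A - {(a, b), (b, c)}"
    have A_eq: "A = insert (a, b) (insert (b, c) B)"
      using A by (auto simp: B_def)
    have "(\<Union>e \<in> B. set (vwalk_arcs (?P e))) = (\<Union>e \<in> B. set (vwalk_arcs (P e)))"
      by (intro SUP_cong refl arg_cong [of _ _ set] arg_cong [of _ _ vwalk_arcs] P_other)
        (auto simp: B_def)
    moreover have "set (vwalk_arcs (?P (a, b))) \<union> set (vwalk_arcs (?P (b, c))) =
        set (vwalk_arcs (P (a, b))) \<union> set (vwalk_arcs (P (b, c)))"
      unfolding P_ab P_bc q(1) r(1) using q(2) r(2) by (auto simp: vwalk_arcs_append z)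
    ultimately show ?thesis
      unfolding subdivision_arcs_def A_eq by auto
  qed
  moreover have "3 \<le> length (?P (b, c))"
    using P_bc r(2) by (cases r) auto
  ultimately show thesis
    by (rule that)
qed

text \<open>As \<open>b\<close> is a sink with a single in-arc, no other path meets
  \<open>f b\<close>, and removing it loses only the last arc of the path into it. The rest is
  therefore still induced in the old subdivision, with one vertex less.\<close>

lemma subdivides_trim:
  assumes sub: "subdivides f P V A" and A: "A \<subseteq> V \<times> V" "(a, b) \<in> A" "a \<noteq> b"
    and unique_in: "\<And>x. (x, b) \<in> A \<Longrightarrow> x = a" and sink: "\<And>x. (b, x) \<notin> A"
    and long: "3 \<le> length (P (a, b))"
  obtains f' P' where "subdivides f' P' V A"
    "subdivision_verts f' P' V A = subdivision_verts f P V A - {f b}"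
    "subdivision_arcs P' A =
      subdivision_arcs P A \<inter> subdivision_verts f' P' V A \<times> subdivision_verts f' P' V A"
proof -
  note subD = subdividesD [OF sub]
  obtain q y z where q: "P (a, b) = q @ [y, z]" "q \<noteq> []"
    using long long_path_split by metis
  have z: "z = f b"
    using subD(5) [OF A(2)] q by simp
  have inner_ab: "inner_vertices (P (a, b)) = insert y (set (tl q))"
    using q inner_vertices_snoc2 by simp
  have y: "y \<notin> f ` V"
    using subD(6) [OF A(2)] inner_ab by auto
  have y_other: "y \<notin> inner_vertices (P e)" if "e \<in> A" "e \<noteq> (a, b)" for e
    using subD(7) [OF A(2) that(1)] that(2) inner_ab by auto
  have inV: "a \<in> V" "b \<in> V"
    using A by auto
  have distinct_ab: "distinct (q @ [y, f b])"
    using subD(2) [OF A(2)] q z by simp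
  let ?f = "f(b := y)" and ?P = "P((a, b) := q @ [y])"
  have inner'_ab: "inner_vertices (?P (a, b)) = set (tl q)"
    using inner_vertices_snoc2(2) [OF q(2)] by simp
  have y_tl: "y \<notin> set (tl q)"
    using distinct_ab q(2) by (cases q) auto
  have f'V: "?f ` V = insert y (f ` V - {f b})"
    using inV subD(1) by (auto dest: inj_onD)
  have fb: "f b \<noteq> y"
    using y inV by blast
  have sub': "subdivides ?f ?P V A"
    unfolding subdivides_def
  proof (intro conjI allI impI ballI)
    show "inj_on ?f V"
      using subD(1) y by (auto simp: inj_on_def)
  next
    fix u v
    assume uv: "(u, v) \<in> A"
    then have u: "u \<noteq> b" and v: "v = b \<Longrightarrow> u = a"
      using sink unique_in by auto
    show "distinct (?P (u, v))"
      using subD(2) [OF uv] distinct_ab by auto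
    show "2 \<le> length (?P (u, v))"
      using subD(3) [OF uv] q(2) by (cases q) auto
    show "hd (?P (u, v)) = ?f u"
      using subD(4) [OF uv] u q by auto
    show "last (?P (u, v)) = ?f v"
      using subD(5) [OF uv] v by auto
  next
    fix e
    assume e: "e \<in> A"
    show "inner_vertices (?P e) \<inter> ?f ` V = {}"
      unfolding f'V using inner'_ab y_tl subD(6) [OF A(2)] inner_ab subD(6) [OF e] y_other [OF e]
      by (cases "e = (a, b)") auto
  next
    fix e e'
    assume e: "e \<in> A" "e' \<in> A" "e \<noteq> e'"
    have "inner_vertices (?P e) \<subseteq> inner_vertices (P e)" for e
      using inner'_ab inner_ab by (cases "e = (a, b)") auto
    then show "inner_vertices (?P e) \<inter> inner_vertices (?P e') = {}"
      using subD(7) [OF e] by blast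
  qed
  define B where "B = A - {(a, b)}"
  have A_eq: "A = insert (a, b) B"
    using A by (auto simp: B_def)
  have P_B: "?P e = P e" if "e \<in> B" for e
    using that by (auto simp: B_def)
  have fb_B: "f b \<notin> set (P e)" if "e \<in> B" for e
  proof -
    obtain u v where e: "e = (u, v)" by (cases e)
    then have "(u, v) \<in> A" "u \<noteq> b" "v \<noteq> b"
      using that sink unique_in by (auto simp: B_def)
    moreover from this have "f u \<noteq> f b" "f v \<noteq> f b"
      using subD(1) A(1) inV by (auto dest: inj_onD)
    moreover have "f b \<notin> inner_vertices (P e)"
      using subD(6) [of e] that inV by (auto simp: B_def)
    ultimately show ?thesis
      using subdivides_set_path [OF sub] e by auto
  qed
  have SB: "(\<Union>e \<in> B. set (?P e)) = (\<Union>e \<in> B. set (P e))"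
    using P_B by simp
  have verts: "subdivision_verts ?f ?P V A = subdivision_verts f P V A - {f b}"
  proof -
    have "subdivision_verts ?f ?P V A = insert y (f ` V - {f b}) \<union> set (q @ [y]) \<union> (\<Union>e \<in> B. set (P e))"
      unfolding subdivision_verts_def f'V A_eq using SB by auto
    moreover have "subdivision_verts f P V A = f ` V \<union> set (q @ [y, f b]) \<union> (\<Union>e \<in> B. set (P e))"
      unfolding subdivision_verts_def A_eq using q(1) z by auto
    moreover have "f b \<notin> (\<Union>e \<in> B. set (P e))" "f b \<notin> set (q @ [y])"
      using fb_B distinct_ab by auto
    ultimately show ?thesis by auto
  qed
  moreover have "subdivision_arcs ?P A =
      subdivision_arcs P A \<inter> subdivision_verts ?f ?P V A \<times> subdivision_verts ?f ?P V A"
  proof -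
    have 1: "subdivision_arcs P A = insert (y, f b) (subdivision_arcs ?P A)"
    proof -
      have "(\<Union>e \<in> B. set (vwalk_arcs (?P e))) = (\<Union>e \<in> B. set (vwalk_arcs (P e)))"
        using P_B by simp
      moreover have "set (vwalk_arcs (P (a, b))) = insert (y, f b) (set (vwalk_arcs (?P (a, b))))"
        using q z by (auto simp: vwalk_arcs_append)
      ultimately show ?thesis
        unfolding subdivision_arcs_def A_eq by auto
    qed
    moreover have "subdivision_arcs ?P A \<subseteq> subdivision_verts ?f ?P V A \<times> subdivision_verts ?f ?P V A"
      unfolding subdivision_arcs_def subdivision_verts_def using vwalk_arcs_subset by fastforce
    moreover have "f b \<notin> subdivision_verts ?f ?P V A"
      using verts by simp
    ultimately show ?thesis by auto
  qed
  ultimately show thesis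
    using sub' that by blast
qed

text \<open>Nodes in terms of the arc relation alone, in a form visibly invariant under
  reversal.\<close>

definition is_branching :: "'v rel \<Rightarrow> 'v \<Rightarrow> bool" where
  "is_branching A v \<longleftrightarrow> (\<exists>x y. x \<noteq> y \<and> ((x, v) \<in> A \<and> (y, v) \<in> A \<or> (v, x) \<in> A \<and> (v, y) \<in> A))"

lemma is_branching_converse: "is_branching (A\<inverse>) v \<longleftrightarrow> is_branching A v"
  by (auto simp: is_branching_def)

definition induced_subdivision ::
    "('v \<Rightarrow> 'w) \<Rightarrow> ('v \<times> 'v \<Rightarrow> 'w list) \<Rightarrow> 'v set \<Rightarrow> 'v rel \<Rightarrow> 'w set \<Rightarrow> 'w rel \<Rightarrow> bool" where
  "induced_subdivision f P V A Y E \<longleftrightarrow> subdivides f P V A \<and>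
     induced_in (subdivision_verts f P V A) (subdivision_arcs P A) Y E"

lemma induced_subdivision_reverse:
  "induced_subdivision f P V A Y E \<Longrightarrow>
    induced_subdivision f (\<lambda>(a, b). rev (P (b, a))) V (A\<inverse>) Y (E\<inverse>)"
  using subdivides_reverse [of f P V A] unfolding induced_subdivision_def induced_in_def by auto

text \<open>Nothing reachable from \<open>b\<close> branches, so beyond \<open>b\<close> there is a
  single directed path. A long path into \<open>b\<close> is shifted into a long path out of
  \<open>b\<close>, against the induction hypothesis, or, if \<open>b\<close> is a sink, trimmed,
  against minimality. Shifting changes the subdivision, so \<open>f\<close> and \<open>P\<close>
  vary in the induction.\<close>

lemma short_path_forward:
  assumes A: "A \<subseteq> V \<times> V" "\<And>x. (x, x) \<notin> A"
    and U: "\<And>x y. (x, y) \<in> A \<Longrightarrow> x \<in> U \<Longrightarrow> y \<in> U"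
    and wf: "wf ((A \<inter> U \<times> U)\<inverse>)" and Y: "finite Y"
    and minimal: "\<And>f P. induced_subdivision f P V A Y E \<Longrightarrow> k \<le> card (subdivision_verts f P V A)"
    and b: "b \<in> U" "\<And>v. (b, v) \<in> A\<^sup>* \<Longrightarrow> \<not> is_branching A v"
    and f: "induced_subdivision f P V A Y E" "card (subdivision_verts f P V A) = k"
    and ab: "(a, b) \<in> A"
  shows "length (P (a, b)) = 2"
  using wf b f ab
proof (induction b arbitrary: a f P rule: wf_induct_rule)
  case (less b)
  then have sub: "subdivides f P V A"
    by (simp add: induced_subdivision_def)
  have "\<not> is_branching A b"
    using less.prems by blast
  then have unique: "\<And>x. (x, b) \<in> A \<Longrightarrow> x = a" "\<And>x y. (b, x) \<in> A \<Longrightarrow> (b, y) \<in> A \<Longrightarrow> x = y"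
    using less.prems(5) by (auto simp: is_branching_def)
  show ?case
  proof (rule ccontr)
    assume "length (P (a, b)) \<noteq> 2"
    then have long: "3 \<le> length (P (a, b))"
      using subdividesD(3) [OF sub less.prems(5)] by linarith
    have "a \<noteq> b"
      using less.prems(5) A by blast
    show False
    proof (cases "\<exists>c. (b, c) \<in> A")
      case True
      then obtain c where c: "(b, c) \<in> A" by blast
      then have "b \<noteq> c"
        using A by blast
      obtain f' P' where "subdivides f' P' V A" "subdivision_verts f' P' V A = subdivision_verts f P V A"
          "subdivision_arcs P' A = subdivision_arcs P A" "3 \<le> length (P' (b, c))"
        by (rule subdivides_shift [OF sub A(1) less.prems(5) c \<open>a \<noteq> b\<close> \<open>b \<noteq> c\<close> unique(1) unique(2) [OF _ c] long])
      moreover from this have "length (P' (b, c)) = 2"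
        using less.prems c U [OF c] by (intro less.IH [of c f' P' b])
          (auto simp: induced_subdivision_def intro: converse_rtrancl_into_rtrancl)
      ultimately show False by simp
    next
      case False
      then have sink: "\<And>x. (b, x) \<notin> A" by blast
      obtain f' P' where f': "subdivides f' P' V A"
        "subdivision_verts f' P' V A = subdivision_verts f P V A - {f b}"
        "subdivision_arcs P' A =
          subdivision_arcs P A \<inter> subdivision_verts f' P' V A \<times> subdivision_verts f' P' V A"
        by (rule subdivides_trim [OF sub A(1) less.prems(5) \<open>a \<noteq> b\<close> unique(1) sink long])
      have "induced_subdivision f' P' V A Y E"
        using less.prems(3) f' by (auto simp: induced_subdivision_def induced_in_def)
      from minimal [OF this] have "k \<le> card (subdivision_verts f P V A - {f b})"
        using f'(2) by simp
      moreover have "f b \<in> subdivision_verts f P V A"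
        using less.prems(5) A by (auto simp: subdivision_verts_def)
      moreover have "finite (subdivision_verts f P V A)"
        using less.prems(3) Y by (auto simp: induced_subdivision_def induced_in_def dest: finite_subset)
      ultimately show False
        using less.prems(4) by (metis card_Diff1_less linorder_not_le)
    qed
  qed
qed

text \<open>The mirror image, for legs directed towards the node: all arcs are reversed.\<close>

lemma short_path_backward:
  assumes A: "A \<subseteq> V \<times> V" "\<And>x. (x, x) \<notin> A"
    and U: "\<And>x y. (x, y) \<in> A \<Longrightarrow> y \<in> U \<Longrightarrow> x \<in> U"
    and wf: "wf (A \<inter> U \<times> U)" and Y: "finite Y"
    and minimal: "\<And>f P. induced_subdivision f P V A Y E \<Longrightarrow> k \<le> card (subdivision_verts f P V A)"
    and a: "a \<in> U" "\<And>v. (v, a) \<in> A\<^sup>* \<Longrightarrow> \<not> is_branching A v"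
    and f: "induced_subdivision f P V A Y E" "card (subdivision_verts f P V A) = k"
    and ab: "(a, b) \<in> A"
  shows "length (P (a, b)) = 2"
proof -
  let ?P = "\<lambda>(a, b). rev (P (b, a))"
  have "length (?P (b, a)) = 2"
  proof (rule short_path_forward [of "A\<inverse>" V U Y "E\<inverse>" k a f ?P b])
    show "A\<inverse> \<subseteq> V \<times> V" "\<And>x. (x, x) \<notin> A\<inverse>"
      using A by auto
    show "\<And>x y. (x, y) \<in> A\<inverse> \<Longrightarrow> x \<in> U \<Longrightarrow> y \<in> U"
      using U by auto
    have "(A\<inverse> \<inter> U \<times> U)\<inverse> = A \<inter> U \<times> U"
      by auto
    then show "wf ((A\<inverse> \<inter> U \<times> U)\<inverse>)"
      using wf by simp
    show "k \<le> card (subdivision_verts f' P' V (A\<inverse>))"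
      if "induced_subdivision f' P' V (A\<inverse>) Y (E\<inverse>)" for f' P'
    proof -
      have "subdivision_verts f' (\<lambda>(a, b). rev (P' (b, a))) V A = subdivision_verts f' P' V (A\<inverse>)"
        using subdivides_reverse(2) [of f' P' V "A\<inverse>"] that by (simp add: induced_subdivision_def)
      then show ?thesis
        using minimal [of f' "\<lambda>(a, b). rev (P' (b, a))"] induced_subdivision_reverse [OF that] by simp
    qed
    show "\<not> is_branching (A\<inverse>) v" if "(a, v) \<in> (A\<inverse>)\<^sup>*" for v
      using that a(2) by (simp add: is_branching_converse rtrancl_converse)
    show "induced_subdivision f ?P V (A\<inverse>) Y (E\<inverse>)"
      by (rule induced_subdivision_reverse [OF f(1)])
    show "card (subdivision_verts f ?P V (A\<inverse>)) = k"
      using subdivides_reverse(2) [of f P V A] f by (simp add: induced_subdivision_def)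
  qed (use a ab Y in auto)
  then show ?thesis by simp
qed

text \<open>
  In a subdivision with the fewest vertices no arc of a spider is really subdivided: away from the
  node the spare vertices of the paths can be pushed to the end of the leg and dropped there.
\<close>

lemma ex_unsubdivided:
  assumes A: "A \<subseteq> V \<times> V" "\<And>x. (x, x) \<notin> A" "finite A"
    and U: "\<And>x y. (x, y) \<in> A \<Longrightarrow> x \<in> U \<longleftrightarrow> y \<in> U"
    and acyclic: "acyclic (A \<inter> U \<times> U)" and Y: "finite Y"
    and one_node: "\<And>u v. u \<in> U \<Longrightarrow> is_branching A u \<Longrightarrow> is_branching A v \<Longrightarrow> (u, v) \<in> A\<^sup>* \<Longrightarrow> u = v"
    and ex: "induced_subdivision f0 P0 V A Y E"
  obtains f P where "induced_subdivision f P V A Y E"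
    and "\<And>a b. (a, b) \<in> A \<Longrightarrow> a \<in> U \<Longrightarrow> P (a, b) = [f a, f b]"
proof -
  define k where "k = (LEAST k. \<exists>f P. induced_subdivision f P V A Y E \<and> card (subdivision_verts f P V A) = k)"
  have "\<exists>f P. induced_subdivision f P V A Y E \<and> card (subdivision_verts f P V A) = k"
    unfolding k_def by (rule LeastI_ex) (use ex in blast)
  then obtain f P where f: "induced_subdivision f P V A Y E" "card (subdivision_verts f P V A) = k"
    by blast
  have minimal: "k \<le> card (subdivision_verts f P V A)" if "induced_subdivision f P V A Y E" for f P
    unfolding k_def by (rule Least_le) (use that in blast)
  have fin: "finite (A \<inter> U \<times> U)"
    using A by simp
  have "P (a, b) = [f a, f b]" if ab: "(a, b) \<in> A" "a \<in> U" for a b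
  proof -
    have "length (P (a, b)) = 2"
    \<comment> \<open>If a node \<open>v\<close> is reachable from \<open>b\<close>, then no node
      \<open>u\<close> reaches \<open>a\<close>: \<open>one_node\<close> would give
      \<open>u = v\<close> and hence a directed cycle through \<open>(a, b)\<close>. So spare
      vertices can be pushed either forwards or backwards.\<close>
    proof (cases "\<exists>v. (b, v) \<in> A\<^sup>* \<and> is_branching A v")
      case False
      show ?thesis
        by (rule short_path_forward [of A V U Y E k b f P a])
          (use A U finite_acyclic_wf_converse [OF fin acyclic] Y minimal False f ab in auto)
    next
      case True
      then obtain v where v: "(b, v) \<in> A\<^sup>*" "is_branching A v"
        by blast
      have "\<not> is_branching A u" if u: "(u, a) \<in> A\<^sup>*" for u
      proof
        assume branching: "is_branching A u"
        have "(u, v) \<in> A\<^sup>*"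
          using u ab(1) v(1) by (meson converse_rtrancl_into_rtrancl rtrancl_trans)
        moreover have "u \<in> U"
          using u ab(2) by (induction rule: converse_rtrancl_induct) (use U in auto)
        ultimately have "u = v"
          using one_node branching v(2) by blast
        then have "(b, a) \<in> A\<^sup>*"
          using u v(1) by simp
        moreover have "(b, x) \<in> (A \<inter> U \<times> U)\<^sup>* \<and> x \<in> U" if "(b, x) \<in> A\<^sup>*" for x
          using that
        proof (induction rule: rtrancl_induct)
          case base
          then show ?case using U [OF ab(1)] ab(2) by simp
        next
          case (step y z)
          then show ?case using U [OF step(2)] by (auto intro: rtrancl_into_rtrancl)
        qed
        ultimately have "(b, a) \<in> (A \<inter> U \<times> U)\<^sup>*"
          by blast
        moreover have "(a, b) \<in> A \<inter> U \<times> U"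
          using ab U by auto
        ultimately have "(a, a) \<in> (A \<inter> U \<times> U)\<^sup>+"
          by (rule rtrancl_into_trancl2 [rotated])
        then show False
          using acyclic by (auto simp: acyclic_def)
      qed
      then show ?thesis
        by (intro short_path_backward [of A V U Y E k a f P b])
          (use A U finite_acyclic_wf [OF fin acyclic] Y minimal f ab in auto)
    qed
    then obtain x y where "P (a, b) = [x, y]"
      by (auto simp: length_Suc_conv numeral_2_eq_2)
    then show ?thesis
      using f(1) subdividesD(4,5) [of f P V A a b] ab by (simp add: induced_subdivision_def)
  qed
  with f(1) show thesis
    by (rule that)
qed

section \<open>Induced cycles and placements\<close>

lemma set_vwalk_arcs_map_upt:
  "set (vwalk_arcs (map g [0..<n])) = {(g k, g (Suc k)) | k. Suc k < n}"
proof (induction n)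
  case (Suc n)
  show ?case
  proof (cases n)
    case (Suc m)
    have "vwalk_arcs (map g [0..<Suc n]) = vwalk_arcs (map g [0..<n]) @ [(g m, g n)]"
      using vwalk_arcs_append [of "map g [0..<n]" "[g n]"] Suc by simp
    then show ?thesis
      using Suc.IH Suc by (auto simp: less_Suc_eq)
  qed simp
qed simp

lemma funpow_in: "s ` W \<subseteq> W \<Longrightarrow> v \<in> W \<Longrightarrow> (s ^^ k) v \<in> W"
  by (induction k) auto

text \<open>
  A minimal nonempty set in which every vertex has an out-neighbour is an induced directed cycle: by
  minimality any choice of out-neighbours permutes the set, so an out-neighbour cannot be exchanged.
\<close>

lemma ex_induced_cycle:
  assumes "finite W0" "W0 \<noteq> {}" "\<And>i. i \<in> W0 \<Longrightarrow> \<exists>j \<in> W0. (i, j) \<in> E" and irrefl: "\<And>i. (i, i) \<notin> E"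
  obtains p where "2 \<le> length p" "distinct p" "set p \<subseteq> W0"
    "E \<inter> set p \<times> set p = insert (last p, hd p) (set (vwalk_arcs p))"
proof -
  define Q where "Q W \<longleftrightarrow> W \<noteq> {} \<and> W \<subseteq> W0 \<and> (\<forall>i \<in> W. \<exists>j \<in> W. (i, j) \<in> E)" for W
  have "Q W0"
    using assms by (simp add: Q_def)
  then obtain W where W: "Q W" and min: "\<And>X. Q X \<Longrightarrow> card W \<le> card X"
    using ex_min_if_finite [of "card ` {W. Q W}"] arg_min_natI [of Q W0 card] arg_min_nat_le [of Q _ card]
    by blast
  have fin: "finite W"
    using W assms(1) by (auto simp: Q_def dest: finite_subset)
  have minimal: "X = W" if "X \<subseteq> W" "X \<noteq> {}" "\<And>i. i \<in> X \<Longrightarrow> \<exists>j \<in> X. (i, j) \<in> E" for X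
  proof -
    have "Q X"
      using that W by (auto simp: Q_def)
    then show ?thesis
      using min that(1) fin by (intro card_seteq) auto
  qed
  \<comment> \<open>The image of \<open>W\<close> under a choice of out-neighbours is itself closed,
    so minimality makes it all of \<open>W\<close>.\<close>
  have perm: "s ` W = W" if "s ` W \<subseteq> W" "\<And>i. i \<in> W \<Longrightarrow> (i, s i) \<in> E" for s
  proof (rule minimal)
    show "s ` W \<noteq> {}"
      using W by (simp add: Q_def)
    show "\<exists>j \<in> s ` W. (i, j) \<in> E" if "i \<in> s ` W" for i
    proof
      show "(i, s i) \<in> E" "s i \<in> s ` W"
        using that \<open>s ` W \<subseteq> W\<close> \<open>\<And>i. i \<in> W \<Longrightarrow> (i, s i) \<in> E\<close> by auto
    qed
  qed (rule that(1))
  obtain s where s: "\<And>i. i \<in> W \<Longrightarrow> s i \<in> W" "\<And>i. i \<in> W \<Longrightarrow> (i, s i) \<in> E"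
    using W unfolding Q_def by metis
  have sW: "s ` W = W"
    by (rule perm) (use s in auto)
  have only: "j = s i" if ij: "(i, j) \<in> E" "i \<in> W" "j \<in> W" for i j
  proof (rule ccontr)
    assume "j \<noteq> s i"
    \<comment> \<open>The exchanged choice permutes \<open>W\<close> as well; but \<open>j\<close>
      is already \<open>s i'\<close> for some \<open>i'\<close> other than \<open>i\<close>, so it
      would be attained twice.\<close>
    have "(s(i := j)) ` W = W"
      by (rule perm) (use s ij in auto)
    then have inj: "inj_on (s(i := j)) W"
      using fin by (intro eq_card_imp_inj_on) auto
    obtain i' where "i' \<in> W" "j = s i'"
      using sW ij(3) by blast
    with \<open>j \<noteq> s i\<close> have "i' \<noteq> i" "(s(i := j)) i' = (s(i := j)) i"
      by auto
    then show False
      using inj_onD [OF inj, of i' i] \<open>i' \<in> W\<close> ij(2) by blast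
  qed
  have arcs: "E \<inter> W \<times> W = (\<lambda>i. (i, s i)) ` W"
    using only s by auto
  obtain v where v: "v \<in> W"
    using W by (auto simp: Q_def)
  have in_W: "(s ^^ k) x \<in> W" if "x \<in> W" for k x
    using funpow_in [of s W x k] sW that by simp
  \<comment> \<open>A forward orbit is closed, hence all of \<open>W\<close>: \<open>s\<close> is a
    single cyclic permutation.\<close>
  have orbit: "range (\<lambda>k. (s ^^ k) x) = W" if x: "x \<in> W" for x
  proof (rule minimal)
    fix i
    assume "i \<in> range (\<lambda>k. (s ^^ k) x)"
    then obtain k where k: "i = (s ^^ k) x" by blast
    then have "(i, (s ^^ Suc k) x) \<in> E"
      using s(2) in_W [OF x] by simp
    then show "\<exists>j \<in> range (\<lambda>k. (s ^^ k) x). (i, j) \<in> E"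
      by blast
  qed (use in_W [OF x] in auto)
  \<comment> \<open>Starting the orbit at \<open>s v\<close> instead of \<open>v\<close> ensures a
    return to \<open>v\<close> after a positive number of steps.\<close>
  have "v \<in> range (\<lambda>k. (s ^^ k) (s v))"
    using orbit [of "s v"] s v by simp
  then obtain k where "v = (s ^^ Suc k) v"
    by (auto simp: funpow_swap1)
  then have ex: "\<exists>n. 0 < n \<and> (s ^^ n) v = v"
    by (metis zero_less_Suc)
  define n where "n = (LEAST n. 0 < n \<and> (s ^^ n) v = v)"
  have n: "0 < n" "(s ^^ n) v = v"
    using LeastI_ex [OF ex] by (simp_all add: n_def)
  have least: "(s ^^ k) v \<noteq> v" if "0 < k" "k < n" for k
    using not_less_Least [of k "\<lambda>n. 0 < n \<and> (s ^^ n) v = v"] that by (simp add: n_def)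
  let ?p = "map (\<lambda>k. (s ^^ k) v) [0..<n]"
  have inj_s: "inj_on s W"
    using fin sW by (intro eq_card_imp_inj_on) auto
  have inj: "inj_on (s ^^ k) W" for k
  proof (induction k)
    case (Suc k)
    have "inj_on s ((s ^^ k) ` W)"
      using inj_s by (rule inj_on_subset) (use in_W in auto)
    with Suc show ?case
      unfolding funpow.simps by (rule comp_inj_on)
  qed simp
  have "inj_on (\<lambda>k. (s ^^ k) v) {0..<n}"
  proof (rule linorder_inj_onI)
    fix i j
    assume ij: "i < j" "i \<in> {0..<n}" "j \<in> {0..<n}"
    show "(s ^^ i) v \<noteq> (s ^^ j) v"
    proof
      assume "(s ^^ i) v = (s ^^ j) v"
      also have "s ^^ j = s ^^ i \<circ> s ^^ (j - i)"
        using ij by (simp flip: funpow_add)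
      finally have "(s ^^ i) v = (s ^^ i) ((s ^^ (j - i)) v)"
        by simp
      then have "(s ^^ (j - i)) v = v"
        using inj_onD [OF inj [of i] _ v in_W [OF v]] by metis
      moreover have "0 < j - i" "j - i < n"
        using ij by (simp_all add: less_imp_diff_less)
      ultimately show False
        using least by blast
    qed
  qed auto
  then have dist: "distinct ?p"
    by (simp add: distinct_map)
  have set_p: "set ?p = W"
  proof -
    have "(s ^^ k) v \<in> set ?p" for k
    proof -
      have "(s ^^ k) v = (s ^^ (k mod n)) v"
        using n(2) by (metis funpow_mod_eq)
      then show ?thesis
        using n(1) by auto
    qed
    then show ?thesis
      using orbit [OF v] by auto
  qed
  have "s v \<noteq> v"
    using s(2) [OF v] irrefl by metis
  then have "n \<noteq> 1"
    using n by auto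
  then have "2 \<le> length ?p"
    using n(1) by simp
  moreover have "E \<inter> set ?p \<times> set ?p = insert (last ?p, hd ?p) (set (vwalk_arcs ?p))"
  proof -
    obtain m where m: "n = Suc m"
      using n(1) by (cases n) auto
    have "last ?p = (s ^^ m) v" "hd ?p = v"
      using m by (simp_all add: upt_rec [of 0])
    moreover have "s ((s ^^ m) v) = v"
      using n(2) m by simp
    moreover have "set (vwalk_arcs ?p) = {((s ^^ k) v, s ((s ^^ k) v)) | k. k < m}"
      using set_vwalk_arcs_map_upt [of "\<lambda>k. (s ^^ k) v" n] m by simp
    moreover have "W = (\<lambda>k. (s ^^ k) v) ` {0..<n}"
      using set_p by (simp only: set_map set_upt)
    then have "W = {(s ^^ k) v | k. k \<le> m}"
      using m by (auto simp: less_Suc_eq_le)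
    ultimately show ?thesis
      unfolding set_p arcs by (auto simp: le_less)
  qed
  ultimately show thesis
    using dist set_p W by (intro that [of ?p]) (auto simp: Q_def)
qed

section \<open>The criterion for disjoint spiders and one directed 2-cycle\<close>

lemma ex_vwalk_arc: "w \<in> set p \<Longrightarrow> w \<noteq> last p \<Longrightarrow> \<exists>x \<in> set p. (w, x) \<in> set (vwalk_arcs p)"
  by (induction p rule: vwalk_arcs.induct) auto

text \<open>A relational summary of the pattern, with all spiders merged into \<open>U\<close> and
  \<open>S\<close>. One node per spider becomes \<open>one_node\<close>, as a directed path cannot
  leave its spider.\<close>

locale spiders_and_C2 =
  fixes U :: "'v set" and S :: "'v rel" and c d :: 'v
  assumes S: "S \<subseteq> U \<times> U" "\<And>x. (x, x) \<notin> S" "finite S" and cd: "c \<notin> U" "d \<notin> U" "c \<noteq> d"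
    and acyclic: "acyclic S"
    and one_node: "\<And>u v. is_branching S u \<Longrightarrow> is_branching S v \<Longrightarrow> (u, v) \<in> S\<^sup>* \<Longrightarrow> u = v"
begin

abbreviation "V \<equiv> U \<union> {c, d}"
abbreviation "A \<equiv> S \<union> {(c, d), (d, c)}"

text \<open>Once the spiders are unsubdivided, \<open>f\<close> itself places them. The two paths
  that replace the arcs of the 2-cycle form \<open>W\<close>, and inducedness forbids arcs between
  \<open>W\<close> and the spiders.\<close>

lemma good_placement_if_induced_subdivision:
  assumes "finite Y" and "induced_subdivision f0 P0 V A Y E"
  shows "\<exists>\<phi>. good_placement S U E Y \<phi>"
proof -
  have AU: "A \<inter> U \<times> U = S"
    using S(1) cd by auto
  have branching: "is_branching A v \<longleftrightarrow> is_branching S v" if "v \<in> U" for v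
    using that S(1) cd by (auto simp: is_branching_def)
  have reach: "(u, v) \<in> S\<^sup>* \<and> v \<in> U" if "(u, v) \<in> A\<^sup>*" "u \<in> U" for u v
    using that(1)
  proof (induction rule: rtrancl_induct)
    case base
    then show ?case using that(2) by simp
  next
    case (step y z)
    then have "(y, z) \<in> S"
      using cd by auto
    with step show ?case
      using S(1) by (auto intro: rtrancl_into_rtrancl)
  qed
  obtain f P where ind: "induced_subdivision f P V A Y E"
    and short: "\<And>a b. (a, b) \<in> A \<Longrightarrow> a \<in> U \<Longrightarrow> P (a, b) = [f a, f b]"
  proof (rule ex_unsubdivided [of A V U Y f0 P0 E])
    show "A \<subseteq> V \<times> V" "\<And>x. (x, x) \<notin> A" "finite A" "acyclic (A \<inter> U \<times> U)"
      unfolding AU using S cd acyclic by auto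
    show "\<And>x y. (x, y) \<in> A \<Longrightarrow> (x \<in> U) = (y \<in> U)"
      using S(1) cd by auto
    show "u = v" if "u \<in> U" "is_branching A u" "is_branching A v" "(u, v) \<in> A\<^sup>*" for u v
      using one_node [of u v] reach [OF that(4,1)] branching that by blast
  qed (use assms in auto)
  have sub: "subdivides f P V A"
    and Y: "subdivision_verts f P V A \<subseteq> Y"
    and E: "subdivision_arcs P A = E \<inter> subdivision_verts f P V A \<times> subdivision_verts f P V A"
    using ind by (auto simp: induced_subdivision_def induced_in_def)
  note subD = subdividesD [OF sub]
  define W where "W = set (P (c, d)) \<union> set (P (d, c))"
  define F where "F = set (vwalk_arcs (P (c, d))) \<union> set (vwalk_arcs (P (d, c)))"
  have FW: "F \<subseteq> W \<times> W"
    using vwalk_arcs_subset [of "P (c, d)"] vwalk_arcs_subset [of "P (d, c)"] by (auto simp: F_def W_def)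
  have arcs: "subdivision_arcs P A = {(f a, f b) | a b. (a, b) \<in> S} \<union> F"
  proof -
    have "(\<Union>e \<in> S. set (vwalk_arcs (P e))) = (\<Union>(a, b) \<in> S. {(f a, f b)})"
      using short S(1) by (intro SUP_cong refl) auto
    then show ?thesis
      by (auto simp: subdivision_arcs_def F_def)
  qed
  have W_eq: "W = {f c, f d} \<union> inner_vertices (P (c, d)) \<union> inner_vertices (P (d, c))"
    using subdivides_set_path [OF sub, of c d] subdivides_set_path [OF sub, of d c] by (auto simp: W_def)
  have disj: "W \<inter> f ` U = {}"
  proof -
    have "f c \<notin> f ` U" "f d \<notin> f ` U"
      using subD(1) cd by (auto dest!: inj_onD)
    then show ?thesis
      unfolding W_eq using subD(6) [of "(c, d)"] subD(6) [of "(d, c)"] by auto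
  qed
  have WV: "W \<subseteq> subdivision_verts f P V A" "f ` U \<subseteq> subdivision_verts f P V A"
    by (auto simp: W_def subdivision_verts_def)
  have E_iff: "(x, y) \<in> E \<longleftrightarrow> (x, y) \<in> {(f a, f b) | a b. (a, b) \<in> S} \<union> F"
    if "x \<in> W \<union> f ` U" "y \<in> W \<union> f ` U" for x y
    using E WV that unfolding arcs by blast
  have SU: "{(f a, f b) | a b. (a, b) \<in> S} \<subseteq> f ` U \<times> f ` U"
    using S(1) by auto
  have "good_placement S U E Y f"
    unfolding good_placement_def
  proof (intro conjI ballI exI [of _ W])
    show "f ` U \<subseteq> Y" "W \<subseteq> Y"
      using WV Y by auto
    show "inj_on f U"
      using subD(1) by (rule inj_on_subset) auto
    then have inj: "f a = f b \<longleftrightarrow> a = b" if "a \<in> U" "b \<in> U" for a b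
      using that by (auto dest: inj_onD)
    show "(f a, f b) \<in> E \<longleftrightarrow> (a, b) \<in> S" if "a \<in> U" "b \<in> U" for a b
    proof -
      have "(f a, f b) \<notin> F"
        using FW disj that by blast
      then show ?thesis
        using E_iff [of "f a" "f b"] that inj S(1) by auto
    qed
    show "W \<noteq> {}"
      by (simp add: W_eq)
    show "\<exists>j \<in> W. (i, j) \<in> E" if i: "i \<in> W" for i
    proof -
      have last: "last (P (c, d)) = f d" "last (P (d, c)) = f c"
        by (rule subD(5); simp)+
      have hd: "f c \<in> set (P (c, d))" "f d \<in> set (P (d, c))"
        using subdivides_set_path [OF sub] by auto
      have "f c \<noteq> f d"
        using subD(1) cd by (auto dest!: inj_onD)
      \<comment> \<open>Each of the two paths ends where the other starts, so every vertex of
        \<open>W\<close> is a non-final vertex of one of them.\<close>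
      then have "(i \<in> set (P (c, d)) \<and> i \<noteq> f d) \<or> (i \<in> set (P (d, c)) \<and> i \<noteq> f c)"
        using i hd by (auto simp: W_def)
      then obtain j where "j \<in> W" "(i, j) \<in> F"
        using ex_vwalk_arc [of i "P (c, d)"] ex_vwalk_arc [of i "P (d, c)"] last
        by (auto simp: W_def F_def)
      then show ?thesis
        using E_iff i by auto
    qed
    fix i a
    assume ia: "i \<in> W" "a \<in> U"
    then show "i \<noteq> f a"
      using disj by auto
    show "(i, f a) \<notin> E" "(f a, i) \<notin> E"
      using E_iff [of i "f a"] E_iff [of "f a" i] ia FW SU disj by blast+
  qed
  then show ?thesis by blast
qed

lemma induced_subdivision_if_good_placement:
  assumes "finite Y" "\<And>x. (x, x) \<notin> E" and good: "good_placement S U E Y \<phi>"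
  shows "\<exists>f P. induced_subdivision f P V A Y E"
proof -
  have "\<exists>W. W \<noteq> {} \<and> W \<subseteq> Y \<and> (\<forall>i \<in> W. \<exists>j \<in> W. (i, j) \<in> E) \<and>
      (\<forall>i \<in> W. \<forall>a \<in> U. i \<noteq> \<phi> a \<and> (i, \<phi> a) \<notin> E \<and> (\<phi> a, i) \<notin> E)"
    using good unfolding good_placement_def by (elim conjE)
  then obtain W where "W \<noteq> {} \<and> W \<subseteq> Y \<and> (\<forall>i \<in> W. \<exists>j \<in> W. (i, j) \<in> E) \<and>
      (\<forall>i \<in> W. \<forall>a \<in> U. i \<noteq> \<phi> a \<and> (i, \<phi> a) \<notin> E \<and> (\<phi> a, i) \<notin> E)"
    by (rule exE)
  then have W: "W \<noteq> {}" "W \<subseteq> Y" "\<And>i. i \<in> W \<Longrightarrow> \<exists>j \<in> W. (i, j) \<in> E"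
    and sep: "\<And>i a. i \<in> W \<Longrightarrow> a \<in> U \<Longrightarrow> i \<noteq> \<phi> a \<and> (i, \<phi> a) \<notin> E \<and> (\<phi> a, i) \<notin> E"
    by simp_all
  have \<phi>: "\<phi> ` U \<subseteq> Y" "inj_on \<phi> U" "\<And>a b. a \<in> U \<Longrightarrow> b \<in> U \<Longrightarrow> (\<phi> a, \<phi> b) \<in> E \<longleftrightarrow> (a, b) \<in> S"
    using good unfolding good_placement_def by simp_all
  have "finite W"
    using W(2) assms(1) by (rule finite_subset)
  from ex_induced_cycle [OF this W(1,3) assms(2)] obtain p where p: "2 \<le> length p" "distinct p" "set p \<subseteq> W"
    "E \<inter> set p \<times> set p = insert (last p, hd p) (set (vwalk_arcs p))"
    by metis
  obtain x y r where xyr: "p = x # y # r"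
    using p(1) by (cases p rule: vwalk_arcs.cases) auto
  \<comment> \<open>The first two vertices of the induced cycle become the images of
    \<open>c\<close> and \<open>d\<close>: \<open>(c, d)\<close> stays an arc, and the path for
    \<open>(d, c)\<close> runs through the rest of the cycle.\<close>
  define f where "f = \<phi>(c := x, d := y)"
  define P where "P = (\<lambda>(a, b). if (a, b) = (c, d) then [x, y] else if (a, b) = (d, c) then y # r @ [x] else [\<phi> a, \<phi> b])"
  have f: "f c = x" "f d = y" "\<And>a. a \<in> U \<Longrightarrow> f a = \<phi> a"
    using cd by (auto simp: f_def)
  have P: "P (c, d) = [x, y]" "P (d, c) = y # r @ [x]" "\<And>a b. (a, b) \<in> S \<Longrightarrow> P (a, b) = [\<phi> a, \<phi> b]"
    using cd S(1) by (auto simp: P_def)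
  have fV: "f ` V = \<phi> ` U \<union> {x, y}"
  proof -
    have "f ` U = \<phi> ` U"
      by (rule image_cong [OF refl f(3)])
    moreover have "f ` V = f ` U \<union> {f c, f d}"
      by (simp only: image_Un image_insert image_empty)
    ultimately show ?thesis
      by (simp only: f)
  qed
  have disj: "set p \<inter> \<phi> ` U = {}"
    using p(3) sep by blast
  have in_A: "(\<And>a b. (a, b) \<in> S \<Longrightarrow> Q (a, b)) \<Longrightarrow> Q (c, d) \<Longrightarrow> Q (d, c) \<Longrightarrow> \<forall>e \<in> A. Q e" for Q
    by auto
  have inner: "inner_vertices (P (c, d)) = {}" "inner_vertices (P (d, c)) = set r"
    "\<And>a b. (a, b) \<in> S \<Longrightarrow> inner_vertices (P (a, b)) = {}"
    unfolding P by (simp_all add: P inner_vertices_def)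
  have "subdivides f P V A"
    unfolding subdivides_def
  proof (intro conjI)
    show "inj_on f V"
      using \<phi>(2) disj cd p(2) xyr by (auto simp: inj_on_def f_def)
    have "\<forall>e \<in> A. distinct (P e) \<and> 2 \<le> length (P e) \<and> hd (P e) = f (fst e) \<and> last (P e) = f (snd e)"
    proof (rule in_A)
      fix a b
      assume ab: "(a, b) \<in> S"
      then have "a \<in> U" "b \<in> U" "a \<noteq> b"
        using S by auto
      then show "distinct (P (a, b)) \<and> 2 \<le> length (P (a, b)) \<and>
          hd (P (a, b)) = f (fst (a, b)) \<and> last (P (a, b)) = f (snd (a, b))"
        unfolding P(3) [OF ab] using f(3) \<phi>(2) by (auto dest: inj_onD)
    qed (use p(2) xyr cd in \<open>auto simp: P f\<close>)
    then show "\<forall>a b. (a, b) \<in> A \<longrightarrow> distinct (P (a, b)) \<and> 2 \<le> length (P (a, b)) \<and>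
        hd (P (a, b)) = f a \<and> last (P (a, b)) = f b"
      by fastforce
    show "\<forall>e \<in> A. inner_vertices (P e) \<inter> f ` V = {}"
      unfolding fV by (rule in_A; unfold inner) (use disj p(2) xyr inner in auto)
    show "\<forall>e \<in> A. \<forall>e' \<in> A. e \<noteq> e' \<longrightarrow> inner_vertices (P e) \<inter> inner_vertices (P e') = {}"
    proof (intro ballI impI)
      fix e e'
      assume e: "e \<in> A" "e' \<in> A" "e \<noteq> e'"
      have "e = (d, c) \<or> inner_vertices (P e) = {}" if "e \<in> A" for e
        using that inner by (cases e) auto
      then show "inner_vertices (P e) \<inter> inner_vertices (P e') = {}"
        using e by blast
    qed
  qed
  moreover have verts: "subdivision_verts f P V A = \<phi> ` U \<union> set p"
  proof -
    have "(\<Union>e \<in> S. set (P e)) \<subseteq> \<phi> ` U"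
      using S(1) P(3) by fastforce
    moreover have "(\<Union>e \<in> A. set (P e)) = (\<Union>e \<in> S. set (P e)) \<union> set (P (c, d)) \<union> set (P (d, c))"
      by blast
    ultimately show ?thesis
      unfolding subdivision_verts_def fV P using xyr by auto
  qed
  moreover have "subdivision_arcs P A = {(\<phi> a, \<phi> b) | a b. (a, b) \<in> S} \<union> E \<inter> set p \<times> set p"
  proof -
    have "(\<Union>e \<in> S. set (vwalk_arcs (P e))) = (\<Union>(a, b) \<in> S. {(\<phi> a, \<phi> b)})"
      using P(3) by (intro SUP_cong refl) auto
    moreover have "(\<Union>e \<in> A. set (vwalk_arcs (P e))) = (\<Union>e \<in> S. set (vwalk_arcs (P e))) \<union>
        set (vwalk_arcs (P (c, d))) \<union> set (vwalk_arcs (P (d, c)))"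
      by blast
    moreover have "set (vwalk_arcs (P (c, d))) \<union> set (vwalk_arcs (P (d, c))) = E \<inter> set p \<times> set p"
      unfolding P p(4) using vwalk_arcs_append [of "y # r" "[x]"] by (simp add: xyr)
    ultimately show ?thesis
      unfolding subdivision_arcs_def by auto
  qed
  \<comment> \<open>\<open>sep\<close> excludes arcs between spiders and cycle, so the union of the
    two induced parts is induced.\<close>
  moreover have "{(\<phi> a, \<phi> b) | a b. (a, b) \<in> S} \<union> E \<inter> set p \<times> set p =
      E \<inter> (\<phi> ` U \<union> set p) \<times> (\<phi> ` U \<union> set p)"
    using \<phi>(3) sep p(3) S(1) by auto
  ultimately have "induced_subdivision f P V A Y E"
    using \<phi>(1) p(3) W(2) by (auto simp: induced_subdivision_def induced_in_def)
  then show ?thesis by blast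
qed

end

text \<open>A directed closed walk may repeat vertices, so \<open>ex_induced_cycle\<close> is reused
  to extract a genuine cycle. Its length is not two because the tree is oriented, and from length
  three on it is an undirected cycle.\<close>

lemma acyclic_oriented_tree:
  assumes "oriented_tree T"
  shows "acyclic (parcs T)"
proof (rule ccontr)
  assume "\<not> acyclic (parcs T)"
  then obtain x where x: "(x, x) \<in> (parcs T)\<^sup>+"
    by (auto simp: acyclic_def)
  interpret T: pair_digraph T
    using assms by (simp add: oriented_tree_def)
  \<comment> \<open>The vertices on closed walks through \<open>x\<close>; the next vertex on such a
    walk is again one of them.\<close>
  let ?W = "{y. (x, y) \<in> (parcs T)\<^sup>* \<and> (y, x) \<in> (parcs T)\<^sup>+}"
  have W: "?W \<subseteq> pverts T"
    using T.in_arcsD1 by (auto dest!: tranclD)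
  have no_loops: "(i, i) \<notin> parcs T" for i
    using T.pair_no_loops [of "(i, i)"] by auto
  have succ: "\<exists>j \<in> ?W. (i, j) \<in> parcs T" if i: "i \<in> ?W" for i
  proof -
    obtain j where j: "(i, j) \<in> parcs T" "(j, x) \<in> (parcs T)\<^sup>*"
      using i by (auto dest: tranclD)
    then have "(x, j) \<in> (parcs T)\<^sup>*"
      using i by (auto intro: rtrancl_into_rtrancl)
    moreover have "(j, x) \<in> (parcs T)\<^sup>+"
      using j(2) x by (rule rtrancl_trancl_trancl)
    ultimately show ?thesis
      using j(1) by blast
  qed
  have W': "finite ?W" "?W \<noteq> {}"
    using W T.pair_finite_verts x by (auto dest: finite_subset)
  obtain p where p: "2 \<le> length p" "distinct p"
    "set p \<subseteq> ?W" "parcs T \<inter> set p \<times> set p = insert (last p, hd p) (set (vwalk_arcs p))"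
    by (rule ex_induced_cycle [OF W' succ no_loops])
  have arcs: "(last p, hd p) \<in> parcs T" "set (vwalk_arcs p) \<subseteq> parcs T"
    using p(4) by blast+
  have "length p \<noteq> 2"
  proof
    assume "length p = 2"
    then obtain u v where "p = [u, v]"
      by (auto simp: length_Suc_conv numeral_2_eq_2)
    then have "(u, v) \<in> parcs T" "(v, u) \<in> parcs T"
      using arcs by auto
    then show False
      using assms by (auto simp: oriented_tree_def)
  qed
  then have "3 \<le> length p"
    using p(1) by simp
  moreover have "vpath p (with_proj (mk_symmetric (with_proj T)))"
  proof -
    have "set p \<subseteq> pverts T"
      using p(3) W by blast
    moreover have "set (vwalk_arcs p) \<subseteq> parcs (mk_symmetric (with_proj T))"
      using arcs(2) by (fastforce simp: parcs_mk_symmetric)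
    ultimately show ?thesis
      using p(1,2) by (auto simp: vpath_def vwalk_def)
  qed
  moreover have "(last p, hd p) \<in> parcs (mk_symmetric (with_proj T))"
    using arcs(1) by (force simp: parcs_mk_symmetric)
  ultimately show False
    using assms unfolding oriented_tree_def by blast
qed

lemma two_le_card: "finite X \<Longrightarrow> x \<in> X \<Longrightarrow> y \<in> X \<Longrightarrow> x \<noteq> y \<Longrightarrow> 2 \<le> card X"
  using card_mono [of X "{x, y}"] by simp

lemma is_node_if_is_branching:
  assumes "pair_digraph T" "is_branching (parcs T) v"
  shows "is_node T v"
proof -
  interpret T: pair_digraph T by (rule assms)
  have fin: "finite (out_arcs (with_proj T) v)" "finite (in_arcs (with_proj T) v)"
    using T.pair_finite_arcs by (auto simp: out_arcs_def in_arcs_def)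
  obtain x y where xy: "x \<noteq> y" and
    "(x, v) \<in> parcs T \<and> (y, v) \<in> parcs T \<or> (v, x) \<in> parcs T \<and> (v, y) \<in> parcs T"
    using assms(2) by (auto simp: is_branching_def)
  then consider "(x, v) \<in> parcs T" "(y, v) \<in> parcs T" | "(v, x) \<in> parcs T" "(v, y) \<in> parcs T"
    by blast
  then show ?thesis
  proof cases
    case 1
    then have "2 \<le> card (in_arcs (with_proj T) v)"
      using xy by (intro two_le_card [OF fin(2), of "(x, v)" "(y, v)"]) (auto simp: in_arcs_def)
    then show ?thesis
      using 1 T.in_arcsD2 by (auto simp: is_node_def in_degree_def)
  next
    case 2
    then have "2 \<le> card (out_arcs (with_proj T) v)"
      using xy by (intro two_le_card [OF fin(1), of "(v, x)" "(v, y)"]) (auto simp: out_arcs_def)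
    then show ?thesis
      using 2 T.in_arcsD1 by (auto simp: is_node_def out_degree_def)
  qed
qed

text \<open>Disjointness confines every directed walk to one component, where acyclicity and
  uniqueness of the node are available.\<close>

lemma ex_spiders_and_C2:
  fixes D C :: "'a pair_pre_digraph"
  assumes D: "pair_digraph D" and spiders: "\<forall>T \<in> \<S>. spider T" and "is_C2 C"
    and union: "is_disjoint_union D (insert C \<S>)"
  obtains U S c d where "spiders_and_C2 U S c d" "finite U" "pverts D = U \<union> {c, d}"
    "parcs D = S \<union> {(c, d), (d, c)}"
proof -
  obtain c d where C: "c \<noteq> d" "pverts C = {c, d}" "parcs C = {(c, d), (d, c)}"
    using \<open>is_C2 C\<close> by (auto simp: is_C2_def)
  interpret D: pair_digraph D by (rule D)
  let ?U = "\<Union>T \<in> \<S>. pverts T" and ?S = "\<Union>T \<in> \<S>. parcs T"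
  have tree: "oriented_tree T" and digraph: "pair_digraph T" if "T \<in> \<S>" for T
    using spiders that by (auto simp: spider_def oriented_tree_def)
  have arcs_verts: "(x, y) \<in> parcs T \<Longrightarrow> x \<in> pverts T \<and> y \<in> pverts T" if "T \<in> \<S>" for T x y
  proof -
    interpret T: pair_digraph T by (rule digraph [OF that])
    show "(x, y) \<in> parcs T \<Longrightarrow> x \<in> pverts T \<and> y \<in> pverts T"
      using T.in_arcsD1 T.in_arcsD2 by blast
  qed
  have disjoint_components:
    "\<forall>H \<in> insert C \<S>. \<forall>K \<in> insert C \<S>. H \<noteq> K \<longrightarrow> pverts H \<inter> pverts K = {}"
    using union unfolding is_disjoint_union_def by (elim conjE)
  have disjoint: "T = T'" if "T \<in> \<S>" "T' \<in> \<S>" "x \<in> pverts T" "x \<in> pverts T'" for T T' x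
    using disjoint_components [rule_format, of T T'] that by auto
  \<comment> \<open>The components form a set, so the 2-cycle must be told apart from the spiders
    before disjointness separates them.\<close>
  have "C \<notin> \<S>"
  proof
    assume "C \<in> \<S>"
    then have "oriented_tree C"
      by (rule tree)
    then have "\<forall>u v. (u, v) \<in> parcs C \<longrightarrow> (v, u) \<notin> parcs C"
      unfolding oriented_tree_def by (elim conjE)
    then show False
      using C(3) by (auto dest: spec [of _ c])
  qed
  then have disjoint_C: "pverts T \<inter> {c, d} = {}" if "T \<in> \<S>" for T
    using disjoint_components [rule_format, of T C] that C(2) by auto
  have verts: "pverts D = ?U \<union> {c, d}" and arcs: "parcs D = ?S \<union> {(c, d), (d, c)}"
    using union C by (auto simp: is_disjoint_union_def)
  have component: "(x, y) \<in> parcs T" if "T \<in> \<S>" "(x, y) \<in> ?S" "x \<in> pverts T \<or> y \<in> pverts T" for T x y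
    using that arcs_verts disjoint by blast
  have reach: "(x, y) \<in> (parcs T)\<^sup>*" if T: "T \<in> \<S>" "x \<in> pverts T" and xy: "(x, y) \<in> ?S\<^sup>*" for T x y
  proof -
    have "(x, y) \<in> (parcs T)\<^sup>* \<and> y \<in> pverts T"
      using xy
    proof (induction rule: rtrancl_induct)
      case base
      then show ?case using T by simp
    next
      case (step y z)
      then have "(y, z) \<in> parcs T"
        using component T by blast
      with step arcs_verts T show ?case
        by (meson rtrancl_into_rtrancl)
    qed
    then show ?thesis by simp
  qed
  have "spiders_and_C2 ?U ?S c d"
  proof
    show "?S \<subseteq> ?U \<times> ?U"
      using arcs_verts by fast
    show "(x, x) \<notin> ?S" for x
    proof -
      have "(x, x) \<notin> parcs D"
        using D.pair_no_loops [of "(x, x)"] by auto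
      then show ?thesis
        unfolding arcs by simp
    qed
    show "finite ?S"
      using D.pair_finite_arcs unfolding arcs by simp
    show "c \<notin> ?U" "d \<notin> ?U" "c \<noteq> d"
      using disjoint_C C by blast+
    show "acyclic ?S"
      unfolding acyclic_def
    proof (intro allI notI)
      fix x
      assume "(x, x) \<in> ?S\<^sup>+"
      then obtain y where y: "(x, y) \<in> ?S" "(y, x) \<in> ?S\<^sup>*"
        by (meson tranclD)
      then obtain T where T: "T \<in> \<S>" "(x, y) \<in> parcs T"
        by blast
      then have "(y, x) \<in> (parcs T)\<^sup>*"
        using reach y(2) arcs_verts by blast
      with T(2) have "(x, x) \<in> (parcs T)\<^sup>+"
        by (rule rtrancl_into_trancl2)
      then show False
        using acyclic_oriented_tree [OF tree [OF T(1)]] by (auto simp: acyclic_def)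
    qed
    show "u = v" if uv: "is_branching ?S u" "is_branching ?S v" "(u, v) \<in> ?S\<^sup>*" for u v
    proof -
      obtain T where T: "T \<in> \<S>" "u \<in> pverts T"
        using uv(1) arcs_verts unfolding is_branching_def by blast
      have "v \<in> pverts T"
        using reach [OF T uv(3)] T arcs_verts by (auto elim: rtranclE)
      then have br: "is_branching (parcs T) u" "is_branching (parcs T) v"
        using uv T component unfolding is_branching_def by blast+
      note node = is_node_if_is_branching [OF digraph [OF T(1)]]
      have "is_node T u" "is_node T v"
        by (rule node, rule br)+
      then show ?thesis
        using spiders T(1) by (auto simp: spider_def)
    qed
  qed
  moreover have "finite ?U"
    using D.pair_finite_verts unfolding verts by simp
  ultimately show thesis
    using verts arcs by (rule that)
qed

section \<open>Words and the digraphs they encode\<close>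

lemma nth_concat_matrix:
  assumes "i < k" "j < n"
  shows "concat (map (\<lambda>u. map (f u) [0..<n]) [0..<k]) ! (i * n + j) = f i j"
  using assms(1)
proof (induction k)
  case (Suc k)
  have len: "length (concat (map (\<lambda>u. map (f u) [0..<n]) [0..<k])) = k * n"
    by (simp add: length_concat comp_def sum_list_triv)
  show ?case
  proof (cases "i < k")
    case True
    then have "Suc i * n \<le> k * n"
      by (intro mult_le_mono1) simp
    then have "i * n + j < k * n"
      using assms(2) by simp
    then show ?thesis
      using Suc.IH True by (simp add: nth_append len)
  next
    case False
    then have "i = k"
      using Suc.prems by simp
    then show ?thesis
      using assms(2) by (simp add: nth_append len)
  qed
qed simp

lemma encode_digraph_eq:
  assumes "pverts G = {..<n}"
  shows "encode_digraph G = replicate n True @ False #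
    concat (map (\<lambda>u. map (\<lambda>v. (u, v) \<in> parcs G) [0..<n]) [0..<n])"
  using assms by (simp add: encode_digraph_def)

lemma encode_digraph_props:
  assumes "pverts G = {..<n}"
  shows "length (encode_digraph G) = n + 1 + n * n"
    and "i < n \<Longrightarrow> encode_digraph G ! i"
    and "\<not> encode_digraph G ! n"
    and "i < n \<Longrightarrow> j < n \<Longrightarrow> matrix_entry (encode_digraph G) n i j \<longleftrightarrow> (i, j) \<in> parcs G"
proof -
  show "length (encode_digraph G) = n + 1 + n * n"
    unfolding encode_digraph_eq [OF assms] by (simp add: length_concat comp_def sum_list_triv)
  show "i < n \<Longrightarrow> encode_digraph G ! i" "\<not> encode_digraph G ! n"
    unfolding encode_digraph_eq [OF assms] by (simp_all add: nth_append)
  show "matrix_entry (encode_digraph G) n i j \<longleftrightarrow> (i, j) \<in> parcs G" if "i < n" "j < n"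
    using nth_concat_matrix [OF that, of "\<lambda>u v. (u, v) \<in> parcs G"]
    unfolding encode_digraph_eq [OF assms] matrix_entry_def by (simp add: nth_append)
qed

text \<open>The correctly formatted words with empty diagonal are exactly the codes of digraphs, so
  the criterion is only needed for digraphs.\<close>

lemma induced_subdivision_problem_eq:
  assumes "\<And>G :: nat pair_pre_digraph. pair_digraph G \<Longrightarrow>
      contains_induced_subdivision G D \<longleftrightarrow> (\<exists>\<phi>. good_placement S U (parcs G) (pverts G) \<phi>)"
  shows "induced_subdivision_problem D = {w. accepted S U w}"
proof (intro set_eqI iffI)
  fix w
  assume "w \<in> induced_subdivision_problem D"
  then obtain G n where w: "w = encode_digraph G" and G: "pair_digraph G" "pverts G = {..<n}"
    and "contains_induced_subdivision G D"
    by (auto simp: induced_subdivision_problem_def input_digraph_def)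
  then obtain \<phi> where \<phi>: "good_placement S U (parcs G) {..<n} \<phi>"
    using assms by metis
  interpret G: pair_digraph G by (rule G(1))
  note props = encode_digraph_props [OF G(2), folded w]
  have arcs: "{(i, j). i < n \<and> j < n \<and> matrix_entry w n i j} = parcs G"
    using G.in_arcsD1 G.in_arcsD2 G(2) props(4) by auto
  have "(i, i) \<notin> parcs G" for i
    using G.pair_no_loops [of "(i, i)"] by auto
  then have "\<forall>i < n. \<not> matrix_entry w n i i"
    using props(4) by simp
  then show "w \<in> {w. accepted S U w}"
    unfolding accepted_def mem_Collect_eq
    by (intro exI [of _ n] conjI exI [of _ \<phi>]) (simp_all add: props arcs \<phi>)
next
  fix w
  assume "w \<in> {w. accepted S U w}"
  then obtain n \<phi> where w: "length w = n + 1 + n * n" "\<forall>i < n. w ! i" "\<not> w ! n"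
      "\<forall>i < n. \<not> matrix_entry w n i i"
    and \<phi>: "good_placement S U {(i, j). i < n \<and> j < n \<and> matrix_entry w n i j} {..<n} \<phi>"
    unfolding accepted_def by blast
  \<comment> \<open>The digraph decoded from \<open>w\<close>; the empty diagonal of the matrix
    excludes loops.\<close>
  define G where "G = \<lparr>pverts = {..<n}, parcs = {(i, j). i < n \<and> j < n \<and> matrix_entry w n i j}\<rparr>"
  have verts: "pverts G = {..<n}"
    by (simp add: G_def)
  have "finite (parcs G)"
    by (rule finite_subset [of _ "{..<n} \<times> {..<n}"]) (auto simp: G_def)
  then have G: "pair_digraph G"
    by unfold_locales (use w(4) in \<open>auto simp: G_def\<close>)
  note props = encode_digraph_props [OF verts]
  have "encode_digraph G = w"
  proof (rule nth_equalityI)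
    show "length (encode_digraph G) = length w"
      using props(1) w(1) by simp
    fix k
    assume "k < length (encode_digraph G)"
    then have k: "k < n + 1 + n * n"
      using props(1) by simp
    consider "k < n" | "k = n" | "n < k" by linarith
    then show "encode_digraph G ! k = w ! k"
    proof cases
      case 3
      then have "\<exists>q < n * n. k = n + 1 + q"
        using k by (intro exI [of _ "k - (n + 1)"]) auto
      then obtain i j where ij: "i < n" "j < n" "k = n + 1 + (i * n + j)"
        unfolding ex_less_square_iff [symmetric] by blast
      then show ?thesis
        using props(4) [OF ij(1,2)] by (simp add: matrix_entry_def G_def)
    qed (use props w in auto)
  qed
  moreover have "contains_induced_subdivision G D"
    using assms [OF G] \<phi> by (auto simp: G_def)
  ultimately show "w \<in> induced_subdivision_problem D"
    unfolding induced_subdivision_problem_def input_digraph_def using G verts by blast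
qed

theorem proposition4:
  fixes D C :: "'a pair_pre_digraph"
    and \<S> :: "'a pair_pre_digraph set"
  assumes "pair_digraph D"
    and "\<forall>S \<in> \<S>. spider S"
    and "is_C2 C"
    and "is_disjoint_union D (insert C \<S>)"
  shows "polynomial_time_decidable (induced_subdivision_problem D)"
proof -
  obtain U S c d where "spiders_and_C2 U S c d" "finite U" and D: "pverts D = U \<union> {c, d}"
    "parcs D = S \<union> {(c, d), (d, c)}"
    by (rule ex_spiders_and_C2 [OF assms])
  then interpret spiders_and_C2 U S c d by simp
  have "contains_induced_subdivision G D \<longleftrightarrow> (\<exists>\<phi>. good_placement S U (parcs G) (pverts G) \<phi>)"
    if G: "pair_digraph G" for G :: "nat pair_pre_digraph"
  proof -
    interpret G: pair_digraph G by (rule G)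
    have "(x, x) \<notin> parcs G" for x
      using G.pair_no_loops [of "(x, x)"] by auto
    then show ?thesis
      unfolding contains_induced_subdivision_iff [OF G] D induced_subdivision_def [symmetric]
      using good_placement_if_induced_subdivision induced_subdivision_if_good_placement
        G.pair_finite_verts by blast
  qed
  then have "induced_subdivision_problem D = {w. accepted S U w}"
    by (rule induced_subdivision_problem_eq)
  then show ?thesis
    using polynomial_time_decidable_accepted [OF \<open>finite U\<close>] by simp
qed

end
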